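(* Let $N\ge2$ and let $M$ be a strictly pseudoconvex CR manifold of dimension $2N-1$ with CR $Q$-curvature $Q^{\mathrm{CR}}_\theta$ associated with each contact form $\theta$. Let $\mathcal P$ denote the space of CR pluriharmonic functions on $M$. Then $$e^{2N\Upsilon}Q^{\mathrm{CR}}_{\widehat\theta}=Q^{\mathrm{CR}}_\theta\qquad\text{whenever }\widehat\theta=e^{2\Upsilon}\theta\text{ with }\Upsilon\in\mathcal P.$$
   Context: A real function on $M$ is CR pluriharmonic if it is locally the real part of a CR function. Definition of $Q^{\mathrm{CR}}_\theta$. First let $M$ be (locally) a strictly pseudoconvex real hypersurface in $\mathbb C^N$. Let $$J[\rho]=(-1)^N\det\begin{pmatrix}\rho&\rho_j\\ \rho_{\overline k}&\rho_{j\overline k}\end{pmatrix},\qquad \rho_j=\partial\rho/\partial z_j,\ \text{etc.}$$ There is a smooth defining function $u$ of $M$, positive on the pseudoconvex side, with $J[u]=1+O(u^{N+1})$, unique modulo $O(u^{N+2})$. On $\widetilde{\mathcal G}=\mathbb C^*\times\widetilde M$, $\widetilde M$ a small collar neighborhood of $M$, with coordinates $(z_0,z)$, let $\widetilde g=\widetilde g[u]$ be the Lorentz–Kähler metric $$\widetilde g[u]=-\sum_{j,k=0}^N\frac{\partial^2(|z_0|^2u(z))}{\partial z_j\partial\overline z_k}\,dz_jd\overline z_k,$$ and $\widetilde\Delta=-\widetilde\nabla_I\widetilde\nabla^I$ its Laplacian. Let $\theta[u]=\mathrm{Im}\,\partial u|_{TM}$; contact forms on $M$ are oriented so as to be positive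 multiples of $\theta[u]$. The metric $\widetilde g[u]$ restricts to a Lorentz metric $g[\theta[u]]$ on $S^1\times M=\{|z_0|=1\}$, and for a general contact form $\theta=e^{2\Upsilon}\theta[u]$ one sets $g[\theta]=e^{2\Upsilon}g[\theta[u]]$. The metric bundle of the resulting conformal class on $S^1\times M$ (of dimension $2N$) is $\mathcal G=\mathbb C^*\times M$, the point $(z_0,z)$ corresponding to $|z_0|^2g[\theta[u]]$ at $(z_0/|z_0|,z)$, and $\widetilde g[u]$ is an ambient metric for it. For $g=g[\theta]$, let $t$ be a positive function on $\widetilde{\mathcal G}$ near $\mathcal G$, homogeneous of degree 1 in $|z_0|$, with $t=e^{-\Upsilon}|z_0|$ on $\mathcal G$; then $Q_g=-(\widetilde\Delta^N\log t)\circ g$, i.e. $-\widetilde\Delta^N\log t$ evaluated on $\{t=1\}\cap\mathcal G$. It is independent of the extension of $t$ off $\mathcal G$ and $S^1$-invariant, and $Q^{\mathrm{CR}}_\theta=\pi_*Q_g$ is the function on $M$ it induces, $\pi:S^1\times M\to M$ being the projection. The value of $Q^{\mathrm{CR}}_\theta$ at a point depends only on $\theta$ and on the (infinite) jet of the CR structure and of $\theta$ at that point, not on the embedding; it is a local invariant of the pseudohermitian structure $\theta$. Through local (formal) embeddings into $\mathbb C^N$ it is therefore defined on abstract strictly pseudoconvex CR manifolds. *)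

theory Defs
  imports "HOL-Analysis.Analysis"
begin

section \<open>Calculus in coordinates\<close>

definition dir_deriv ::
  "'a::real_normed_vector \<Rightarrow> ('a \<Rightarrow> 'b::real_normed_vector) \<Rightarrow> 'a \<Rightarrow> 'b" where
  "dir_deriv v f x = frechet_derivative f (at x) v"

text \<open>Both notions below are meant for open sets \<open>S\<close>.\<close>

primrec Ck_on ::
  "nat \<Rightarrow> 'a::euclidean_space set \<Rightarrow> ('a \<Rightarrow> 'b::real_normed_vector) \<Rightarrow> bool" where
  "Ck_on 0 S f \<longleftrightarrow> continuous_on S f"
| "Ck_on (Suc k) S f \<longleftrightarrow> f differentiable_on S \<and> (\<forall>v. Ck_on k S (dir_deriv v f))"

definition smooth_on :: "'a::euclidean_space set \<Rightarrow> ('a \<Rightarrow> 'b::real_normed_vector) \<Rightarrow> bool" where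
  "smooth_on S f \<longleftrightarrow> (\<forall>k. Ck_on k S f)"

text \<open>Vanishing to infinite order at \<open>a\<close>; for smooth \<open>f\<close> this says that the Taylor series is zero.\<close>

definition flat_at :: "('a::real_normed_vector \<Rightarrow> 'b::real_normed_vector) \<Rightarrow> 'a \<Rightarrow> bool" where
  "flat_at f a \<longleftrightarrow>
     (\<forall>k::nat. \<exists>C. \<forall>\<^sub>F x in nhds a. norm (f x) \<le> C * norm (x - a) ^ k)"

text \<open>The Wirtinger derivatives \<open>\<partial>f/\<partial>z\<^sub>j\<close> and their conjugates.\<close>

definition dz :: "'m::finite \<Rightarrow> (complex^'m \<Rightarrow> complex) \<Rightarrow> complex^'m \<Rightarrow> complex" where
  "dz j f x = (dir_deriv (axis j 1) f x - \<i> * dir_deriv (axis j \<i>) f x) / 2"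

definition dzbar :: "'m::finite \<Rightarrow> (complex^'m \<Rightarrow> complex) \<Rightarrow> complex^'m \<Rightarrow> complex" where
  "dzbar j f x = (dir_deriv (axis j 1) f x + \<i> * dir_deriv (axis j \<i>) f x) / 2"

section \<open>Pseudo-Riemannian Laplacian in real coordinates\<close>

text \<open>
  The real coordinates of \<open>complex^'m\<close> are indexed by \<open>'m \<times> bool\<close>: the index \<open>(j, False)\<close>
  belongs to \<open>Re z\<^sub>j\<close> and \<open>(j, True)\<close> to \<open>Im z\<^sub>j\<close>.
  A metric is given by the field of its Gram matrices.
\<close>

definition cframe :: "'m::finite \<times> bool \<Rightarrow> complex^'m" where
  "cframe I = axis (fst I) (if snd I then \<i> else 1)"

definition christoffel ::
  "(complex^'m::finite \<Rightarrow> real^('m \<times> bool)^('m \<times> bool)) \<Rightarrow>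
   'm \<times> bool \<Rightarrow> 'm \<times> bool \<Rightarrow> 'm \<times> bool \<Rightarrow> complex^'m \<Rightarrow> real" where
  "christoffel g K I J x =
     (\<Sum>L\<in>UNIV. matrix_inv (g x) $ K $ L *
        (dir_deriv (cframe I) (\<lambda>y. g y $ J $ L) x
         + dir_deriv (cframe J) (\<lambda>y. g y $ I $ L) x
         - dir_deriv (cframe L) (\<lambda>y. g y $ I $ J) x)) / 2"

text \<open>The sign is that of \<open>- \<nabla>\<^sub>I \<nabla>\<^sup>I\<close>.\<close>

definition laplacian ::
  "(complex^'m::finite \<Rightarrow> real^('m \<times> bool)^('m \<times> bool)) \<Rightarrow>
   (complex^'m \<Rightarrow> real) \<Rightarrow> complex^'m \<Rightarrow> real" where
  "laplacian g f x =
     - (\<Sum>I\<in>UNIV. \<Sum>J\<in>UNIV. matrix_inv (g x) $ I $ J *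
          (dir_deriv (cframe I) (dir_deriv (cframe J) f) x
           - (\<Sum>K\<in>UNIV. christoffel g K I J x * dir_deriv (cframe K) f x)))"

section \<open>Strictly pseudoconvex real hypersurfaces and the ambient metric\<close>

text \<open>The index \<open>None\<close> is the one of the undifferentiated row and column.\<close>

definition fefferman_J :: "(complex^'n::finite \<Rightarrow> real) \<Rightarrow> complex^'n \<Rightarrow> complex" where
  "fefferman_J \<rho> z = (-1) ^ CARD('n) *
     det ((\<chi> a b.
       (let r = (\<lambda>w. complex_of_real (\<rho> w)) in
        case (a, b) of
          (None, None) \<Rightarrow> r z
        | (None, Some j) \<Rightarrow> dz j r z
        | (Some k, None) \<Rightarrow> dzbar k r z
        | (Some k, Some j) \<Rightarrow> dzbar k (dz j r) z)) :: complex^('n option)^('n option))"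

text \<open>
  \<open>u\<close> defines the hypersurface \<open>{u = 0}\<close> in \<open>W\<close>, and \<open>{u > 0}\<close> is its pseudoconvex side:
  the Levi form of \<open>- u\<close> is positive definite on the complex tangent spaces.
\<close>

definition pseudoconvex_defining :: "(complex^'n::finite) set \<Rightarrow> (complex^'n \<Rightarrow> real) \<Rightarrow> bool" where
  "pseudoconvex_defining W u \<longleftrightarrow> open W \<and> smooth_on W u \<and>
     (let r = (\<lambda>w. complex_of_real (u w)) in
      \<forall>z\<in>W. u z = 0 \<longrightarrow>
        (\<exists>j. dz j r z \<noteq> 0) \<and>
        (\<forall>v. v \<noteq> 0 \<and> (\<Sum>j\<in>UNIV. dz j r z * v $ j) = 0 \<longrightarrow>
           0 < - Re (\<Sum>j\<in>UNIV. \<Sum>k\<in>UNIV. dzbar k (dz j r) z * v $ j * cnj (v $ k))))"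

definition fefferman_defining :: "(complex^'n::finite) set \<Rightarrow> (complex^'n \<Rightarrow> real) \<Rightarrow> bool" where
  "fefferman_defining W u \<longleftrightarrow> pseudoconvex_defining W u \<and>
     (\<exists>C. \<forall>z\<in>W. cmod (fefferman_J u z - 1) \<le> C * \<bar>u z\<bar> ^ (CARD('n) + 1))"

text \<open>The form \<open>Im \<partial>u\<close> at \<open>z\<close>, evaluated on the real tangent vector \<open>v\<close>.\<close>

definition im_del :: "(complex^'n::finite \<Rightarrow> real) \<Rightarrow> complex^'n \<Rightarrow> complex^'n \<Rightarrow> real" where
  "im_del u z v = Im (\<Sum>j\<in>UNIV. dz j (\<lambda>w. complex_of_real (u w)) z * v $ j)"

text \<open>Points of the ambient space are \<open>(z\<^sub>0, z)\<close>, with \<open>z\<^sub>0\<close> at the index \<open>None\<close>.\<close>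

definition amb :: "complex \<Rightarrow> complex^'n \<Rightarrow> complex^('n::finite option)" where
  "amb z0 z = (\<chi> i. case i of None \<Rightarrow> z0 | Some j \<Rightarrow> z $ j)"

definition amb_base :: "complex^('n::finite option) \<Rightarrow> complex^'n" where
  "amb_base x = (\<chi> j. x $ Some j)"

definition amb_over :: "(complex^'n::finite) set \<Rightarrow> (complex^('n option)) set" where
  "amb_over W = {amb z0 z | z0 z. z0 \<noteq> 0 \<and> z \<in> W}"

text \<open>
  The Gram matrix of the real symmetric form obtained by polarizing
  \<open>V \<mapsto> - \<Sum>\<^sub>j\<^sub>k r\<^sub>j\<^sub>k V\<^sub>j cnj V\<^sub>k\<close>, where \<open>r\<^sub>j\<^sub>k\<close> is the complex Hessian of
  \<open>|z\<^sub>0|\<^sup>2 u(z)\<close>. The product of one-forms is thus the symmetric one, with \<open>dz dz\<^sup>- = dx\<^sup>2 + dy\<^sup>2\<close>.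
\<close>

definition ambient_metric ::
  "(complex^'n::finite \<Rightarrow> real) \<Rightarrow> complex^('n option) \<Rightarrow>
   real^('n option \<times> bool)^('n option \<times> bool)" where
  "ambient_metric u x =
     (let r = (\<lambda>y. complex_of_real ((cmod (y $ None))\<^sup>2 * u (amb_base y))) in
      \<chi> I J. - Re (\<Sum>j\<in>UNIV. \<Sum>k\<in>UNIV.
                 dzbar k (dz j r) x * cframe I $ j * cnj (cframe J $ k)))"

section \<open>Abstract strictly pseudoconvex CR manifolds\<close>

text \<open>
  An atlas is a set of charts \<open>(U, \<phi>)\<close>; the manifold is the union of the domains \<open>U\<close>.
  Tensor fields are families of component functions, one for each chart, defined on the
  image of the chart and related by the usual transformation laws. The complexified tangent
  space at a point of the image of a chart is \<open>complex^'d\<close>.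
\<close>

type_synonym ('m, 'd) chart = "'m set \<times> ('m \<Rightarrow> real^'d)"

definition chart_img :: "('m, 'd::finite) chart \<Rightarrow> (real^'d) set" where
  "chart_img c = snd c ` fst c"

definition chart_inv :: "('m, 'd::finite) chart \<Rightarrow> real^'d \<Rightarrow> 'm" where
  "chart_inv c = inv_into (fst c) (snd c)"

definition transition ::
  "('m, 'd::finite) chart \<Rightarrow> ('m, 'd) chart \<Rightarrow> real^'d \<Rightarrow> real^'d" where
  "transition c c' = snd c' \<circ> chart_inv c"

definition overlap :: "('m, 'd::finite) chart \<Rightarrow> ('m, 'd) chart \<Rightarrow> (real^'d) set" where
  "overlap c c' = snd c ` (fst c \<inter> fst c')"

definition carrier_of :: "('m, 'd::finite) chart set \<Rightarrow> 'm set" where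
  "carrier_of A = (\<Union>c\<in>A. fst c)"

definition smooth_atlas ::
  "('m::{t2_space,second_countable_topology}, 'd::finite) chart set \<Rightarrow> bool" where
  "smooth_atlas A \<longleftrightarrow>
     (\<forall>c\<in>A. open (fst c) \<and> open (chart_img c) \<and>
        homeomorphism (fst c) (chart_img c) (snd c) (chart_inv c)) \<and>
     (\<forall>c\<in>A. \<forall>c'\<in>A. smooth_on (overlap c c') (transition c c'))"

definition cvec_deriv :: "complex^'d \<Rightarrow> (real^'d::finite \<Rightarrow> complex) \<Rightarrow> real^'d \<Rightarrow> complex" where
  "cvec_deriv v f x = (\<Sum>k\<in>UNIV. v $ k * dir_deriv (axis k 1) f x)"

definition cnj_vec :: "complex^'d::finite \<Rightarrow> complex^'d" where
  "cnj_vec v = (\<chi> k. cnj (v $ k))"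

definition pushforward ::
  "(real^'d::finite \<Rightarrow> real^'d) \<Rightarrow> real^'d \<Rightarrow> complex^'d \<Rightarrow> complex^'d" where
  "pushforward \<tau> x v =
     (\<chi> i. \<Sum>k\<in>UNIV. v $ k * complex_of_real (dir_deriv (axis k 1) \<tau> x $ i))"

definition lie_bracket ::
  "(real^'d::finite \<Rightarrow> complex^'d) \<Rightarrow> (real^'d \<Rightarrow> complex^'d) \<Rightarrow> real^'d \<Rightarrow> complex^'d" where
  "lie_bracket Z W x =
     (\<chi> i. cvec_deriv (Z x) (\<lambda>y. W y $ i) x - cvec_deriv (W x) (\<lambda>y. Z y $ i) x)"

definition covec_apply :: "real^'d::finite \<Rightarrow> complex^'d \<Rightarrow> complex" where
  "covec_apply \<alpha> v = (\<Sum>k\<in>UNIV. complex_of_real (\<alpha> $ k) * v $ k)"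

definition local_section ::
  "(real^'d::finite) set \<Rightarrow> (real^'d \<Rightarrow> (complex^'d) set) \<Rightarrow> (real^'d \<Rightarrow> complex^'d) \<Rightarrow> bool" where
  "local_section V E Z \<longleftrightarrow> open V \<and> smooth_on V Z \<and> (\<forall>x\<in>V. Z x \<in> E x)"

text \<open>
  \<open>T c x\<close> is the space of (1,0)-vectors at the point \<open>x\<close> of the image of the chart \<open>c\<close>.
  With \<open>CARD('d) = 2 N - 1\<close> the CR structure is of hypersurface type.
\<close>

definition cr_manifold ::
  "nat \<Rightarrow> ('m::{t2_space,second_countable_topology}, 'd::finite) chart set \<Rightarrow>
   (('m, 'd) chart \<Rightarrow> real^'d \<Rightarrow> (complex^'d) set) \<Rightarrow> bool" where
  "cr_manifold N A T \<longleftrightarrow> CARD('d) = 2 * N - 1 \<and> smooth_atlas A \<and>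
     (\<forall>c\<in>A. \<forall>x\<in>chart_img c.
        vec.subspace (T c x) \<and> vec.dim (T c x) = N - 1 \<and>
        T c x \<inter> cnj_vec ` T c x = {0} \<and>
        (\<exists>V Z. x \<in> V \<and> V \<subseteq> chart_img c \<and>
           (\<forall>i<N - 1. local_section V (T c) (Z i)) \<and> open V \<and>
           (\<forall>y\<in>V. T c y = vec.span ((\<lambda>i. Z i y) ` {..<N - 1})))) \<and>
     (\<forall>c\<in>A. \<forall>V Z W. V \<subseteq> chart_img c \<and> local_section V (T c) Z \<and> local_section V (T c) W \<longrightarrow>
        local_section V (T c) (lie_bracket Z W)) \<and>
     (\<forall>c\<in>A. \<forall>c'\<in>A. \<forall>x\<in>overlap c c'.
        T c' (transition c c' x) = pushforward (transition c c') x ` T c x)"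

text \<open>
  The real covector \<open>\<alpha>\<close> at \<open>x\<close> annihilates \<open>T\<close>, and the Levi form
  \<open>Z \<mapsto> - \<i> \<alpha>([Z, cnj Z]) = \<i> d\<alpha>(Z, cnj Z)\<close>, which takes real values, is positive definite.
  For \<open>\<alpha> = Im \<partial>u\<close> this form is \<open>- u\<^sub>j\<^sub>k Z\<^sub>j cnj Z\<^sub>k\<close>, so that
  positivity is the orientation of contact forms given by \<open>Im \<partial>u\<close>.
\<close>

definition levi_positive ::
  "('m, 'd::finite) chart \<Rightarrow> (real^'d \<Rightarrow> (complex^'d) set) \<Rightarrow> real^'d \<Rightarrow> real^'d \<Rightarrow> bool" where
  "levi_positive c E x \<alpha> \<longleftrightarrow>
     \<alpha> \<noteq> 0 \<and> (\<forall>v\<in>E x. covec_apply \<alpha> v = 0) \<and>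
     (\<forall>V Z. x \<in> V \<and> V \<subseteq> chart_img c \<and> local_section V E Z \<and> Z x \<noteq> 0 \<longrightarrow>
        0 < Re (- \<i> * covec_apply \<alpha> (lie_bracket Z (\<lambda>y. cnj_vec (Z y)) x)))"

definition strictly_pseudoconvex_cr_manifold ::
  "nat \<Rightarrow> ('m::{t2_space,second_countable_topology}, 'd::finite) chart set \<Rightarrow>
   (('m, 'd) chart \<Rightarrow> real^'d \<Rightarrow> (complex^'d) set) \<Rightarrow> bool" where
  "strictly_pseudoconvex_cr_manifold N A T \<longleftrightarrow> cr_manifold N A T \<and>
     (\<forall>c\<in>A. \<forall>x\<in>chart_img c. \<exists>\<alpha>. levi_positive c (T c) x \<alpha>)"

definition contact_form ::
  "('m::{t2_space,second_countable_topology}, 'd::finite) chart set \<Rightarrow>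
   (('m, 'd) chart \<Rightarrow> real^'d \<Rightarrow> (complex^'d) set) \<Rightarrow>
   (('m, 'd) chart \<Rightarrow> real^'d \<Rightarrow> real^'d) \<Rightarrow> bool" where
  "contact_form A T \<theta> \<longleftrightarrow>
     (\<forall>c\<in>A. smooth_on (chart_img c) (\<theta> c) \<and>
        (\<forall>x\<in>chart_img c. levi_positive c (T c) x (\<theta> c x))) \<and>
     (\<forall>c\<in>A. \<forall>c'\<in>A. \<forall>x\<in>overlap c c'. \<forall>v.
        \<theta> c x \<bullet> v = \<theta> c' (transition c c' x) \<bullet> dir_deriv v (transition c c') x)"

definition cr_function_on ::
  "('m::{t2_space,second_countable_topology}, 'd::finite) chart set \<Rightarrow>
   (('m, 'd) chart \<Rightarrow> real^'d \<Rightarrow> (complex^'d) set) \<Rightarrow> 'm set \<Rightarrow> ('m \<Rightarrow> complex) \<Rightarrow> bool" where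
  "cr_function_on A T O' f \<longleftrightarrow>
     (\<forall>c\<in>A. smooth_on (snd c ` (fst c \<inter> O')) (f \<circ> chart_inv c) \<and>
        (\<forall>x \<in> snd c ` (fst c \<inter> O'). \<forall>v \<in> T c x.
           cvec_deriv (cnj_vec v) (f \<circ> chart_inv c) x = 0))"

definition cr_pluriharmonic ::
  "('m::{t2_space,second_countable_topology}, 'd::finite) chart set \<Rightarrow>
   (('m, 'd) chart \<Rightarrow> real^'d \<Rightarrow> (complex^'d) set) \<Rightarrow> ('m \<Rightarrow> real) \<Rightarrow> bool" where
  "cr_pluriharmonic A T \<Upsilon> \<longleftrightarrow>
     (\<forall>p\<in>carrier_of A. \<exists>O' f. open O' \<and> p \<in> O' \<and> O' \<subseteq> carrier_of A \<and>
        cr_function_on A T O' f \<and> (\<forall>q\<in>O'. \<Upsilon> q = Re (f q)))"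

section \<open>CR Q-curvature\<close>

text \<open>
  A formal embedding at the point \<open>a\<close> of the image of a chart: a parametrization \<open>F\<close> of the
  real hypersurface \<open>{z \<in> W. u z = 0}\<close> of \<open>complex^'n\<close> whose components satisfy the tangential
  Cauchy-Riemann equations to infinite order at \<open>a\<close>, together with a Fefferman defining
  function \<open>u\<close> of that hypersurface.
\<close>

definition formal_embedding ::
  "(real^'d::finite \<Rightarrow> (complex^'d) set) \<Rightarrow> real^'d \<Rightarrow> (real^'d) set \<Rightarrow>
   (complex^'n::finite) set \<Rightarrow> (real^'d \<Rightarrow> complex^'n) \<Rightarrow> (complex^'n \<Rightarrow> real) \<Rightarrow> bool" where
  "formal_embedding E a V W F u \<longleftrightarrow>
     open V \<and> a \<in> V \<and> smooth_on V F \<and> inj_on F V \<and>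
     (\<forall>x\<in>V. inj (frechet_derivative F (at x))) \<and>
     fefferman_defining W u \<and> F ` V = {z\<in>W. u z = 0} \<and>
     (\<forall>V' Z j. a \<in> V' \<and> V' \<subseteq> V \<and> local_section V' E Z \<longrightarrow>
        flat_at (\<lambda>x. cvec_deriv (cnj_vec (Z x)) (\<lambda>y. F y $ j) x) a)"

text \<open>
  The components, in the coordinates of \<open>V\<close>, of \<open>F\<^sup>* (e\<^sup>2\<^sup>\<Upsilon> Im \<partial>u)\<close>, with
  \<open>ups = \<Upsilon> \<circ> F\<close>.
\<close>

definition pulled_back_form ::
  "(real^'d::finite \<Rightarrow> complex^'n::finite) \<Rightarrow> (complex^'n \<Rightarrow> real) \<Rightarrow> (real^'d \<Rightarrow> real) \<Rightarrow>
   real^'d \<Rightarrow> real^'d" where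
  "pulled_back_form F u ups x =
     (\<chi> k. exp (2 * ups x) * im_del u (F x) (dir_deriv (axis k 1) F x))"

text \<open>
  The conditions on \<open>t\<close>: positive, smooth, homogeneous of degree 1 in \<open>|z\<^sub>0|\<close>, and equal to
  \<open>e\<^sup>-\<^sup>\<Upsilon> |z\<^sub>0|\<close> over the hypersurface.
\<close>

definition scale_extension ::
  "(real^'d::finite) set \<Rightarrow> (complex^'n::finite) set \<Rightarrow> (real^'d \<Rightarrow> complex^'n) \<Rightarrow>
   (real^'d \<Rightarrow> real) \<Rightarrow> (complex^('n option) \<Rightarrow> real) \<Rightarrow> bool" where
  "scale_extension V W F ups t \<longleftrightarrow>
     smooth_on (amb_over W) t \<and> (\<forall>x\<in>amb_over W. 0 < t x) \<and>
     (\<forall>l z0 z. l \<noteq> 0 \<and> z0 \<noteq> 0 \<and> z \<in> W \<longrightarrow> t (amb (l * z0) z) = cmod l * t (amb z0 z)) \<and>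
     (\<forall>x\<in>V. \<forall>z0. z0 \<noteq> 0 \<longrightarrow> t (amb z0 (F x)) = exp (- ups x) * cmod z0)"

text \<open>
  All values at \<open>p\<close> of \<open>- \<Delta>\<^sup>N log t\<close> on \<open>{t = 1}\<close> over the hypersurface, for all formal
  embeddings at \<open>p\<close>, all Fefferman defining functions and all extensions \<open>t\<close>. As \<open>F\<close> is a CR map
  only to infinite order at \<open>p\<close>, the form \<open>\<theta>\<close> is required to agree with the pullback of a
  multiple of \<open>Im \<partial>u\<close> only to infinite order at \<open>p\<close>.
\<close>

definition cr_Q_values ::
  "'n::finite itself \<Rightarrow> ('m::{t2_space,second_countable_topology}, 'd::finite) chart set \<Rightarrow>
   (('m, 'd) chart \<Rightarrow> real^'d \<Rightarrow> (complex^'d) set) \<Rightarrow>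
   (('m, 'd) chart \<Rightarrow> real^'d \<Rightarrow> real^'d) \<Rightarrow> 'm \<Rightarrow> real set" where
  "cr_Q_values _ A T \<theta> p =
     {q. \<exists>c\<in>A. \<exists>V W F (u :: complex^'n \<Rightarrow> real) ups t z0.
        p \<in> fst c \<and> V \<subseteq> chart_img c \<and>
        formal_embedding (T c) (snd c p) V W F u \<and>
        smooth_on V ups \<and>
        flat_at (\<lambda>x. \<theta> c x - pulled_back_form F u ups x) (snd c p) \<and>
        scale_extension V W F ups t \<and>
        z0 \<noteq> 0 \<and> t (amb z0 (F (snd c p))) = 1 \<and>
        q = - (laplacian (ambient_metric u) ^^ CARD('n)) (\<lambda>y. ln (t y))
                (amb z0 (F (snd c p)))}"

text \<open>
  The value of the Q-curvature does not depend on any of these choices, so that for a contact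
  form on a strictly pseudoconvex CR manifold the set above is a singleton; the Q-curvature is
  its element. The value 0 only makes the function total.
\<close>

definition cr_Q_curvature ::
  "'n::finite itself \<Rightarrow> ('m::{t2_space,second_countable_topology}, 'd::finite) chart set \<Rightarrow>
   (('m, 'd) chart \<Rightarrow> real^'d \<Rightarrow> (complex^'d) set) \<Rightarrow>
   (('m, 'd) chart \<Rightarrow> real^'d \<Rightarrow> real^'d) \<Rightarrow> 'm \<Rightarrow> real" where
  "cr_Q_curvature N A T \<theta> p =
     (if is_singleton (cr_Q_values N A T \<theta> p) then the_elem (cr_Q_values N A T \<theta> p) else 0)"

end

theory Submission
  imports Defs "HOL-Library.Multiset"
begin

text \<open>
  Near \<open>p\<close> write \<open>\<Upsilon> = Re f\<close> with a CR function \<open>f\<close>. In a formal embedding \<open>F\<close>, \<open>f\<close> agrees with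
  \<open>P \<circ> F\<close> to any prescribed finite order, \<open>P\<close> being a holomorphic polynomial, so that \<open>\<Upsilon>\<close> extends
  off the hypersurface to \<open>R = Re P\<close> plus a term vanishing to order \<open>2 N + 1\<close> at \<open>F p\<close>. If \<open>t\<close> is
  a scale for \<open>\<theta>\<close>, then \<open>e\<^sup>-\<^sup>R t\<close> is one for \<open>\<theta>'\<close>, and \<open>\<Delta>\<^sup>N log (e\<^sup>-\<^sup>R t) = \<Delta>\<^sup>N log t - \<Delta>\<^sup>N R\<close>. The ambient
  metric has a Kaehler potential, so its Laplacian kills \<open>Re P\<close>, and \<open>\<Delta>\<^sup>N\<close> kills the
  remaining term at \<open>F p\<close>. Passing from \<open>{t = 1}\<close> to \<open>{e\<^sup>-\<^sup>R t = 1}\<close> multiplies \<open>z\<^sub>0\<close> by \<open>e\<^sup>\<Upsilon>\<close>, and \<open>\<Delta>\<^sup>N log t\<close> is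
  homogeneous of degree \<open>- 2 N\<close> in \<open>z\<^sub>0\<close>. Applied to \<open>\<Upsilon>\<close> and \<open>- \<Upsilon>\<close> this gives a bijection between the
  sets of values admitted in the definition of the Q-curvature; that these
  sets are singletons plays no role.
\<close>


section \<open>Calculus of smooth functions\<close>

text \<open>A smooth CR function need not extend holomorphically to a neighbourhood, and a formal
  embedding \<open>F\<close> is a CR map only to infinite order at its base point, so
  \<open>f\<close> is matched by a polynomial to finite order at that one point. The polynomial
  exists because the leading homogeneous part of \<open>f - P o F\<close> is killed by the conjugate
  (1,0)-vectors there, and the covectors killed by these are spanned by the differentials of the
  components of \<open>F\<close>; the leading part is thus a form in these differentials and is
  removed order by order. \<open>Re P\<close> alone cannot serve as \<open>R\<close>: the contact
  form must match the pullback to infinite order, so \<open>R\<close> has to equal \<Upsilon> on the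
  hypersurface near the point, and the remainder is carried off the hypersurface by a local
  retraction. The order 2 N + 1 leaves order one, that is the value 0, after N operators of second
  order. The Laplacian has no first-order part because the third derivatives of the potential are
  symmetric. Nondegeneracy of the metric comes from J[u] = 1 on the hypersurface, the complex
  Hessian of |z_0|^2 u being the bordered matrix in J[u] up to diagonal factors.\<close>

lemma has_derivative_dir_deriv:
  "f differentiable (at x) \<Longrightarrow> (f has_derivative (\<lambda>v. dir_deriv v f x)) (at x)"
  unfolding dir_deriv_def by (simp add: frechet_derivative_works[symmetric])

lemma dir_deriv_eqI: "(f has_derivative f') (at x) \<Longrightarrow> dir_deriv v f x = f' v"
  unfolding dir_deriv_def by (metis frechet_derivative_at)

lemma dir_deriv_const [simp]: "dir_deriv v (\<lambda>x. c) = (\<lambda>x. 0)"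
  by (rule ext) (rule dir_deriv_eqI[OF has_derivative_const])

lemma linear_dir_deriv: "f differentiable (at x) \<Longrightarrow> linear (\<lambda>v. dir_deriv v f x)"
  using has_derivative_dir_deriv has_derivative_linear by blast

lemma dir_deriv_cong:
  assumes "open S" "x \<in> S" "\<And>y. y \<in> S \<Longrightarrow> f y = g y"
  shows "dir_deriv v f x = dir_deriv v g x"
proof -
  have "(f has_derivative f') (at x) = (g has_derivative f') (at x)" for f'
    using assms has_derivative_transform_within_open by metis
  then show ?thesis
    unfolding dir_deriv_def frechet_derivative_def by simp
qed

lemma Ck_on_cong:
  assumes "open S" "\<And>y. y \<in> S \<Longrightarrow> f y = g y" "Ck_on k S f"
  shows "Ck_on k S g"
  using assms(2,3)
proof (induction k arbitrary: f g)
  case 0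
  then show ?case by (simp cong: continuous_on_cong)
next
  case (Suc k)
  have "g differentiable_on S"
    unfolding differentiable_on_def
  proof
    fix x assume x: "x \<in> S"
    have "f differentiable (at x within S)"
      using Suc.prems(2) x by (simp add: differentiable_on_def)
    then show "g differentiable (at x within S)"
      by (rule differentiable_transform_within[OF _ zero_less_one x]) (simp add: Suc.prems(1))
  qed
  moreover have "Ck_on k S (dir_deriv v g)" for v
    using Suc.IH[of "dir_deriv v f" "dir_deriv v g"] Suc.prems dir_deriv_cong[OF assms(1)]
    by (metis Ck_on.simps(2))
  ultimately show ?case by simp
qed

lemma Ck_on_subset: "Ck_on k S f \<Longrightarrow> T \<subseteq> S \<Longrightarrow> Ck_on k T f"
  by (induction k arbitrary: f) (auto intro: continuous_on_subset differentiable_on_subset)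

lemma Ck_on_Suc_imp: "Ck_on (Suc k) S f \<Longrightarrow> Ck_on k S f"
  by (induction k arbitrary: f) (auto intro: differentiable_imp_continuous_on)

lemma Ck_on_SucD:
  assumes "Ck_on (Suc k) S f" "open S" "x \<in> S"
  shows "(f has_derivative (\<lambda>v. dir_deriv v f x)) (at x)"
  using assms by (auto intro!: has_derivative_dir_deriv simp: differentiable_on_eq_differentiable_at)

text \<open>On an open set the derivative within the set is the full derivative and is unique, so an
  explicit formula \<open>f'\<close> may replace \<open>dir_deriv\<close>. The closure proofs by
  induction on \<open>k\<close> below rest on this rule.\<close>

lemma Ck_on_SucI:
  assumes "open S" "\<And>x. x \<in> S \<Longrightarrow> (f has_derivative f' x) (at x)"
    and "\<And>v. Ck_on k S (\<lambda>x. f' x v)"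
  shows "Ck_on (Suc k) S f"
proof -
  have "f differentiable_on S"
    using assms(2) by (auto simp: differentiable_on_def differentiable_def intro: has_derivative_at_withinI)
  moreover have "Ck_on k S (dir_deriv v f)" for v
    by (rule Ck_on_cong[OF assms(1) _ assms(3)[of v]]) (simp add: dir_deriv_eqI[OF assms(2)])
  ultimately show ?thesis by simp
qed

lemma Ck_on_const: "open S \<Longrightarrow> Ck_on k S (\<lambda>x. c)"
proof (induction k arbitrary: c)
  case (Suc k)
  then show ?case by (intro Ck_on_SucI[where f' = "\<lambda>x v. 0"]) auto
qed simp

lemma Ck_on_linear_compose:
  assumes "open S" "bounded_linear h" "Ck_on k S f"
  shows "Ck_on k S (\<lambda>x. h (f x))"
  using assms(3)
proof (induction k arbitrary: f)
  case 0
  then show ?case using bounded_linear.continuous_on[OF assms(2)] by simp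
next
  case (Suc k)
  show ?case
  proof (rule Ck_on_SucI[OF assms(1)])
    show "((\<lambda>x. h (f x)) has_derivative (\<lambda>v. h (dir_deriv v f x))) (at x)" if "x \<in> S" for x
      using bounded_linear.has_derivative[OF assms(2) Ck_on_SucD[OF Suc.prems assms(1) that]] .
    show "Ck_on k S (\<lambda>x. h (dir_deriv v f x))" for v
      using Suc by simp
  qed
qed

lemma Ck_on_ident: "open S \<Longrightarrow> Ck_on k S (\<lambda>x. x)"
proof (cases k)
  case (Suc m)
  assume "open S"
  then show ?thesis unfolding Suc
    by (intro Ck_on_SucI[where f' = "\<lambda>x v. v"]) (auto intro: Ck_on_const)
qed simp

lemma Ck_on_add:
  assumes "open S" "Ck_on k S f" "Ck_on k S g"
  shows "Ck_on k S (\<lambda>x. f x + g x)"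
  using assms(2,3)
proof (induction k arbitrary: f g)
  case (Suc k)
  show ?case
  proof (rule Ck_on_SucI[OF assms(1)])
    show "((\<lambda>x. f x + g x) has_derivative (\<lambda>v. dir_deriv v f x + dir_deriv v g x)) (at x)"
      if "x \<in> S" for x
      using Suc.prems assms(1) that by (intro has_derivative_add Ck_on_SucD)
  qed (use Suc in simp)
qed (simp add: continuous_on_add)

lemma Ck_on_bilinear:
  assumes "open S" "bounded_bilinear p" "Ck_on k S f" "Ck_on k S g"
  shows "Ck_on k S (\<lambda>x. p (f x) (g x))"
  using assms(3,4)
proof (induction k arbitrary: f g)
  case 0
  then show ?case using bounded_bilinear.continuous_on[OF assms(2)] by simp
next
  case (Suc k)
  show ?case
  proof (rule Ck_on_SucI[OF assms(1)])
    show "((\<lambda>x. p (f x) (g x)) has_derivative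
        (\<lambda>v. p (f x) (dir_deriv v g x) + p (dir_deriv v f x) (g x))) (at x)" if "x \<in> S" for x
      using Suc.prems assms(1) that
      by (intro bounded_bilinear.FDERIV[OF assms(2)] Ck_on_SucD)
    show "Ck_on k S (\<lambda>x. p (f x) (dir_deriv v g x) + p (dir_deriv v f x) (g x))" for v
      using Suc.prems Ck_on_Suc_imp[OF Suc.prems(1)] Ck_on_Suc_imp[OF Suc.prems(2)]
      by (intro Ck_on_add assms(1) Suc.IH) auto
  qed
qed

lemmas Ck_on_mult = Ck_on_bilinear[OF _ bounded_bilinear_mult]

lemma Ck_on_sum:
  assumes "open S" "\<And>i. i \<in> I \<Longrightarrow> Ck_on k S (f i)"
  shows "Ck_on k S (\<lambda>x. \<Sum>i\<in>I. f i x)"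
  using assms(2)
  by (induction I rule: infinite_finite_induct) (auto intro: Ck_on_const Ck_on_add assms(1))

lemma Ck_on_prod:
  fixes f :: "'i \<Rightarrow> 'a::euclidean_space \<Rightarrow> 'b::real_normed_field"
  assumes "open S" "\<And>i. i \<in> I \<Longrightarrow> Ck_on k S (f i)"
  shows "Ck_on k S (\<lambda>x. \<Prod>i\<in>I. f i x)"
  using assms(2)
  by (induction I rule: infinite_finite_induct) (auto intro: Ck_on_const Ck_on_mult assms(1))

lemma dir_deriv_Basis:
  fixes f :: "'a::euclidean_space \<Rightarrow> 'b::real_normed_vector"
  assumes "f differentiable (at x)"
  shows "dir_deriv v f x = (\<Sum>b\<in>Basis. (v \<bullet> b) *\<^sub>R dir_deriv b f x)"
proof -
  have "dir_deriv (\<Sum>b\<in>Basis. (v \<bullet> b) *\<^sub>R b) f x = (\<Sum>b\<in>Basis. (v \<bullet> b) *\<^sub>R dir_deriv b f x)"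
    using linear_dir_deriv[OF assms] by (simp add: linear_sum[OF linear_dir_deriv[OF assms]] linear_scale[OF linear_dir_deriv[OF assms]])
  then show ?thesis by (simp add: euclidean_representation)
qed

lemma dir_deriv_compose:
  fixes f :: "'a::euclidean_space \<Rightarrow> 'b::euclidean_space"
  assumes "f differentiable (at x)" "g differentiable (at (f x))"
  shows "dir_deriv v (\<lambda>y. g (f y)) x = dir_deriv (dir_deriv v f x) g (f x)"
  using diff_chain_at[OF has_derivative_dir_deriv[OF assms(1)] has_derivative_dir_deriv[OF assms(2)]]
  by (auto simp: o_def dest: dir_deriv_eqI)

text \<open>The chain rule differentiates \<open>g\<close> in the direction
  \<open>dir_deriv v f x\<close>, which varies with \<open>x\<close>. Expanding it in
  \<open>Basis\<close> leaves derivatives of \<open>g\<close> in fixed directions, to which the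
  induction hypothesis applies, multiplied by components of the derivative of
  \<open>f\<close>.\<close>

lemma Ck_on_compose:
  fixes f :: "'a::euclidean_space \<Rightarrow> 'b::euclidean_space"
  assumes "open S" "open U" "f ` S \<subseteq> U" "Ck_on k S f" "Ck_on k U g"
  shows "Ck_on k S (\<lambda>x. g (f x))"
  using assms(4,5)
proof (induction k arbitrary: g)
  case 0
  then show ?case using continuous_on_compose2[of U g S f] assms(3) by auto
next
  case (Suc k)
  show ?case
  proof (rule Ck_on_SucI[OF assms(1)])
    fix x assume "x \<in> S"
    then have f: "(f has_derivative (\<lambda>v. dir_deriv v f x)) (at x)"
      and "f x \<in> U"
      using Ck_on_SucD[OF Suc.prems(1)] assms by auto
    then have g: "(g has_derivative (\<lambda>v. dir_deriv v g (f x))) (at (f x))"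
      using Ck_on_SucD[OF Suc.prems(2)] assms by auto
    have eq: "dir_deriv v g (f x) = (\<Sum>b\<in>Basis. (v \<bullet> b) *\<^sub>R dir_deriv b g (f x))" for v
      using g by (intro dir_deriv_Basis) (auto simp: differentiable_def)
    show "((\<lambda>x. g (f x)) has_derivative
        (\<lambda>v. \<Sum>b\<in>Basis. (dir_deriv v f x \<bullet> b) *\<^sub>R dir_deriv b g (f x))) (at x)"
      unfolding eq[symmetric] using diff_chain_at[OF f g] by (simp add: o_def)
  next
    fix v
    show "Ck_on k S (\<lambda>x. \<Sum>b\<in>Basis. (dir_deriv v f x \<bullet> b) *\<^sub>R dir_deriv b g (f x))"
      using Suc.prems Ck_on_Suc_imp[OF Suc.prems(1)]
      by (intro Ck_on_sum Ck_on_bilinear[OF _ bounded_bilinear_scaleR] assms(1) Suc.IH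
          Ck_on_linear_compose[OF _ bounded_linear_inner_left]) auto
  qed
qed

lemma Ck_on_euclidean:
  fixes f :: "'a::euclidean_space \<Rightarrow> 'b::euclidean_space"
  assumes "open S" "\<And>b. b \<in> Basis \<Longrightarrow> Ck_on k S (\<lambda>x. f x \<bullet> b)"
  shows "Ck_on k S f"
proof -
  have "Ck_on k S (\<lambda>x. \<Sum>b\<in>Basis. (f x \<bullet> b) *\<^sub>R b)"
    using assms
    by (intro Ck_on_sum Ck_on_linear_compose[OF _ bounded_linear_scaleR_left]) auto
  then show ?thesis by (simp add: euclidean_representation)
qed

lemma Ck_on_vec:
  fixes f :: "'a::euclidean_space \<Rightarrow> 'b::euclidean_space^'n"
  assumes "open S" "\<And>i. Ck_on k S (\<lambda>x. f x $ i)"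
  shows "Ck_on k S f"
proof (rule Ck_on_euclidean[OF assms(1)])
  fix b :: "'b^'n" assume "b \<in> Basis"
  then obtain i e where "b = axis i e" unfolding Basis_vec_def by blast
  then show "Ck_on k S (\<lambda>x. f x \<bullet> b)"
    using Ck_on_linear_compose[OF assms(1) bounded_linear_inner_left assms(2)[of i]]
    by (simp add: inner_axis)
qed

lemma Ck_on_inverse:
  fixes f :: "'a::euclidean_space \<Rightarrow> 'b::real_normed_field"
  assumes "open S" "\<And>x. x \<in> S \<Longrightarrow> f x \<noteq> 0" "Ck_on k S f"
  shows "Ck_on k S (\<lambda>x. inverse (f x))"
  using assms(3)
proof (induction k)
  case 0
  then show ?case using assms(2) by (simp add: continuous_on_inverse)
next
  case (Suc k)
  show ?case
  proof (rule Ck_on_SucI[OF assms(1)])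
    show "((\<lambda>x. inverse (f x)) has_derivative
        (\<lambda>v. - (inverse (f x) * dir_deriv v f x * inverse (f x)))) (at x)" if "x \<in> S" for x
      using that assms by (intro Deriv.has_derivative_inverse Ck_on_SucD[OF Suc.prems]) auto
    show "Ck_on k S (\<lambda>x. - (inverse (f x) * dir_deriv v f x * inverse (f x)))" for v
      using Suc Ck_on_Suc_imp[OF Suc.prems] assms(1)
      by (intro Ck_on_linear_compose[OF _ bounded_linear_minus[OF bounded_linear_ident]] Ck_on_mult) auto
  qed
qed

lemma Ck_on_exp:
  fixes f :: "'a::euclidean_space \<Rightarrow> real"
  assumes "open S" "Ck_on k S f"
  shows "Ck_on k S (\<lambda>x. exp (f x))"
  using assms(2)
proof (induction k)
  case 0
  then show ?case by (simp add: continuous_on_exp)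
next
  case (Suc k)
  show ?case
  proof (rule Ck_on_SucI[OF assms(1)])
    show "((\<lambda>x. exp (f x)) has_derivative (\<lambda>v. exp (f x) * dir_deriv v f x)) (at x)"
      if "x \<in> S" for x
      using has_derivative_exp[OF Ck_on_SucD[OF Suc.prems assms(1) that]]
      by (simp add: mult.commute)
  qed (use Suc Ck_on_Suc_imp[OF Suc.prems] assms(1) in \<open>auto intro: Ck_on_mult\<close>)
qed

lemma Ck_on_ln:
  fixes f :: "'a::euclidean_space \<Rightarrow> real"
  assumes "open S" "\<And>x. x \<in> S \<Longrightarrow> 0 < f x" "Ck_on k S f"
  shows "Ck_on k S (\<lambda>x. ln (f x))"
proof (cases k)
  case 0
  then show ?thesis using assms by (force intro!: continuous_on_ln)
next
  case (Suc m)
  note f = assms(3)[unfolded Suc]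
  show ?thesis unfolding Suc
  proof (rule Ck_on_SucI[OF assms(1)])
    show "((\<lambda>x. ln (f x)) has_derivative (\<lambda>v. inverse (f x) * dir_deriv v f x)) (at x)"
      if "x \<in> S" for x
      using has_derivative_ln[OF assms(2)[OF that] Ck_on_SucD[OF f assms(1) that]]
      by (simp add: divide_inverse mult.commute)
    show "Ck_on m S (\<lambda>x. inverse (f x) * dir_deriv v f x)" for v
      using f Ck_on_Suc_imp[OF f] assms by (intro Ck_on_mult Ck_on_inverse) force+
  qed
qed

section \<open>Closure properties of smooth functions\<close>

lemma smooth_onD: "smooth_on S f \<Longrightarrow> Ck_on k S f"
  by (simp add: smooth_on_def)

lemma smooth_on_const: "open S \<Longrightarrow> smooth_on S (\<lambda>x. c)"
  by (simp add: smooth_on_def Ck_on_const)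

lemma smooth_on_ident: "open S \<Longrightarrow> smooth_on S (\<lambda>x. x)"
  by (simp add: smooth_on_def Ck_on_ident)

lemma smooth_on_linear_compose:
  "open S \<Longrightarrow> bounded_linear h \<Longrightarrow> smooth_on S f \<Longrightarrow> smooth_on S (\<lambda>x. h (f x))"
  by (simp add: smooth_on_def Ck_on_linear_compose)

lemma smooth_on_linear: "open S \<Longrightarrow> bounded_linear h \<Longrightarrow> smooth_on S h"
  using smooth_on_linear_compose smooth_on_ident by blast

lemma smooth_on_add:
  "open S \<Longrightarrow> smooth_on S f \<Longrightarrow> smooth_on S g \<Longrightarrow> smooth_on S (\<lambda>x. f x + g x)"
  by (simp add: smooth_on_def Ck_on_add)

lemma smooth_on_minus: "open S \<Longrightarrow> smooth_on S f \<Longrightarrow> smooth_on S (\<lambda>x. - f x)"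
  by (rule smooth_on_linear_compose[OF _ bounded_linear_minus[OF bounded_linear_ident]])

lemma smooth_on_diff:
  "open S \<Longrightarrow> smooth_on S f \<Longrightarrow> smooth_on S g \<Longrightarrow> smooth_on S (\<lambda>x. f x - g x)"
  using smooth_on_add[OF _ _ smooth_on_minus, of S f g] by simp

lemma smooth_on_bilinear:
  "open S \<Longrightarrow> bounded_bilinear p \<Longrightarrow> smooth_on S f \<Longrightarrow> smooth_on S g
    \<Longrightarrow> smooth_on S (\<lambda>x. p (f x) (g x))"
  by (simp add: smooth_on_def Ck_on_bilinear)

lemmas smooth_on_mult = smooth_on_bilinear[OF _ bounded_bilinear_mult]
lemmas smooth_on_scaleR = smooth_on_bilinear[OF _ bounded_bilinear_scaleR]

lemma smooth_on_sum:
  "open S \<Longrightarrow> (\<And>i. i \<in> I \<Longrightarrow> smooth_on S (f i)) \<Longrightarrow> smooth_on S (\<lambda>x. \<Sum>i\<in>I. f i x)"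
  by (simp add: smooth_on_def Ck_on_sum)

lemma smooth_on_prod:
  fixes f :: "'i \<Rightarrow> 'a::euclidean_space \<Rightarrow> 'b::real_normed_field"
  shows "open S \<Longrightarrow> (\<And>i. i \<in> I \<Longrightarrow> smooth_on S (f i)) \<Longrightarrow> smooth_on S (\<lambda>x. \<Prod>i\<in>I. f i x)"
  by (simp add: smooth_on_def Ck_on_prod)

lemma smooth_on_compose:
  fixes f :: "'a::euclidean_space \<Rightarrow> 'b::euclidean_space"
  shows "open S \<Longrightarrow> open U \<Longrightarrow> f ` S \<subseteq> U \<Longrightarrow> smooth_on S f \<Longrightarrow> smooth_on U g
    \<Longrightarrow> smooth_on S (\<lambda>x. g (f x))"
  by (auto simp: smooth_on_def intro: Ck_on_compose)

lemma smooth_on_vec: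
  fixes f :: "'a::euclidean_space \<Rightarrow> 'b::euclidean_space^'n"
  shows "open S \<Longrightarrow> (\<And>i. smooth_on S (\<lambda>x. f x $ i)) \<Longrightarrow> smooth_on S f"
  by (simp add: smooth_on_def Ck_on_vec)

lemma smooth_on_inverse:
  fixes f :: "'a::euclidean_space \<Rightarrow> 'b::real_normed_field"
  shows "open S \<Longrightarrow> (\<And>x. x \<in> S \<Longrightarrow> f x \<noteq> 0) \<Longrightarrow> smooth_on S f \<Longrightarrow> smooth_on S (\<lambda>x. inverse (f x))"
  by (simp add: smooth_on_def Ck_on_inverse)

lemma smooth_on_subset: "smooth_on S f \<Longrightarrow> T \<subseteq> S \<Longrightarrow> smooth_on T f"
  by (auto simp: smooth_on_def intro: Ck_on_subset)

lemma smooth_on_cong: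
  "open S \<Longrightarrow> (\<And>y. y \<in> S \<Longrightarrow> f y = g y) \<Longrightarrow> smooth_on S f \<Longrightarrow> smooth_on S g"
  by (metis Ck_on_cong smooth_on_def)

lemma smooth_on_dir_deriv: "smooth_on S f \<Longrightarrow> smooth_on S (dir_deriv v f)"
  unfolding smooth_on_def by (metis Ck_on.simps(2))

lemma smooth_on_differentiable: "smooth_on S f \<Longrightarrow> open S \<Longrightarrow> x \<in> S \<Longrightarrow> f differentiable (at x)"
  using Ck_on_SucD[OF smooth_onD[of S f "Suc 0"]] unfolding differentiable_def by blast

lemma smooth_on_has_derivative:
  "smooth_on S f \<Longrightarrow> open S \<Longrightarrow> x \<in> S \<Longrightarrow> (f has_derivative (\<lambda>v. dir_deriv v f x)) (at x)"
  by (simp add: smooth_on_differentiable has_derivative_dir_deriv)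

lemma smooth_on_continuous: "smooth_on S f \<Longrightarrow> continuous_on S f"
  using smooth_onD[of S f 0] by simp

lemma smooth_on_nth: 
  fixes f :: "'a::euclidean_space \<Rightarrow> 'b::euclidean_space^'n"
  shows "open S \<Longrightarrow> smooth_on S f \<Longrightarrow> smooth_on S (\<lambda>x. f x $ i)"
  by (rule smooth_on_linear_compose[OF _ bounded_linear_vec_nth])

section \<open>Smooth dependence of determinants and inverse matrices\<close>

lemma smooth_on_det:
  fixes A :: "'a::euclidean_space \<Rightarrow> 'b::{real_normed_field, euclidean_space}^'n^'n"
  assumes "open S" "\<And>i j. smooth_on S (\<lambda>x. A x $ i $ j)"
  shows "smooth_on S (\<lambda>x. det (A x))"
  unfolding det_def
  by (intro smooth_on_sum smooth_on_mult smooth_on_prod smooth_on_const assms)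

lemma matrix_mult_inv:
  fixes A :: "'a::field^'n^'n"
  assumes "det A \<noteq> 0"
  shows "A ** matrix_inv A = mat 1" "matrix_inv A ** A = mat 1"
proof -
  obtain B where "A ** B = mat 1 \<and> B ** A = mat 1"
    using assms unfolding invertible_det_nz[symmetric] invertible_def by blast
  then have "A ** matrix_inv A = mat 1 \<and> matrix_inv A ** A = mat 1"
    unfolding matrix_inv_def by (rule someI)
  then show "A ** matrix_inv A = mat 1" "matrix_inv A ** A = mat 1" by blast+
qed

text \<open>\<open>matrix_inv\<close> is given by a choice operator; Cramer's rule turns its entries
  into quotients of determinants, from which smoothness in the entries of \<open>A\<close> can be
  read off.\<close>

lemma matrix_inv_cramer:
  fixes A :: "'a::field^'n^'n"
  assumes "det A \<noteq> 0"
  shows "matrix_inv A $ i $ j = det (\<chi> k l. if l = i then (if k = j then 1 else 0) else A $ k $ l) / det A"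
proof -
  have A: "A ** matrix_inv A = mat 1"
    using assms by (rule matrix_mult_inv)
  have "A *v column j (matrix_inv A) = column j (mat 1)"
    unfolding A[symmetric] by (simp add: column_def matrix_matrix_mult_def matrix_vector_mult_def vec_eq_iff)
  then have "column j (matrix_inv A) = (\<chi> i. det (\<chi> k l. if l = i then column j (mat 1) $ k else A $ k $ l) / det A)"
    using cramer[OF assms] by blast
  then have "column j (matrix_inv A) $ i = det (\<chi> k l. if l = i then column j (mat 1) $ k else A $ k $ l) / det A"
    by simp
  moreover have "column j (mat 1 :: 'a^'n^'n) $ k = (if k = j then 1 else 0)" for k
    by (simp add: column_def mat_def)
  ultimately show ?thesis by (simp only:) (simp add: column_def)
qed

lemma smooth_on_matrix_inv:
  fixes A :: "'a::euclidean_space \<Rightarrow> real^'n^'n"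
  assumes "open S" "\<And>i j. smooth_on S (\<lambda>x. A x $ i $ j)" "\<And>x. x \<in> S \<Longrightarrow> det (A x) \<noteq> 0"
  shows "smooth_on S (\<lambda>x. matrix_inv (A x) $ i $ j)"
proof (rule smooth_on_cong[OF assms(1)])
  have "smooth_on S (\<lambda>x. if l = i then (if k = j then 1 else 0) else A x $ k $ l)" for k l
    using assms(2) smooth_on_const[OF assms(1)] by (cases "l = i"; cases "k = j") simp_all
  then show "smooth_on S (\<lambda>x. det (\<chi> k l. if l = i then (if k = j then 1 else 0) else A x $ k $ l) * inverse (det (A x)))"
    using assms
    by (intro smooth_on_mult smooth_on_inverse smooth_on_det) simp_all
qed (simp add: matrix_inv_cramer assms(3) divide_inverse)

section \<open>Symmetry of second derivatives\<close>

lemma has_real_derivative_along_line: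
  fixes f :: "'a::real_normed_vector \<Rightarrow> real"
  assumes "f differentiable (at (x + s *\<^sub>R v))"
  shows "((\<lambda>s. f (x + s *\<^sub>R v)) has_real_derivative dir_deriv v f (x + s *\<^sub>R v)) (at s)"
proof -
  have "((\<lambda>s. x + s *\<^sub>R v) has_derivative (\<lambda>h. h *\<^sub>R v)) (at s)"
    by (auto intro!: derivative_eq_intros)
  from diff_chain_at[OF this has_derivative_dir_deriv[OF assms]]
  show ?thesis
    using linear_scale[OF linear_dir_deriv[OF assms]]
    by (simp add: o_def has_field_derivative_def mult.commute[of "dir_deriv v f _"] fun_eq_iff
        mult_commute_abs)
qed

text \<open>The mean value theorem is applied twice, along \<open>v\<close> and then along
  \<open>w\<close>. The second difference is symmetric in \<open>v\<close> and \<open>w\<close>, so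
  exchanging them expresses it by the other mixed derivative as well.\<close>

lemma second_difference_eq:
  fixes f :: "'a::euclidean_space \<Rightarrow> real"
  assumes S: "smooth_on (ball x e) f" and t: "0 < t" "t * (norm v + norm w) < e"
  obtains p where "norm (p - x) < e" "norm (p - x) \<le> t * (norm v + norm w)"
    "f (x + t *\<^sub>R v + t *\<^sub>R w) - f (x + t *\<^sub>R v) - f (x + t *\<^sub>R w) + f x
      = t\<^sup>2 * dir_deriv w (dir_deriv v f) p"
proof -
  have near: "norm (s *\<^sub>R v + r *\<^sub>R w) \<le> t * (norm v + norm w)"
    if "0 \<le> s" "s \<le> t" "0 \<le> r" "r \<le> t" for s r
  proof -
    have "norm (s *\<^sub>R v + r *\<^sub>R w) \<le> s * norm v + r * norm w"
      using norm_triangle_ineq[of "s *\<^sub>R v" "r *\<^sub>R w"] that by simp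
    also have "\<dots> \<le> t * (norm v + norm w)"
      using that by (simp add: distrib_left add_mono mult_right_mono)
    finally show ?thesis .
  qed
  have inS: "x + s *\<^sub>R v + r *\<^sub>R w \<in> ball x e"
    if "0 \<le> s" "s \<le> t" "0 \<le> r" "r \<le> t" for s r
    using near[OF that] t by (simp add: dist_norm algebra_simps norm_minus_commute)
  have df: "f differentiable (at y)" "dir_deriv v f differentiable (at y)" if "y \<in> ball x e" for y
    using that S smooth_on_differentiable smooth_on_dir_deriv by blast+
  \<comment> \<open>The increment of \<phi> over the interval from 0 to \<open>t\<close> is the
    second difference, and its derivative is a first difference of \<open>dir_deriv v f\<close>
    along \<open>w\<close>.\<close>
  define \<phi> where "\<phi> s = f (x + t *\<^sub>R w + s *\<^sub>R v) - f (x + s *\<^sub>R v)" for s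
  have "\<exists>z>0. z < t \<and> \<phi> t - \<phi> 0 = (t - 0) *
     (dir_deriv v f (x + t *\<^sub>R w + z *\<^sub>R v) - dir_deriv v f (x + z *\<^sub>R v))"
  proof (rule MVT2[OF t(1)])
    fix s assume "0 \<le> s" "s \<le> t"
    then show "DERIV \<phi> s :> dir_deriv v f (x + t *\<^sub>R w + s *\<^sub>R v) - dir_deriv v f (x + s *\<^sub>R v)"
      unfolding \<phi>_def using inS[of s t] inS[of s 0] t
      by (intro DERIV_diff has_real_derivative_along_line df) (auto simp: algebra_simps)
  qed
  then obtain s where s: "0 < s" "s < t" and 1: "\<phi> t - \<phi> 0 = t *
     (dir_deriv v f (x + t *\<^sub>R w + s *\<^sub>R v) - dir_deriv v f (x + s *\<^sub>R v))" by auto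
  have "\<exists>z>0. z < t \<and> dir_deriv v f (x + s *\<^sub>R v + t *\<^sub>R w) - dir_deriv v f (x + s *\<^sub>R v + 0 *\<^sub>R w)
     = (t - 0) * dir_deriv w (dir_deriv v f) (x + s *\<^sub>R v + z *\<^sub>R w)"
    using inS[of s] s by (intro MVT2[OF t(1)] has_real_derivative_along_line df) auto
  then obtain r where r: "0 < r" "r < t" and 2: "dir_deriv v f (x + s *\<^sub>R v + t *\<^sub>R w) - dir_deriv v f (x + s *\<^sub>R v)
     = t * dir_deriv w (dir_deriv v f) (x + s *\<^sub>R v + r *\<^sub>R w)" by auto
  show thesis
  proof
    show "norm (x + s *\<^sub>R v + r *\<^sub>R w - x) \<le> t * (norm v + norm w)"
      using near[of s r] s r by (simp add: algebra_simps)
    then show "norm (x + s *\<^sub>R v + r *\<^sub>R w - x) < e" using t by linarith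
    show "f (x + t *\<^sub>R v + t *\<^sub>R w) - f (x + t *\<^sub>R v) - f (x + t *\<^sub>R w) + f x
      = t\<^sup>2 * dir_deriv w (dir_deriv v f) (x + s *\<^sub>R v + r *\<^sub>R w)"
      using 1 2 unfolding \<phi>_def by (simp add: power2_eq_square algebra_simps)
  qed
qed

lemma dir_deriv_commute_real:
  fixes f :: "'a::euclidean_space \<Rightarrow> real"
  assumes "open S" "smooth_on S f" "x \<in> S"
  shows "dir_deriv v (dir_deriv w f) x = dir_deriv w (dir_deriv v f) x"
proof (rule ccontr)
  let ?g = "dir_deriv v (dir_deriv w f)" and ?h = "dir_deriv w (dir_deriv v f)"
  \<comment> \<open>Half of the gap: two errors below \<open>d\<close>, one for each mixed
    derivative, cannot bridge it.\<close>
  define d where "d = \<bar>?g x - ?h x\<bar> / 2"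
  assume "?g x \<noteq> ?h x"
  then have d: "0 < d" by (simp add: d_def)
  have "isCont ?g x" "isCont ?h x"
    using smooth_on_continuous[OF smooth_on_dir_deriv[OF smooth_on_dir_deriv[OF assms(2)]]]
      continuous_on_eq_continuous_at[OF assms(1)] assms(3) by blast+
  then have cont: "\<exists>e>0. \<forall>p. norm (p - x) < e \<longrightarrow> \<bar>?g p - ?g x\<bar> < d"
    "\<exists>e>0. \<forall>p. norm (p - x) < e \<longrightarrow> \<bar>?h p - ?h x\<bar> < d"
    using d unfolding continuous_at_eps_delta dist_norm real_norm_def by simp_all
  obtain e1 where e1: "0 < e1" "\<And>p. norm (p - x) < e1 \<Longrightarrow> \<bar>?g p - ?g x\<bar> < d"
    using cont(1) by blast
  obtain e2 where e2: "0 < e2" "\<And>p. norm (p - x) < e2 \<Longrightarrow> \<bar>?h p - ?h x\<bar> < d"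
    using cont(2) by blast
  obtain e3 where e3: "0 < e3" "ball x e3 \<subseteq> S"
    using assms open_contains_ball by blast
  define e where "e = min e1 (min e2 e3)"
  have e: "0 < e" "e \<le> e1" "e \<le> e2" "e \<le> e3" using e1 e2 e3 by (auto simp: e_def)
  \<comment> \<open>Keeps all points of the second difference within \<open>e\<close> of
    \<open>x\<close>; the summand 1 makes the denominator positive.\<close>
  define t where "t = e / (2 * (norm v + norm w + 1))"
  have "norm v + norm w + 1 > 0" by (simp add: add_nonneg_pos)
  then have t: "0 < t" "t * (norm v + norm w) < e"
    using e(1) by (auto simp: t_def field_simps intro: add_nonneg_pos add_pos_pos)
      (smt (verit) mult_nonneg_nonneg norm_ge_zero)
  have S': "smooth_on (ball x e) f"
    using assms(2) e3 e by (meson smooth_on_subset subset_ball subset_trans)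
  obtain p where p: "norm (p - x) < e" "f (x + t *\<^sub>R v + t *\<^sub>R w) - f (x + t *\<^sub>R v) - f (x + t *\<^sub>R w) + f x
      = t\<^sup>2 * ?h p"
    using second_difference_eq[OF S' t] by metis
  obtain q where q: "norm (q - x) < e" "f (x + t *\<^sub>R w + t *\<^sub>R v) - f (x + t *\<^sub>R w) - f (x + t *\<^sub>R v) + f x
      = t\<^sup>2 * ?g q"
    using second_difference_eq[OF S', of t w v] t by (metis add.commute)
  have "t\<^sup>2 * ?h p = t\<^sup>2 * ?g q"
    using p(2) q(2) by (simp add: algebra_simps)
  then have "?h p = ?g q" using t by simp
  then show False
    using e1(2)[of q] e2(2)[of p] p(1) q(1) e unfolding d_def by (simp add: abs_if split: if_splits)
qed

lemma dir_deriv_linear_compose: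
  assumes "bounded_linear h" "f differentiable (at x)"
  shows "dir_deriv v (\<lambda>x. h (f x)) x = h (dir_deriv v f x)"
  by (rule dir_deriv_eqI) (rule bounded_linear.has_derivative[OF assms(1) has_derivative_dir_deriv[OF assms(2)]])

lemma dir_deriv_commute:
  fixes f :: "'a::euclidean_space \<Rightarrow> 'b::euclidean_space"
  assumes "open S" "smooth_on S f" "x \<in> S"
  shows "dir_deriv v (dir_deriv w f) x = dir_deriv w (dir_deriv v f) x"
proof (rule euclidean_eqI)
  fix b :: 'b assume "b \<in> Basis"
  note lin = bounded_linear_inner_left[of b]
  have "dir_deriv v (dir_deriv w (\<lambda>x. f x \<bullet> b)) x = dir_deriv v (dir_deriv w f) x \<bullet> b" for v w
  proof -
    have "dir_deriv v (dir_deriv w (\<lambda>x. f x \<bullet> b)) x = dir_deriv v (\<lambda>x. dir_deriv w f x \<bullet> b) x"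
      using assms smooth_on_differentiable
      by (intro dir_deriv_cong[OF assms(1,3)] dir_deriv_linear_compose[OF lin]) auto
    also have "\<dots> = dir_deriv v (dir_deriv w f) x \<bullet> b"
      using assms smooth_on_differentiable[OF smooth_on_dir_deriv]
      by (intro dir_deriv_linear_compose[OF lin]) auto
    finally show ?thesis .
  qed
  then show "dir_deriv v (dir_deriv w f) x \<bullet> b = dir_deriv w (dir_deriv v f) x \<bullet> b"
    using dir_deriv_commute_real[OF assms(1) smooth_on_linear_compose[OF assms(1) lin assms(2)] assms(3)]
    by metis
qed

section \<open>Functions vanishing to a given order at a point\<close>

text \<open>For smooth \<open>f\<close> this says that all derivatives of order less than
  \<open>m\<close> are zero at \<open>a\<close>. In this recursive form a derivative lowers the
  order by one by definition, and \<open>vanish 1\<close> is a statement about the value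
  alone.\<close>

primrec vanish :: "nat \<Rightarrow> ('a::real_normed_vector \<Rightarrow> 'b::real_normed_vector) \<Rightarrow> 'a \<Rightarrow> bool" where
  "vanish 0 f a \<longleftrightarrow> True"
| "vanish (Suc m) f a \<longleftrightarrow> f a = 0 \<and> (\<forall>v. vanish m (dir_deriv v f) a)"

lemma vanish_Suc_imp: "vanish (Suc m) f a \<Longrightarrow> vanish m f a"
  by (induction m arbitrary: f) auto

lemma vanish_mono: "vanish m f a \<Longrightarrow> n \<le> m \<Longrightarrow> vanish n f a"
proof (induction m)
  case (Suc m)
  then show ?case
    using vanish_Suc_imp by (cases "n = Suc m") (blast, force simp del: vanish.simps)
qed simp

lemma vanish_dir_deriv: "vanish m f a \<Longrightarrow> vanish (m - 1) (dir_deriv v f) a"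
  by (cases m) auto

lemma vanish_cong:
  assumes "open S" "a \<in> S" "\<And>x. x \<in> S \<Longrightarrow> f x = g x" "vanish m f a"
  shows "vanish m g a"
  using assms(3,4)
proof (induction m arbitrary: f g)
  case (Suc m)
  have "vanish m (dir_deriv v g) a" for v
  proof (rule Suc.IH)
    show "dir_deriv v f x = dir_deriv v g x" if "x \<in> S" for x
      by (rule dir_deriv_cong[OF assms(1) that Suc.prems(1)])
    show "vanish m (dir_deriv v f) a" using Suc.prems(2) by simp
  qed
  moreover have "g a = 0" using Suc.prems(1)[OF assms(2)] Suc.prems(2) by simp
  ultimately show ?case by simp
qed simp

lemma vanish_const0: "vanish m (\<lambda>x. 0) a"
  by (induction m) auto

lemma vanish_add:
  assumes "open S" "a \<in> S" "smooth_on S f" "smooth_on S g" "vanish m f a" "vanish m g a"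
  shows "vanish m (\<lambda>x. f x + g x) a"
  using assms(3-6)
proof (induction m arbitrary: f g)
  case (Suc m)
  have "vanish m (dir_deriv v (\<lambda>x. f x + g x)) a" for v
  proof (rule vanish_cong[OF assms(1,2)])
    show "vanish m (\<lambda>x. dir_deriv v f x + dir_deriv v g x) a"
      using Suc by (auto intro!: Suc.IH smooth_on_dir_deriv)
    show "dir_deriv v f x + dir_deriv v g x = dir_deriv v (\<lambda>x. f x + g x) x" if "x \<in> S" for x
      using that Suc.prems assms(1)
      by (intro dir_deriv_eqI[symmetric] has_derivative_add smooth_on_has_derivative)
  qed
  then show ?case using Suc.prems by simp
qed simp

lemma vanish_linear_compose:
  assumes "open S" "a \<in> S" "bounded_linear h" "smooth_on S f" "vanish m f a"
  shows "vanish m (\<lambda>x. h (f x)) a"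
  using assms(4-5)
proof (induction m arbitrary: f)
  case (Suc m)
  have "vanish m (dir_deriv v (\<lambda>x. h (f x))) a" for v
  proof (rule vanish_cong[OF assms(1,2)])
    show "vanish m (\<lambda>x. h (dir_deriv v f x)) a"
      using Suc by (auto intro!: Suc.IH smooth_on_dir_deriv)
    show "h (dir_deriv v f x) = dir_deriv v (\<lambda>x. h (f x)) x" if "x \<in> S" for x
      using that Suc.prems assms smooth_on_differentiable
      by (intro dir_deriv_linear_compose[symmetric]) auto
  qed
  then show ?case using Suc.prems linear_0[OF bounded_linear.linear[OF assms(3)]] by simp
qed simp

lemma vanish_minus:
  "open S \<Longrightarrow> a \<in> S \<Longrightarrow> smooth_on S f \<Longrightarrow> vanish m f a \<Longrightarrow> vanish m (\<lambda>x. - f x) a"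
  by (rule vanish_linear_compose[OF _ _ bounded_linear_minus[OF bounded_linear_ident]])

lemma vanish_diff:
  assumes "open S" "a \<in> S" "smooth_on S f" "smooth_on S g" "vanish m f a" "vanish m g a"
  shows "vanish m (\<lambda>x. f x - g x) a"
  using vanish_add[OF assms(1-3) smooth_on_minus[OF assms(1,4)] assms(5) vanish_minus[OF assms(1,2,4,6)]]
  by simp

lemma vanish_sum:
  assumes "open S" "a \<in> S" "\<And>i. i \<in> I \<Longrightarrow> smooth_on S (f i)" "\<And>i. i \<in> I \<Longrightarrow> vanish m (f i) a"
  shows "vanish m (\<lambda>x. \<Sum>i\<in>I. f i x) a"
  using assms(3,4)
  by (induction I rule: infinite_finite_induct)
    (auto simp: vanish_const0 intro!: vanish_add[OF assms(1,2)] smooth_on_sum assms(1))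

text \<open>Induction on the total order \<open>m + n\<close>: each term of the product rule lowers
  exactly one of the two orders.\<close>

lemma vanish_bilinear:
  assumes "open S" "a \<in> S" "bounded_bilinear p"
    and "smooth_on S f" "smooth_on S g" "vanish m f a" "vanish n g a"
  shows "vanish (m + n) (\<lambda>x. p (f x) (g x)) a"
  using assms(4-)
proof (induction "m + n" arbitrary: m n f g)
  case (Suc k)
  note bl = assms(3)
  have m: "vanish k (dir_deriv v (\<lambda>x. p (f x) (g x))) a" for v
  proof (rule vanish_cong[OF assms(1,2)])
    have "vanish k (\<lambda>x. p (f x) (dir_deriv v g x)) a"
    proof (cases n)
      case 0
      \<comment> \<open>The order of \<open>g\<close> is already 0 and cannot drop, so the order of
        \<open>f\<close> is weakened by one to bring the total down to \<open>k\<close>.\<close>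
      then have "k = (m - 1) + 0" "vanish (m - 1) f a"
        using Suc.hyps(2) Suc.prems vanish_mono[of m f a "m - 1"] by simp_all
      then show ?thesis
        using Suc.prems by (simp only:) (intro Suc.hyps(1) smooth_on_dir_deriv; simp)
    next
      case (Suc n')
      then have "k = m + (n - 1)" using Suc.hyps(2) by simp
      then show ?thesis
        using Suc.prems by (simp only:) (intro Suc.hyps(1) vanish_dir_deriv smooth_on_dir_deriv; simp)
    qed
    moreover have "vanish k (\<lambda>x. p (dir_deriv v f x) (g x)) a"
    proof (cases m)
      case 0
      then have "k = 0 + (n - 1)" "vanish (n - 1) g a"
        using Suc.hyps(2) Suc.prems vanish_mono[of n g a "n - 1"] by simp_all
      then show ?thesis
        using Suc.prems by (simp only:) (intro Suc.hyps(1) smooth_on_dir_deriv; simp)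
    next
      case (Suc m')
      then have "k = (m - 1) + n" using Suc.hyps(2) by simp
      then show ?thesis
        using Suc.prems by (simp only:) (intro Suc.hyps(1) vanish_dir_deriv smooth_on_dir_deriv; simp)
    qed
    ultimately
    show "vanish k (\<lambda>x. p (f x) (dir_deriv v g x) + p (dir_deriv v f x) (g x)) a"
      using Suc.prems by (intro vanish_add[OF assms(1,2)] smooth_on_bilinear[OF assms(1) bl] smooth_on_dir_deriv)
    show "p (f x) (dir_deriv v g x) + p (dir_deriv v f x) (g x) = dir_deriv v (\<lambda>x. p (f x) (g x)) x"
      if "x \<in> S" for x
      using that Suc.prems assms(1)
      by (intro dir_deriv_eqI[symmetric] bounded_bilinear.FDERIV[OF bl] smooth_on_has_derivative)
  qed
  have "f a = 0 \<or> g a = 0"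
    using Suc by (cases m; cases n) auto
  then have "p (f a) (g a) = 0"
    using bounded_bilinear.zero_left[OF bl] bounded_bilinear.zero_right[OF bl] by auto
  then show ?case unfolding Suc.hyps(2)[symmetric] using m by simp
next
  case 0
  then show ?case by simp
qed

lemmas vanish_mult = vanish_bilinear[OF _ _ bounded_bilinear_mult]

lemma vanish_compose:
  fixes f :: "'a::euclidean_space \<Rightarrow> 'b::euclidean_space"
  assumes "open S" "a \<in> S" "open U" "f ` S \<subseteq> U" "smooth_on S f" "smooth_on U g" "vanish m g (f a)"
  shows "vanish m (\<lambda>x. g (f x)) a"
  using assms(6,7)
proof (induction m arbitrary: g)
  case (Suc m)
  have "vanish m (dir_deriv v (\<lambda>x. g (f x))) a" for v
  proof (rule vanish_cong[OF assms(1,2)])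
    have sm: "smooth_on S (\<lambda>x. dir_deriv v f x \<bullet> b)" "smooth_on S (\<lambda>x. dir_deriv b g (f x))" for b
      by (rule smooth_on_linear_compose[OF assms(1) bounded_linear_inner_left smooth_on_dir_deriv[OF assms(5)]])
        (rule smooth_on_compose[OF assms(1,3,4,5) smooth_on_dir_deriv[OF Suc.prems(1)]])
    have "vanish m (\<lambda>x. dir_deriv b g (f x)) a" for b
      using Suc.prems by (intro Suc.IH smooth_on_dir_deriv) auto
    then have "vanish (0 + m) (\<lambda>x. (dir_deriv v f x \<bullet> b) *\<^sub>R dir_deriv b g (f x)) a" for b
      by (intro vanish_bilinear[OF assms(1,2) bounded_bilinear_scaleR] sm) simp
    then show "vanish m (\<lambda>x. \<Sum>b\<in>Basis. (dir_deriv v f x \<bullet> b) *\<^sub>R dir_deriv b g (f x)) a"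
      by (intro vanish_sum[OF assms(1,2)] smooth_on_scaleR assms(1) sm) simp
    fix x assume "x \<in> S"
    then have "f differentiable (at x)" "g differentiable (at (f x))"
      using assms Suc.prems smooth_on_differentiable by (auto simp: image_subset_iff)
    then show "(\<Sum>b\<in>Basis. (dir_deriv v f x \<bullet> b) *\<^sub>R dir_deriv b g (f x)) = dir_deriv v (\<lambda>x. g (f x)) x"
      by (simp add: dir_deriv_compose dir_deriv_Basis[symmetric])
  qed
  then show ?case using Suc.prems by simp
qed simp

text \<open>Interpolation between \<open>f\<close> and its second derivative: over a step of length
  \<open>s\<close> the first derivative differs from a difference quotient by at most
  \<open>s\<close> times a bound of the second derivative, and the quotient is bounded by values of
  \<open>f\<close> divided by \<open>s\<close>. Flatness of order 2 (k + 1) for \<open>f\<close>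
  then gives order k + 1 for the derivative.\<close>

lemma flat_at_dir_deriv_real:
  fixes f :: "'a::euclidean_space \<Rightarrow> real"
  assumes "open S" "a \<in> S" "smooth_on S f" "flat_at f a"
  shows "flat_at (dir_deriv v f) a"
proof -
  let ?D = "dir_deriv v f" and ?DD = "dir_deriv v (dir_deriv v f)"
  obtain r where r: "0 < r" "cball a r \<subseteq> S"
    using assms open_contains_cball by blast
  have df: "f differentiable (at y)" "?D differentiable (at y)" if "y \<in> cball a r" for y
    using that r assms smooth_on_differentiable smooth_on_dir_deriv by blast+
  have "compact (?DD ` cball a r)"
    using smooth_on_continuous[OF smooth_on_dir_deriv[OF smooth_on_dir_deriv[OF assms(3)]]] r
    by (intro compact_continuous_image) (auto intro: continuous_on_subset)
  then have "bounded (?DD ` cball a r)" by (rule compact_imp_bounded)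
  then obtain B where B: "0 < B" "\<And>y. y \<in> cball a r \<Longrightarrow> \<bar>?DD y\<bar> \<le> B"
    unfolding bounded_pos real_norm_def by blast
  have "\<exists>K\<ge>0. \<exists>\<delta>>0. \<delta> \<le> 1 \<and> (\<forall>x. x \<noteq> a \<and> norm (x - a) < \<delta> \<longrightarrow> \<bar>?D x\<bar> \<le> K * norm (x - a) ^ Suc k)" for k
  proof -
    obtain C' where "\<forall>\<^sub>F x in nhds a. norm (f x) \<le> C' * norm (x - a) ^ (2 * Suc k)"
      using assms(4) unfolding flat_at_def by blast
    then obtain d where d: "0 < d" "\<And>x. norm (x - a) < d \<Longrightarrow> \<bar>f x\<bar> \<le> C' * norm (x - a) ^ (2 * Suc k)"
      unfolding eventually_nhds_metric dist_norm by auto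
    define C where "C = \<bar>C'\<bar>"
    have C0: "0 \<le> C" by (simp add: C_def)
    have C: "\<bar>f x\<bar> \<le> C * norm (x - a) ^ (2 * Suc k)" if "norm (x - a) < d" for x
      using d(2)[OF that] mult_right_mono[of C' "\<bar>C'\<bar>" "norm (x - a) ^ (2 * Suc k)"]
      unfolding C_def by fastforce
    define m where "m = min d r"
    \<comment> \<open>The bound 1 gives s \<le> \<rho> for the step length below; the divisor 1 +
      norm v then leaves room for a step of length at most \<rho> * norm v inside both
      balls.\<close>
    define \<delta> where "\<delta> = min 1 (m / (1 + norm v))"
    have v: "1 + norm v > 0" by (simp add: add_pos_nonneg)
    have "0 < m" using d r by (simp add: m_def)
    then have \<delta>: "0 < \<delta>" "\<delta> \<le> 1" "\<delta> * (1 + norm v) \<le> m" "0 < m"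
      using v unfolding pos_le_divide_eq[OF v, symmetric] by (simp_all add: \<delta>_def)
    define K where "K = C * (1 + norm v) ^ (2 * Suc k) + C + B"
    have "\<bar>?D x\<bar> \<le> K * norm (x - a) ^ Suc k" if "x \<noteq> a" "norm (x - a) < \<delta>" for x
    proof -
      define \<rho> where "\<rho> = norm (x - a)"
      \<comment> \<open>This choice balances the two error terms: f / s and s times the second
        derivative are both of order k + 1.\<close>
      define s where "s = \<rho> ^ Suc k"
      have \<rho>: "0 < \<rho>" "\<rho> < \<delta>" using that by (auto simp: \<rho>_def)
      have s: "0 < s" "s \<le> \<rho>"
        using \<rho> \<delta> by (auto simp: s_def mult_left_le power_le_one)
      have ss: "s * s = \<rho> ^ (2 * Suc k)"
        unfolding s_def by (simp only: power_add[symmetric] mult_2)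
      have near: "norm (x + q *\<^sub>R v - a) \<le> \<rho> * (1 + norm v)" if "0 \<le> q" "q \<le> s" for q
      proof -
        have "norm (x + q *\<^sub>R v - a) \<le> \<rho> + q * norm v"
          using norm_triangle_ineq[of "x - a" "q *\<^sub>R v"] that by (simp add: \<rho>_def algebra_simps)
        also have "\<dots> \<le> \<rho> * (1 + norm v)"
          using that s by (simp add: distrib_left mult_right_mono)
        finally show ?thesis .
      qed
      have \<rho>m: "\<rho> * (1 + norm v) < m"
        using \<rho> \<delta> v by (smt (verit) mult_strict_right_mono)
      have inS: "x + q *\<^sub>R v \<in> cball a r" if "0 \<le> q" "q \<le> s" for q
        using near[OF that] \<rho>m by (simp add: m_def dist_norm norm_minus_commute)
      have "\<exists>z>0. z < s \<and> f (x + s *\<^sub>R v) - f (x + 0 *\<^sub>R v) = (s - 0) * ?D (x + z *\<^sub>R v)"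
        using inS by (intro MVT2[OF s(1)] has_real_derivative_along_line df) auto
      then obtain z where z: "0 < z" "z < s" "f (x + s *\<^sub>R v) - f x = s * ?D (x + z *\<^sub>R v)"
        by auto
      have "\<exists>y>0. y < z \<and> ?D (x + z *\<^sub>R v) - ?D (x + 0 *\<^sub>R v) = (z - 0) * ?DD (x + y *\<^sub>R v)"
        using inS z by (intro MVT2[OF z(1)] has_real_derivative_along_line df) auto
      then obtain y where y: "0 < y" "y < z" "?D (x + z *\<^sub>R v) - ?D x = z * ?DD (x + y *\<^sub>R v)"
        by auto
      have "\<bar>?DD (x + y *\<^sub>R v)\<bar> \<le> B" using inS[of y] y z by (intro B) auto
      then have 1: "\<bar>z * ?DD (x + y *\<^sub>R v)\<bar> \<le> s * B"
        using z by (simp add: abs_mult mult_mono)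
      have "\<bar>f (x + s *\<^sub>R v)\<bar> \<le> C * norm (x + s *\<^sub>R v - a) ^ (2 * Suc k)"
        using near[of s] \<rho>m s by (intro C) (simp add: m_def)
      also have "\<dots> \<le> C * (\<rho> * (1 + norm v)) ^ (2 * Suc k)"
        using near[of s] s C0 by (intro mult_left_mono power_mono) auto
      also have "\<dots> = s * (s * (C * (1 + norm v) ^ (2 * Suc k)))"
        unfolding power_mult_distrib ss[symmetric] by (simp only: ac_simps)
      finally have 2: "\<bar>f (x + s *\<^sub>R v)\<bar> \<le> s * (s * (C * (1 + norm v) ^ (2 * Suc k)))" .
      have "\<bar>f x\<bar> \<le> C * \<rho> ^ (2 * Suc k)"
        using near[of 0] \<rho>m s unfolding \<rho>_def by (intro C) (simp add: m_def)
      also have "\<dots> = s * (s * C)"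
        unfolding ss[symmetric] by (simp only: ac_simps)
      finally have 3: "\<bar>f x\<bar> \<le> s * (s * C)" .
      have "s * \<bar>?D (x + z *\<^sub>R v)\<bar> = \<bar>f (x + s *\<^sub>R v) - f x\<bar>"
        using z s by (simp add: abs_mult)
      also have "\<dots> \<le> s * (s * (C * (1 + norm v) ^ (2 * Suc k)) + s * C)"
        using 2 3 by (simp add: distrib_left)
      finally have "\<bar>?D (x + z *\<^sub>R v)\<bar> \<le> s * (C * (1 + norm v) ^ (2 * Suc k)) + s * C"
        using s by simp
      then have "\<bar>?D x\<bar> \<le> s * (C * (1 + norm v) ^ (2 * Suc k)) + s * C + s * B"
        using y 1 by linarith
      then show ?thesis
        unfolding K_def s_def \<rho>_def by (simp only: distrib_right distrib_left ac_simps)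
    qed
    moreover have "0 \<le> K" using C0 B(1) by (simp add: K_def add_pos_nonneg less_imp_le)
    ultimately show ?thesis using \<delta> by blast
  qed
  note est = this
  \<comment> \<open>The estimate speaks only of points other than \<open>a\<close>; the value at
    \<open>a\<close> follows from it by continuity.\<close>
  have "?D a = 0"
  proof -
    obtain K \<delta> where K: "0 < \<delta>" "\<And>x. x \<noteq> a \<Longrightarrow> norm (x - a) < \<delta> \<Longrightarrow> \<bar>?D x\<bar> \<le> K * norm (x - a) ^ Suc 0"
      using est[of 0] by blast
    have "((\<lambda>x. K * norm (x - a) ^ Suc 0) \<longlongrightarrow> K * norm (a - a) ^ Suc 0) (at a)"
      by (intro tendsto_intros)
    then have "((\<lambda>x. K * norm (x - a) ^ Suc 0) \<longlongrightarrow> 0) (at a)" by simp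
    moreover have "\<forall>\<^sub>F x in at a. norm (?D x) \<le> K * norm (x - a) ^ Suc 0"
      using K unfolding eventually_at by (auto simp: dist_norm)
    ultimately have "(?D \<longlongrightarrow> 0) (at a)" by (rule Lim_null_comparison[rotated])
    moreover have "(?D \<longlongrightarrow> ?D a) (at a)"
      using differentiable_imp_continuous_within[OF df(2)[of a]] r by (simp add: continuous_within)
    ultimately show ?thesis using tendsto_unique trivial_limit_at by blast
  qed
  show ?thesis
    unfolding flat_at_def
  proof
    fix k
    obtain K \<delta> where K: "0 \<le> K" "0 < \<delta>" "\<delta> \<le> 1"
      "\<And>x. x \<noteq> a \<Longrightarrow> norm (x - a) < \<delta> \<Longrightarrow> \<bar>?D x\<bar> \<le> K * norm (x - a) ^ Suc k"
      using est[of k] by blast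
    have "norm (?D x) \<le> K * norm (x - a) ^ k" if "norm (x - a) < \<delta>" for x
    proof (cases "x = a")
      case False
      have "norm (x - a) ^ Suc k \<le> norm (x - a) ^ k"
        using that K by (intro power_decreasing) auto
      then show ?thesis using K(4)[OF False that] K(1) mult_left_mono by fastforce
    qed (use \<open>?D a = 0\<close> K(1) in simp)
    then show "\<exists>C. \<forall>\<^sub>F x in nhds a. norm (?D x) \<le> C * norm (x - a) ^ k"
      unfolding eventually_nhds_metric dist_norm using K(2) by blast
  qed
qed

lemma vanish_flat_at_real:
  fixes f :: "'a::euclidean_space \<Rightarrow> real"
  assumes "open S" "a \<in> S" "smooth_on S f" "flat_at f a"
  shows "vanish m f a"
  using assms(3,4)
proof (induction m arbitrary: f)
  case (Suc m)
  obtain C where "\<forall>\<^sub>F x in nhds a. norm (f x) \<le> C * norm (x - a) ^ 1"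
    using Suc.prems unfolding flat_at_def by blast
  then have "norm (f a) \<le> C * norm (a - a) ^ 1" by (rule eventually_nhds_x_imp_x)
  then have "f a = 0" by simp
  then show ?case
    using Suc.prems
    by (auto intro!: Suc.IH flat_at_dir_deriv_real[OF assms(1,2)] smooth_on_dir_deriv)
qed simp

lemma vanish_flat_at:
  fixes f :: "'a::euclidean_space \<Rightarrow> 'b::euclidean_space"
  assumes "open S" "a \<in> S" "smooth_on S f" "flat_at f a"
  shows "vanish m f a"
proof -
  have "vanish m (\<lambda>x. f x \<bullet> b) a" if "b \<in> Basis" for b
  proof (rule vanish_flat_at_real[OF assms(1,2)])
    show "flat_at (\<lambda>x. f x \<bullet> b) a"
      unfolding flat_at_def
    proof
      fix k
      obtain C where C: "\<forall>\<^sub>F x in nhds a. norm (f x) \<le> C * norm (x - a) ^ k"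
        using assms(4) unfolding flat_at_def by blast
      have "\<forall>\<^sub>F x in nhds a. norm (f x \<bullet> b) \<le> C * norm (x - a) ^ k"
        by (rule eventually_mono[OF C]) (use Basis_le_norm[OF that] order_trans in fastforce)
      then show "\<exists>C. \<forall>\<^sub>F x in nhds a. norm (f x \<bullet> b) \<le> C * norm (x - a) ^ k" ..
    qed
  qed (rule smooth_on_linear_compose[OF assms(1) bounded_linear_inner_left assms(3)])
  then have "vanish m (\<lambda>x. \<Sum>b\<in>Basis. (f x \<bullet> b) *\<^sub>R b) a"
    using assms
    by (intro vanish_sum[OF assms(1,2)] smooth_on_linear_compose[OF _ bounded_linear_scaleR_left]
        vanish_linear_compose[OF assms(1,2) bounded_linear_scaleR_left]
        smooth_on_linear_compose[OF _ bounded_linear_inner_left])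
  then show ?thesis by (simp add: euclidean_representation)
qed

section \<open>Smooth local inverses\<close>

text \<open>The smooth inverse function theorem, normalized to have identity derivative at
  \<open>a\<close>. Closeness of the derivative to the identity gives local injectivity, invariance
  of domain gives openness of the image, and a formula for the derivative of the inverse gives
  smoothness.\<close>

lemma smooth_local_inverse:
  fixes f :: "real^'d \<Rightarrow> real^'d"
  assumes "open V" "a \<in> V" "smooth_on V f" "\<And>v. dir_deriv v f a = v"
  obtains S g where "open S" "a \<in> S" "S \<subseteq> V" "open (f ` S)" "smooth_on (f ` S) g"
    "\<And>x. x \<in> S \<Longrightarrow> g (f x) = x"
proof -
  define J where "J x = (\<chi> i j. dir_deriv (axis j 1) f x $ i)" for x
  have der: "(f has_derivative (\<lambda>v. dir_deriv v f x)) (at x)" if "x \<in> V" for x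
    using that assms smooth_on_has_derivative by blast
  have J: "J x *v v = dir_deriv v f x" if "x \<in> V" for x v
  proof -
    have "dir_deriv v f x = dir_deriv (\<Sum>j\<in>UNIV. (v $ j) *\<^sub>R axis j 1) f x"
      using basis_expansion[of v] by (simp add: scalar_mult_eq_scaleR)
    also have "\<dots> = (\<Sum>j\<in>UNIV. (v $ j) *\<^sub>R dir_deriv (axis j 1) f x)"
      using linear_dir_deriv[OF smooth_on_differentiable[OF assms(3,1) that]]
      by (simp add: linear_sum[where f = "\<lambda>v. dir_deriv v f x"] linear_scale[where f = "\<lambda>v. dir_deriv v f x"])
    finally show ?thesis
      by (simp add: vec_eq_iff J_def matrix_vector_mult_def mult.commute)
  qed
  have JD: "(*v) (J x) = (\<lambda>v. dir_deriv v f x)" if "x \<in> V" for x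
    using J[OF that] by (rule ext)
  have smJ: "smooth_on V (\<lambda>x. J x $ i $ j)" for i j
    unfolding J_def using smooth_on_nth[OF assms(1) smooth_on_dir_deriv[OF assms(3)]] by simp
  have "J a = mat 1"
    by (auto simp: J_def assms(4) vec_eq_iff mat_def axis_def)
  then have detJ: "det (J a) \<noteq> 0" by simp
  have contdet: "continuous_on V (\<lambda>x. det (J x))"
    by (intro smooth_on_continuous smooth_on_det assms(1) smJ)
  define V1 where "V1 = V \<inter> (\<lambda>x. det (J x)) -` (- {0})"
  have V1: "open V1" "a \<in> V1" "V1 \<subseteq> V"
    using continuous_on_open_vimage[OF assms(1), of "\<lambda>x. det (J x)"] contdet detJ assms(2)
    by (auto simp: V1_def Int_commute)
  have cont: "\<exists>d>0. \<forall>x. dist a x < d \<longrightarrow> onorm (\<lambda>v. (J x *v v) - J a *v v) < e" if "0 < e" for e :: real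
  proof -
    \<comment> \<open>This finite sum over basis vectors dominates the operator norm of the
      difference of the derivatives and is continuous by inspection.\<close>
    have "continuous_on V (\<lambda>x. \<Sum>b\<in>Basis. norm (dir_deriv b f x - dir_deriv b f a))"
      by (intro continuous_intros smooth_on_continuous smooth_on_dir_deriv assms)
    then have "isCont (\<lambda>x. \<Sum>b\<in>Basis. norm (dir_deriv b f x - dir_deriv b f a)) a"
      using assms by (simp add: continuous_on_eq_continuous_at)
    then have "\<exists>d>0. \<forall>x. dist x a < d \<longrightarrow> dist (\<Sum>b\<in>Basis. norm (dir_deriv b f x - dir_deriv b f a))
        (\<Sum>b\<in>Basis. norm (dir_deriv b f a - dir_deriv b f a)) < e"
      using that unfolding continuous_at_eps_delta by blast
    then obtain d1 where d1: "0 < d1" "\<And>x. dist x a < d1 \<Longrightarrow>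
        dist (\<Sum>b\<in>Basis. norm (dir_deriv b f x - dir_deriv b f a)) 0 < e"
      by auto
    obtain d2 where d2: "0 < d2" "ball a d2 \<subseteq> V"
      using assms open_contains_ball by blast
    have "onorm (\<lambda>v. (J x *v v) - J a *v v) < e" if "dist a x < min d1 d2" for x
    proof -
      have xV: "x \<in> V" using that d2 by auto
      have "onorm (\<lambda>v. (J x *v v) - J a *v v) \<le> (\<Sum>b\<in>Basis. norm ((J x *v b) - J a *v b))"
        by (intro onorm_componentwise bounded_linear_sub) auto
      also have "\<dots> < e"
        using d1(2)[of x] that by (simp add: J[OF xV] J[OF assms(2)] dist_commute)
      finally show ?thesis .
    qed
    then show ?thesis using d1 d2 by (intro exI[of _ "min d1 d2"]) auto
  qed
  obtain r where r: "0 < r" "ball a r \<subseteq> V1" "inj_on f (ball a r)"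
  proof (rule has_derivative_locally_injective[of a V1 id "\<lambda>x v. J x *v v" f])
    show "(f has_derivative (*v) (J x)) (at x)" if "x \<in> V1" for x
      using der[of x] V1(3) that by (simp add: subset_iff JD)
    show "\<exists>d>0. \<forall>x. dist a x < d \<longrightarrow> onorm (\<lambda>v. J x *v v - J a *v v) < e" if "0 < e" for e
      using cont[OF that] .
  qed (use V1 \<open>J a = mat 1\<close> in \<open>auto simp: fun_eq_iff bounded_linear_ident id_def\<close>)
  define S where "S = ball a r"
  define g where "g = inv_into S f"
  have S: "open S" "a \<in> S" "S \<subseteq> V" "S \<subseteq> V1" "inj_on f S"
    using r V1 by (auto simp: S_def)
  have gf: "g (f x) = x" if "x \<in> S" for x
    using that S by (simp add: g_def inv_into_f_f)
  have opf: "open (f ` S)"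
    using S smooth_on_continuous[OF assms(3)] by (intro invariance_of_domain) (auto intro: continuous_on_subset)
  have dS: "det (J x) \<noteq> 0" if "x \<in> S" for x
    using S(4) that by (auto simp: V1_def)
  have inv: "matrix_inv (J x) ** J x = mat 1" "J x ** matrix_inv (J x) = mat 1" if "x \<in> S" for x
    using S(4) that matrix_mult_inv[of "J x"] by (auto simp: V1_def)
  have gder: "(g has_derivative (\<lambda>w. matrix_inv (J (g y)) *v w)) (at y)" if y: "y \<in> f ` S" for y
  proof -
    obtain x where x: "x \<in> S" "y = f x" using y by blast
    have "(g has_derivative (\<lambda>w. matrix_inv (J x) *v w)) (at (f x))"
    proof (rule has_derivative_inverse_on[of S f "\<lambda>x v. J x *v v"])
      show "(f has_derivative (*v) (J x)) (at x)" if "x \<in> S" for x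
        using der[of x] S(3) that by (simp add: subset_iff JD)
      show "(*v) (J x) \<circ> (*v) (matrix_inv (J x)) = id"
        using inv[OF x(1)] by (simp add: fun_eq_iff matrix_vector_mul_assoc)
    qed (use S gf x in auto)
    then show ?thesis using x gf by simp
  qed
  \<comment> \<open>Bootstrapping: the derivative of \<open>g\<close> is a smooth matrix function
    composed with \<open>g\<close>, so it is as regular as \<open>g\<close> is already known to
    be.\<close>
  have "Ck_on k (f ` S) g" for k
  proof (induction k)
    case 0
    have "continuous (at y) g" if "y \<in> f ` S" for y
      using gder[OF that] has_derivative_continuous by blast
    then show ?case by (simp add: opf continuous_on_eq_continuous_at)
  next
    case (Suc k)
    show ?case
    proof (rule Ck_on_SucI[OF opf gder])
      fix w
      have "smooth_on S (\<lambda>x. matrix_inv (J x) *v w)"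
      proof (rule smooth_on_vec[OF S(1)])
        show "smooth_on S (\<lambda>x. (matrix_inv (J x) *v w) $ i)" for i
          unfolding matrix_vector_mult_def vec_lambda_beta
          by (intro smooth_on_sum[OF S(1)] smooth_on_mult[OF S(1)] smooth_on_const[OF S(1)]
              smooth_on_matrix_inv[OF S(1) smooth_on_subset[OF smJ S(3)] dS])
      qed
      then show "Ck_on k (f ` S) (\<lambda>y. matrix_inv (J (g y)) *v w)"
        using gf by (intro Ck_on_compose[OF opf S(1) _ Suc smooth_onD]) auto
    qed
  qed
  then show thesis using that[OF S(1-3) opf _ gf] by (simp add: smooth_on_def)
qed

section \<open>The Laplacian of a metric with a Kaehler potential\<close>

abbreviation cpart :: "'m \<times> bool \<Rightarrow> complex" where
  "cpart I \<equiv> (if snd I then \<i> else 1)"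

text \<open>Multiplication by \<open>\<i>\<close> maps the vector of index \<open>I\<close> to \<open>isgn I\<close> times that of index \<open>irot I\<close>.\<close>

definition irot :: "'m \<times> bool \<Rightarrow> 'm \<times> bool" where
  "irot I = (fst I, \<not> snd I)"

definition isgn :: "'m \<times> bool \<Rightarrow> real" where
  "isgn I = (if snd I then - 1 else 1)"

lemma irot_simps [simp]:
  "irot (irot I) = I" "isgn (irot I) = - isgn I" "isgn I * isgn I = 1" "isgn I * (isgn I * x) = x"
  by (auto simp: irot_def isgn_def)

lemma irot_eq_iff [simp]: "irot I = irot J \<longleftrightarrow> I = J"
  by (metis irot_simps(1))

lemma sum_irot: "(\<Sum>I\<in>UNIV. F (irot I)) = (\<Sum>I\<in>UNIV. F I)"
  for F :: "('m::finite \<times> bool) \<Rightarrow> 'a::comm_monoid_add"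
  by (rule sum.reindex_bij_witness[of _ irot irot]) auto

lemma scale_i_cframe: "\<i> *s cframe I = isgn I *\<^sub>R cframe (irot I)"
  by (auto simp: cframe_def irot_def isgn_def vec_eq_iff axis_def)

abbreviation cderiv :: "'m::finite \<times> bool \<Rightarrow> (complex^'m \<Rightarrow> 'b::real_normed_vector) \<Rightarrow> complex^'m \<Rightarrow> 'b" where
  "cderiv I \<equiv> dir_deriv (cframe I)"

text \<open>The expression in \<open>ambient_metric\<close> with a general potential in place of
  |z_0|^2 u, the form in which the Laplacian is studied.\<close>

definition kahler_gram :: "(complex^'m::finite \<Rightarrow> real) \<Rightarrow> complex^'m \<Rightarrow> real^('m \<times> bool)^('m \<times> bool)" where
  "kahler_gram \<phi> x = (\<chi> I J. - Re (\<Sum>j\<in>UNIV. \<Sum>k\<in>UNIV.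
     dzbar k (dz j (\<lambda>y. complex_of_real (\<phi> y))) x * cframe I $ j * cnj (cframe J $ k)))"

lemma ambient_metric_eq:
  "ambient_metric u = kahler_gram (\<lambda>y. (cmod (y $ None))\<^sup>2 * u (amb_base y))"
  by (rule ext) (simp only: ambient_metric_def kahler_gram_def Let_def)

section \<open>The Gram matrix in terms of the real Hessian of the potential\<close>

lemma dir_deriv_of_real:
  assumes "f differentiable (at x)"
  shows "dir_deriv v (\<lambda>y. complex_of_real (f y)) x = complex_of_real (dir_deriv v f x)"
  by (rule dir_deriv_linear_compose[OF bounded_linear_of_real assms])

lemma dz_of_real:
  assumes "f differentiable (at x)"
  shows "dz j (\<lambda>y. complex_of_real (f y)) x
    = (complex_of_real (cderiv (j, False) f x) - \<i> * complex_of_real (cderiv (j, True) f x)) / 2"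
  unfolding dz_def cframe_def by (simp add: dir_deriv_of_real[OF assms])

lemma dzbar_dz_of_real:
  fixes f :: "complex^'m::finite \<Rightarrow> real"
  assumes "open S" "smooth_on S f" "x \<in> S"
  shows "dzbar k (dz j (\<lambda>y. complex_of_real (f y))) x
    = Complex (cderiv (k, False) (cderiv (j, False) f) x + cderiv (k, True) (cderiv (j, True) f) x)
        (cderiv (k, True) (cderiv (j, False) f) x - cderiv (k, False) (cderiv (j, True) f) x) / 4"
proof -
  have d: "dir_deriv v (dz j (\<lambda>y. complex_of_real (f y))) x
    = (complex_of_real (dir_deriv v (cderiv (j, False) f) x) - \<i> * complex_of_real (dir_deriv v (cderiv (j, True) f) x)) / 2"
    for v
  proof -
    have "dir_deriv v (dz j (\<lambda>y. complex_of_real (f y))) x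
      = dir_deriv v (\<lambda>x. (complex_of_real (cderiv (j, False) f x) - \<i> * complex_of_real (cderiv (j, True) f x)) / 2) x"
      using assms smooth_on_differentiable
      by (intro dir_deriv_cong[OF assms(1,3)] dz_of_real) blast
    also have "((\<lambda>x. (complex_of_real (cderiv (j, False) f x) - \<i> * complex_of_real (cderiv (j, True) f x)) / 2)
      has_derivative (\<lambda>v. (complex_of_real (dir_deriv v (cderiv (j, False) f) x) - \<i> * complex_of_real (dir_deriv v (cderiv (j, True) f) x)) / 2)) (at x)"
      using assms smooth_on_has_derivative smooth_on_dir_deriv
      by (intro bounded_linear.has_derivative[OF bounded_linear_divide] has_derivative_diff has_derivative_mult_right
          bounded_linear.has_derivative[OF bounded_linear_of_real]) blast+
    from dir_deriv_eqI[OF this] show ?thesis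
      using calculation by simp
  qed
  show ?thesis
    unfolding dzbar_def[of k] d by (simp add: cframe_def complex_eq_iff field_simps)
qed

lemma kahler_gram_entry:
  fixes \<phi> :: "complex^'m::finite \<Rightarrow> real"
  shows "kahler_gram \<phi> x $ I $ J
    = - Re (dzbar (fst J) (dz (fst I) (\<lambda>y. complex_of_real (\<phi> y))) x * cpart I * cnj (cpart J))"
proof -
  let ?H = "\<lambda>j k. dzbar k (dz j (\<lambda>y. complex_of_real (\<phi> y))) x"
  have cf: "cframe I $ j = (if j = fst I then cpart I else 0)" for I and j :: 'm
    by (simp add: cframe_def axis_def)
  have "kahler_gram \<phi> x $ I $ J = - Re (\<Sum>j\<in>UNIV. \<Sum>k\<in>UNIV.
      (if k = fst J then if j = fst I then ?H j k * cpart I * cnj (cpart J) else 0 else 0))"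
    unfolding kahler_gram_def vec_lambda_beta cf
    by (intro arg_cong[where f = "\<lambda>z. - Re z"] sum.cong refl) simp
  then show ?thesis
    by (simp only: sum.delta finite UNIV_I if_True)
qed

text \<open>The real part of the complex Hessian averages the real Hessian over multiplication of
  both arguments by i; \<open>isgn\<close> and \<open>irot\<close> express that rotation in the
  frame. The quarter comes from the two halves in the Wirtinger derivatives.\<close>

lemma kahler_gram_eq:
  fixes \<phi> :: "complex^'m::finite \<Rightarrow> real"
  assumes "open S" "smooth_on S \<phi>" "x \<in> S"
  shows "kahler_gram \<phi> x $ I $ J
    = (- 1 / 4) * (cderiv I (cderiv J \<phi>) x + (isgn I * isgn J) * cderiv (irot I) (cderiv (irot J) \<phi>) x)"
  unfolding kahler_gram_entry dzbar_dz_of_real[OF assms]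
  using dir_deriv_commute[OF assms]
  by (cases I; cases J) (auto simp: irot_def isgn_def field_simps)

lemma smooth_on_kahler_gram:
  assumes "open S" "smooth_on S \<phi>"
  shows "smooth_on S (\<lambda>x. kahler_gram \<phi> x $ I $ J)"
proof (rule smooth_on_cong[OF assms(1)])
  show "smooth_on S (\<lambda>x. (- 1 / 4) * (cderiv I (cderiv J \<phi>) x + (isgn I * isgn J) * cderiv (irot I) (cderiv (irot J) \<phi>) x))"
    by (intro smooth_on_mult smooth_on_add smooth_on_const smooth_on_dir_deriv assms)
qed (simp add: kahler_gram_eq[OF assms])

section \<open>Symmetries of the inverse Gram matrix\<close>

lemma matrix_inv_unique:
  fixes A :: "'a::field^'n^'n"
  assumes "A ** B = mat 1"
  shows "matrix_inv A = B"
proof -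
  have "det A * det B = 1" using arg_cong[OF assms, of det] by (simp add: det_mul)
  then have "matrix_inv A ** A = mat 1" by (intro matrix_mult_inv) auto
  then show ?thesis
    using assms by (metis matrix_mul_assoc matrix_mul_lid matrix_mul_rid)
qed

lemma matrix_inv_sym:
  fixes A :: "'a::field^'n^'n"
  assumes "det A \<noteq> 0" "\<And>i j. A $ i $ j = A $ j $ i"
  shows "matrix_inv A $ i $ j = matrix_inv A $ j $ i"
proof -
  have "transpose A = A" using assms(2) by (simp add: transpose_def vec_eq_iff)
  then have "A ** transpose (matrix_inv A) = mat 1"
    using matrix_mult_inv(2)[OF assms(1)] by (metis matrix_transpose_mul transpose_mat)
  from matrix_inv_unique[OF this] have "matrix_inv A = transpose (matrix_inv A)" .
  then have "matrix_inv A $ i $ j = transpose (matrix_inv A) $ i $ j" by simp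
  then show ?thesis by (simp add: transpose_def)
qed

text \<open>The matrix is invariant under multiplication of both arguments by i. Rotating its
  inverse in the same way gives another right inverse, and inverses are unique.\<close>

lemma matrix_inv_irot:
  fixes A :: "real^('m::finite \<times> bool)^('m \<times> bool)"
  assumes "det A \<noteq> 0" "\<And>I J. A $ I $ J = isgn I * isgn J * A $ irot I $ irot J"
  shows "matrix_inv A $ I $ J = isgn I * isgn J * matrix_inv A $ irot I $ irot J"
proof -
  define B where "B = (\<chi> I J. isgn I * isgn J * matrix_inv A $ irot I $ irot J)"
  have "(A ** B) $ I $ K = (mat 1 :: real^('m \<times> bool)^('m \<times> bool)) $ I $ K" for I K
  proof -
    have "(A ** B) $ I $ K = (\<Sum>J\<in>UNIV. isgn I * isgn K * (A $ irot I $ irot J * matrix_inv A $ irot J $ irot K))"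
      unfolding matrix_matrix_mult_def B_def
      by (subst assms(2)) (auto intro!: sum.cong simp: algebra_simps)
    also have "\<dots> = isgn I * isgn K * (\<Sum>J\<in>UNIV. A $ irot I $ J * matrix_inv A $ J $ irot K)"
      using sum_irot[of "\<lambda>J. A $ irot I $ J * matrix_inv A $ J $ irot K"] by (simp add: sum_distrib_left[symmetric])
    also have "(\<Sum>J\<in>UNIV. A $ irot I $ J * matrix_inv A $ J $ irot K) = (A ** matrix_inv A) $ irot I $ irot K"
      by (simp add: matrix_matrix_mult_def)
    finally show ?thesis
      using matrix_mult_inv(1)[OF assms(1)] by (auto simp: mat_def)
  qed
  then have "A ** B = mat 1" by (simp add: vec_eq_iff)
  from matrix_inv_unique[OF this] have "matrix_inv A $ I $ J = B $ I $ J" by simp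
  then show ?thesis by (simp add: B_def)
qed

text \<open>In a Kaehler metric the coordinates are harmonic: the contraction of the Christoffel
  symbols vanishes because the third derivatives of the potential are symmetric.\<close>

lemma contracted_third_derivatives:
  fixes h :: "'m::finite \<times> bool \<Rightarrow> 'm \<times> bool \<Rightarrow> real"
  assumes sym: "\<And>I J. h I J = h J I" and inv: "\<And>I J. h I J = isgn I * isgn J * h (irot I) (irot J)"
    and A1: "\<And>I J L. A I J L = A J I L" and A2: "\<And>I J L. A I J L = A I L J"
  shows "(\<Sum>I\<in>UNIV. \<Sum>J\<in>UNIV. h I J *
      ((A I J L + isgn J * isgn L * A I (irot J) (irot L)) + (A J I L + isgn I * isgn L * A J (irot I) (irot L))
       - (A L I J + isgn I * isgn J * A L (irot I) (irot J)))) = 0"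
proof -
  define s where "s F = (\<Sum>I\<in>UNIV. \<Sum>J\<in>UNIV. h I J * F I J)" for F
  have flip: "s F = s (\<lambda>I J. F J I)" for F
    unfolding s_def by (subst sum.swap) (simp add: sym)
  have rot: "s F = s (\<lambda>I J. isgn I * isgn J * F (irot I) (irot J))" for F
  proof -
    have "s F = (\<Sum>I\<in>UNIV. \<Sum>J\<in>UNIV. h (irot I) (irot J) * F (irot I) (irot J))"
      unfolding s_def by (simp add: sum_irot[of "\<lambda>J. h _ J * F _ J"] sum_irot[of "\<lambda>I. \<Sum>J\<in>UNIV. h I J * F I J"])
    also have "\<dots> = s (\<lambda>I J. isgn I * isgn J * F (irot I) (irot J))"
      unfolding s_def by (subst (2) inv) (simp add: algebra_simps)
    finally show ?thesis .
  qed
  have add: "s (\<lambda>I J. F I J + G I J) = s F + s G" "s (\<lambda>I J. F I J - G I J) = s F - s G" for F G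
    by (simp_all add: s_def algebra_simps sum.distrib sum_subtractf)
  have neg: "s (\<lambda>I J. - F I J) = - s F" "s (\<lambda>I J. c * F I J) = c * s F" for F c
    by (simp_all add: s_def sum_negf sum_distrib_left algebra_simps)
  \<comment> \<open>Rotating the index pair, then using the symmetry of \<open>A\<close> and of
    \<open>h\<close>, returns the same sum with the opposite sign.\<close>
  have zero: "s (\<lambda>I J. isgn J * A I (irot J) M) = 0" for M
  proof -
    have "s (\<lambda>I J. isgn J * A I (irot J) M) = s (\<lambda>I J. - (isgn I * A (irot I) J M))"
      by (subst rot) (simp add: algebra_simps)
    also have "\<dots> = - s (\<lambda>I J. isgn I * A J (irot I) M)"
      unfolding neg using A1 by simp
    also have "\<dots> = - s (\<lambda>I J. isgn J * A I (irot J) M)"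
      by (subst flip) simp
    finally show ?thesis by simp
  qed
  have 1: "s (\<lambda>I J. isgn J * isgn L * A I (irot J) (irot L)) = 0"
    using zero[of "irot L"] neg(2)[of "isgn L" "\<lambda>I J. isgn J * A I (irot J) (irot L)"] by (simp add: ac_simps)
  have 2: "s (\<lambda>I J. isgn I * isgn L * A J (irot I) (irot L)) = 0"
    using 1 by (subst flip) simp
  \<comment> \<open>Here the rotated indices are exactly the contracted ones, so this term survives
    and equals the unrotated one. The two copies subtracted cancel the two copies in
    \<open>4\<close>.\<close>
  have 3: "s (\<lambda>I J. isgn I * isgn J * A L (irot I) (irot J)) = s (\<lambda>I J. A L I J)"
    by (subst (2) rot) simp
  have 4: "s (\<lambda>I J. A I J L) = s (\<lambda>I J. A L I J)" "s (\<lambda>I J. A J I L) = s (\<lambda>I J. A L I J)"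
    using A1 A2 by metis+
  have "s (\<lambda>I J. (A I J L + isgn J * isgn L * A I (irot J) (irot L)) + (A J I L + isgn I * isgn L * A J (irot I) (irot L))
       - (A L I J + isgn I * isgn J * A L (irot I) (irot J))) = 0"
    unfolding add 1 2 3 4 by simp
  then show ?thesis unfolding s_def .
qed

lemma kahler_gram_sym:
  assumes "open S" "smooth_on S \<phi>" "x \<in> S"
  shows "kahler_gram \<phi> x $ I $ J = kahler_gram \<phi> x $ J $ I"
  using dir_deriv_commute[OF assms] by (simp add: kahler_gram_eq[OF assms] ac_simps)

lemma kahler_gram_irot:
  assumes "open S" "smooth_on S \<phi>" "x \<in> S"
  shows "kahler_gram \<phi> x $ I $ J = isgn I * isgn J * kahler_gram \<phi> x $ irot I $ irot J"
  by (simp add: kahler_gram_eq[OF assms] algebra_simps)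

text \<open>The first-order coefficients are contractions of the Christoffel symbols with the
  inverse metric, which \<open>contracted_third_derivatives\<close> makes zero. All later arguments
  use this purely second-order formula.\<close>

lemma laplacian_kahler_gram:
  fixes \<phi> :: "complex^'m::finite \<Rightarrow> real"
  assumes S: "open S" "smooth_on S \<phi>" "x \<in> S" and det: "det (kahler_gram \<phi> x) \<noteq> 0"
  shows "laplacian (kahler_gram \<phi>) f x
    = - (\<Sum>I\<in>UNIV. \<Sum>J\<in>UNIV. matrix_inv (kahler_gram \<phi> x) $ I $ J * cderiv I (cderiv J f) x)"
proof -
  let ?g = "kahler_gram \<phi>"
  define h where "h I J = matrix_inv (?g x) $ I $ J" for I J
  define A where "A I J L = cderiv I (cderiv J (cderiv L \<phi>)) x" for I J L
  have hs: "h I J = h J I" "h I J = isgn I * isgn J * h (irot I) (irot J)" for I J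
    unfolding h_def
    using matrix_inv_sym[OF det kahler_gram_sym[OF S]] matrix_inv_irot[OF det kahler_gram_irot[OF S]] by blast+
  have A1: "A I J L = A J I L" for I J L
    unfolding A_def using dir_deriv_commute[OF S(1) smooth_on_dir_deriv[OF S(2)] S(3)] by blast
  have A2: "A I J L = A I L J" for I J L
    unfolding A_def using dir_deriv_commute[OF S(1,2)] by (intro dir_deriv_cong[OF S(1,3)])
  have dg: "cderiv L (\<lambda>y. ?g y $ I $ J) x = (- 1 / 4) * (A L I J + (isgn I * isgn J) * A L (irot I) (irot J))" for I J L
  proof -
    have "cderiv L (\<lambda>y. ?g y $ I $ J) x = cderiv L (\<lambda>x. (- 1 / 4) * (cderiv I (cderiv J \<phi>) x + (isgn I * isgn J) * cderiv (irot I) (cderiv (irot J) \<phi>) x)) x"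
      by (intro dir_deriv_cong[OF S(1,3)] kahler_gram_eq[OF S(1,2)])
    also have "\<dots> = (- 1 / 4) * (A L I J + (isgn I * isgn J) * A L (irot I) (irot J))"
      unfolding A_def using smooth_on_has_derivative[OF smooth_on_dir_deriv[OF smooth_on_dir_deriv[OF S(2)]] S(1,3)]
      by (intro dir_deriv_eqI has_derivative_add has_derivative_mult_right)
    finally show ?thesis .
  qed
  have contr: "(\<Sum>I\<in>UNIV. \<Sum>J\<in>UNIV. h I J * christoffel ?g K I J x) = 0" for K
  proof -
    \<comment> \<open>The 8 combines the 1/2 of the Christoffel symbol with the 1/4 of
      \<open>kahler_gram_eq\<close>.\<close>
    have "(\<Sum>I\<in>UNIV. \<Sum>J\<in>UNIV. h I J * christoffel ?g K I J x)
      = (\<Sum>I\<in>UNIV. \<Sum>J\<in>UNIV. \<Sum>L\<in>UNIV. - (h K L / 8) * (h I J *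
      ((A I J L + isgn J * isgn L * A I (irot J) (irot L)) + (A J I L + isgn I * isgn L * A J (irot I) (irot L))
       - (A L I J + isgn I * isgn J * A L (irot I) (irot J)))))"
      unfolding christoffel_def dg h_def[symmetric]
      unfolding sum_divide_distrib sum_distrib_left
      by (intro sum.cong refl) (simp add: field_simps)
    also have "\<dots> = (\<Sum>L\<in>UNIV. \<Sum>I\<in>UNIV. \<Sum>J\<in>UNIV. - (h K L / 8) * (h I J *
      ((A I J L + isgn J * isgn L * A I (irot J) (irot L)) + (A J I L + isgn I * isgn L * A J (irot I) (irot L))
       - (A L I J + isgn I * isgn J * A L (irot I) (irot J)))))"
      by (subst sum.swap[of _ UNIV UNIV], subst (2) sum.swap) (rule refl)
    also have "\<dots> = 0"
      unfolding sum_distrib_left[symmetric] contracted_third_derivatives[where h = h and A = A, OF hs A1 A2] by simp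
    finally show ?thesis .
  qed
  have "(\<Sum>I\<in>UNIV. \<Sum>J\<in>UNIV. h I J * (\<Sum>K\<in>UNIV. christoffel ?g K I J x * cderiv K f x))
    = (\<Sum>K\<in>UNIV. (\<Sum>I\<in>UNIV. \<Sum>J\<in>UNIV. h I J * christoffel ?g K I J x) * cderiv K f x)"
    unfolding sum_distrib_left sum_distrib_right mult.assoc
    by (subst sum.swap, subst (2) sum.swap) (rule refl)
  then have "(\<Sum>I\<in>UNIV. \<Sum>J\<in>UNIV. h I J * (\<Sum>K\<in>UNIV. christoffel ?g K I J x * cderiv K f x)) = 0"
    by (simp add: contr)
  then show ?thesis
    unfolding laplacian_def h_def by (simp add: right_diff_distrib sum_subtractf)
qed

section \<open>Locality, dilations and iterates of the Laplacian\<close>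

lemma laplacian_cong:
  assumes "open S" "x \<in> S" "\<And>y. y \<in> S \<Longrightarrow> f y = f' y"
  shows "laplacian g f x = laplacian g f' x"
proof -
  have 1: "dir_deriv v f y = dir_deriv v f' y" if "y \<in> S" for v y
    by (rule dir_deriv_cong[OF assms(1) that assms(3)])
  have 2: "dir_deriv w (dir_deriv v f) x = dir_deriv w (dir_deriv v f') x" for v w
    by (rule dir_deriv_cong[OF assms(1,2) 1])
  show ?thesis unfolding laplacian_def 1[OF assms(2)] 2 ..
qed

text \<open>One chain-rule step for homogeneity. The additive constant \<beta> accommodates a
  logarithm, to which a dilation adds a constant; a single derivative removes it.\<close>

lemma dir_deriv_affine_compose:
  fixes f :: "'a::euclidean_space \<Rightarrow> real"
  assumes "open S" "x \<in> S" "bounded_linear \<delta>" "\<delta> x \<in> T" "open T" "smooth_on T f" "smooth_on S k"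
    and "\<And>y. y \<in> S \<Longrightarrow> f (\<delta> y) = \<alpha> * k y + \<beta>" and "\<delta> v = s *\<^sub>R v"
  shows "s * dir_deriv v f (\<delta> x) = \<alpha> * dir_deriv v k x"
proof -
  have f: "f differentiable (at (\<delta> x))"
    using assms smooth_on_differentiable by blast
  have "((\<lambda>y. f (\<delta> y)) has_derivative (\<lambda>v. dir_deriv (\<delta> v) f (\<delta> x))) (at x)"
    using diff_chain_at[OF bounded_linear_imp_has_derivative[OF assms(3)] has_derivative_dir_deriv[OF f]]
    by (simp add: o_def)
  then have "dir_deriv v (\<lambda>y. f (\<delta> y)) x = dir_deriv (\<delta> v) f (\<delta> x)"
    by (rule dir_deriv_eqI)
  also have "\<dots> = s * dir_deriv v f (\<delta> x)"
    using linear_scale[OF linear_dir_deriv[OF f]] assms(9) by simp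
  also have "dir_deriv v (\<lambda>y. f (\<delta> y)) x = dir_deriv v (\<lambda>y. \<alpha> * k y + \<beta>) x"
    by (rule dir_deriv_cong[OF assms(1,2,8)])
  also have "\<dots> = \<alpha> * dir_deriv v k x"
  proof (rule dir_deriv_eqI)
    have "((\<lambda>y. \<alpha> * k y + \<beta>) has_derivative (\<lambda>v. \<alpha> * dir_deriv v k x + 0)) (at x)"
      using assms by (intro has_derivative_add has_derivative_mult_right has_derivative_const smooth_on_has_derivative)
    then show "((\<lambda>y. \<alpha> * k y + \<beta>) has_derivative (\<lambda>v. \<alpha> * dir_deriv v k x)) (at x)" by simp
  qed
  finally show ?thesis by simp
qed

context
  fixes \<phi> :: "complex^'m::finite \<Rightarrow> real" and \<Omega> :: "(complex^'m) set"
  assumes op: "open \<Omega>" and sm: "smooth_on \<Omega> \<phi>"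
    and nd: "\<And>x. x \<in> \<Omega> \<Longrightarrow> det (kahler_gram \<phi> x) \<noteq> 0"
begin

lemma laplacian_eq:
  "x \<in> \<Omega> \<Longrightarrow> laplacian (kahler_gram \<phi>) f x
    = - (\<Sum>I\<in>UNIV. \<Sum>J\<in>UNIV. matrix_inv (kahler_gram \<phi> x) $ I $ J * cderiv I (cderiv J f) x)"
  by (rule laplacian_kahler_gram[OF op sm _ nd])

lemma smooth_on_laplacian:
  assumes "smooth_on \<Omega> f"
  shows "smooth_on \<Omega> (laplacian (kahler_gram \<phi>) f)"
proof (rule smooth_on_cong[OF op])
  show "smooth_on \<Omega> (\<lambda>x. - (\<Sum>I\<in>UNIV. \<Sum>J\<in>UNIV.
      matrix_inv (kahler_gram \<phi> x) $ I $ J * cderiv I (cderiv J f) x))"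
    using smooth_on_matrix_inv[OF op smooth_on_kahler_gram[OF op sm] nd] op assms
    by (intro smooth_on_minus smooth_on_sum smooth_on_mult smooth_on_dir_deriv)
qed (simp add: laplacian_eq)

lemma smooth_on_laplacian_iter:
  "smooth_on \<Omega> f \<Longrightarrow> smooth_on \<Omega> ((laplacian (kahler_gram \<phi>) ^^ n) f)"
  by (induction n) (auto intro: smooth_on_laplacian)

lemma laplacian_iter_cong:
  assumes "\<And>y. y \<in> \<Omega> \<Longrightarrow> f y = f' y" "x \<in> \<Omega>"
  shows "(laplacian (kahler_gram \<phi>) ^^ n) f x = (laplacian (kahler_gram \<phi>) ^^ n) f' x"
  using assms(2)
  by (induction n arbitrary: x) (auto intro: laplacian_cong[OF op] assms)

lemma laplacian_diff:
  assumes "smooth_on \<Omega> f" "smooth_on \<Omega> f'" "x \<in> \<Omega>"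
  shows "laplacian (kahler_gram \<phi>) (\<lambda>y. f y - f' y) x
    = laplacian (kahler_gram \<phi>) f x - laplacian (kahler_gram \<phi>) f' x"
proof -
  have 1: "dir_deriv v (\<lambda>y. f y - f' y) y = dir_deriv v f y - dir_deriv v f' y"
    if "smooth_on \<Omega> f" "smooth_on \<Omega> f'" "y \<in> \<Omega>" for v y f f'
    using that op by (intro dir_deriv_eqI has_derivative_diff smooth_on_has_derivative)
  have "dir_deriv w (dir_deriv v (\<lambda>y. f y - f' y)) x = dir_deriv w (dir_deriv v f) x - dir_deriv w (dir_deriv v f') x" for v w
  proof -
    have "dir_deriv w (dir_deriv v (\<lambda>y. f y - f' y)) x = dir_deriv w (\<lambda>y. dir_deriv v f y - dir_deriv v f' y) x"
      by (rule dir_deriv_cong[OF op assms(3) 1[OF assms(1,2)]])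
    also have "\<dots> = dir_deriv w (dir_deriv v f) x - dir_deriv w (dir_deriv v f') x"
      by (rule 1[OF smooth_on_dir_deriv[OF assms(1)] smooth_on_dir_deriv[OF assms(2)] assms(3)])
    finally show ?thesis .
  qed
  then show ?thesis
    by (simp add: laplacian_eq[OF assms(3)] right_diff_distrib sum_subtractf)
qed

lemma laplacian_iter_diff:
  assumes "smooth_on \<Omega> f" "smooth_on \<Omega> f'" "x \<in> \<Omega>"
  shows "(laplacian (kahler_gram \<phi>) ^^ n) (\<lambda>y. f y - f' y) x
    = (laplacian (kahler_gram \<phi>) ^^ n) f x - (laplacian (kahler_gram \<phi>) ^^ n) f' x"
  using assms(3)
proof (induction n arbitrary: x)
  case (Suc n)
  have "(laplacian (kahler_gram \<phi>) ^^ Suc n) (\<lambda>y. f y - f' y) x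
    = laplacian (kahler_gram \<phi>)
       (\<lambda>y. (laplacian (kahler_gram \<phi>) ^^ n) f y - (laplacian (kahler_gram \<phi>) ^^ n) f' y) x"
    using Suc by (auto intro: laplacian_cong[OF op])
  then show ?case
    by (simp add: laplacian_diff[OF smooth_on_laplacian_iter smooth_on_laplacian_iter, OF assms(1,2) Suc.prems])
qed simp

text \<open>Each Laplacian has order two and smooth coefficients, so it costs two orders of
  vanishing.\<close>

lemma laplacian_iter_vanish:
  assumes "smooth_on \<Omega> f" "x \<in> \<Omega>" "vanish (2 * n + m) f x"
  shows "vanish m ((laplacian (kahler_gram \<phi>) ^^ n) f) x"
  using assms(3)
proof (induction n arbitrary: m)
  case (Suc n)
  let ?f = "(laplacian (kahler_gram \<phi>) ^^ n) f"
  have sf: "smooth_on \<Omega> ?f" using smooth_on_laplacian_iter[OF assms(1)] .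
  have "vanish (m + 2) ?f x"
    using Suc.prems by (intro Suc.IH) (simp add: algebra_simps del: vanish.simps)
  then have v: "vanish m (cderiv I (cderiv J ?f)) x" for I J
    using vanish_dir_deriv[OF vanish_dir_deriv] by fastforce
  have "vanish m (laplacian (kahler_gram \<phi>) ?f) x"
  proof (rule vanish_cong[OF op assms(2)])
    have sm1: "smooth_on \<Omega> (\<lambda>x. matrix_inv (kahler_gram \<phi> x) $ I $ J)" for I J
      by (rule smooth_on_matrix_inv[OF op smooth_on_kahler_gram[OF op sm] nd])
    have sm2: "smooth_on \<Omega> (cderiv I (cderiv J ?f))" for I J
      by (intro smooth_on_dir_deriv sf)
    have "vanish (0 + m) (\<lambda>x. matrix_inv (kahler_gram \<phi> x) $ I $ J * cderiv I (cderiv J ?f) x) x" for I J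
      by (intro vanish_mult[OF op assms(2)] sm1 sm2 v) simp
    then show "vanish m (\<lambda>x. - (\<Sum>I\<in>UNIV. \<Sum>J\<in>UNIV. matrix_inv (kahler_gram \<phi> x) $ I $ J * cderiv I (cderiv J ?f) x)) x"
      by (intro vanish_minus[OF op assms(2)] vanish_sum[OF op assms(2)] smooth_on_sum smooth_on_mult op sm1 sm2) simp
  qed (simp add: laplacian_eq)
  then show ?case by simp
qed simp

text \<open>The hypothesis says that the complex Hessian of \<open>f\<close> is zero.\<close>

lemma laplacian_iter_pluriharmonic:
  assumes "\<And>I J y. y \<in> \<Omega> \<Longrightarrow>
      cderiv I (cderiv J f) y = - (isgn I * isgn J * cderiv (irot I) (cderiv (irot J) f) y)"
    and "x \<in> \<Omega>" "n \<noteq> 0"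
  shows "(laplacian (kahler_gram \<phi>) ^^ n) f x = 0"
proof -
  have z: "laplacian (kahler_gram \<phi>) f y = 0" if y: "y \<in> \<Omega>" for y
  proof -
    define h where "h I J = matrix_inv (kahler_gram \<phi> y) $ I $ J" for I J
    have h: "h I J = isgn I * isgn J * h (irot I) (irot J)" for I J
      unfolding h_def by (rule matrix_inv_irot[OF nd[OF y] kahler_gram_irot[OF op sm y]])
    let ?s = "\<Sum>I\<in>UNIV. \<Sum>J\<in>UNIV. h I J * cderiv I (cderiv J f) y"
    \<comment> \<open>Rotating the index pair preserves \<open>h\<close> and changes the sign of the
      Hessian of \<open>f\<close>; reindexing then makes the sum its own negative.\<close>
    have "?s = - (\<Sum>I\<in>UNIV. \<Sum>J\<in>UNIV. h (irot I) (irot J) * cderiv (irot I) (cderiv (irot J) f) y)"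
      by (subst h, subst assms(1)[OF y]) (simp add: sum_negf[symmetric] algebra_simps)
    also have "\<dots> = - ?s"
      by (simp add: sum_irot[of "\<lambda>J. h _ J * cderiv _ (cderiv J f) y"] sum_irot[of "\<lambda>I. \<Sum>J\<in>UNIV. h I J * cderiv I (cderiv J f) y"])
    finally have "?s = 0" by simp
    then show ?thesis by (simp add: laplacian_eq[OF y] h_def)
  qed
  have "(laplacian (kahler_gram \<phi>) ^^ Suc m) f y = 0" if "y \<in> \<Omega>" for m y
    using that
  proof (induction m arbitrary: y)
    case (Suc m)
    have "laplacian (kahler_gram \<phi>) ((laplacian (kahler_gram \<phi>) ^^ Suc m) f) y
      = laplacian (kahler_gram \<phi>) (\<lambda>y. 0) y"
      using Suc by (intro laplacian_cong[OF op])
    also have "\<dots> = 0"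
      by (simp add: laplacian_eq[OF Suc.prems])
    finally show ?case by simp
  qed (simp add: z)
  then show ?thesis using assms(2,3) not0_implies_Suc by blast
qed

text \<open>The second derivatives scale by \<alpha> / (s I * s J) and the inverse metric by s I * s
  J / c, so the weights of the frame vectors cancel.\<close>

lemma laplacian_scale:
  assumes \<delta>: "bounded_linear \<delta>" "\<And>y. y \<in> \<Omega> \<Longrightarrow> \<delta> y \<in> \<Omega>" "\<And>I. \<delta> (cframe I) = s I *\<^sub>R cframe I"
    and s: "\<And>I. s I \<noteq> 0" "\<And>I. s (irot I) = s I"
    and \<phi>: "\<And>y. y \<in> \<Omega> \<Longrightarrow> \<phi> (\<delta> y) = c * \<phi> y" "c \<noteq> 0"
    and f: "smooth_on \<Omega> f" "smooth_on \<Omega> k" "\<And>y. y \<in> \<Omega> \<Longrightarrow> f (\<delta> y) = \<alpha> * k y + \<beta>"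
    and x: "x \<in> \<Omega>"
  shows "laplacian (kahler_gram \<phi>) f (\<delta> x) = \<alpha> / c * laplacian (kahler_gram \<phi>) k x"
proof -
  have DD: "cderiv I (cderiv J f) (\<delta> x) = \<alpha> / (s I * s J) * cderiv I (cderiv J k) x"
    if "x \<in> \<Omega>" "smooth_on \<Omega> f" "smooth_on \<Omega> k" "\<And>y. y \<in> \<Omega> \<Longrightarrow> f (\<delta> y) = \<alpha> * k y + \<beta>"
    for x I J f k \<alpha> \<beta>
  proof -
    have "s J * cderiv J f (\<delta> y) = \<alpha> * cderiv J k y" if "y \<in> \<Omega>" for y
      using that dir_deriv_affine_compose[OF op that \<delta>(1) \<delta>(2)[OF that] op \<open>smooth_on \<Omega> f\<close> \<open>smooth_on \<Omega> k\<close> _ \<delta>(3)]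
        \<open>\<And>y. y \<in> \<Omega> \<Longrightarrow> f (\<delta> y) = \<alpha> * k y + \<beta>\<close> by blast
    then have "cderiv J f (\<delta> y) = \<alpha> / s J * cderiv J k y + 0" if "y \<in> \<Omega>" for y
      using that s by (simp add: field_simps)
    from dir_deriv_affine_compose[OF op that(1) \<delta>(1) \<delta>(2)[OF that(1)] op smooth_on_dir_deriv[OF that(2)]
        smooth_on_dir_deriv[OF that(3)] this \<delta>(3)]
    show ?thesis using s by (simp add: field_simps)
  qed
  \<comment> \<open>The potential is itself a case of \<open>DD\<close>, with \<alpha> = c and
    \<beta> = 0. Both terms of \<open>kahler_gram_eq\<close> scale alike because \<open>s\<close>
    takes the same value at an index and at its rotation.\<close>
  have G: "kahler_gram \<phi> (\<delta> x) $ I $ J = c / (s I * s J) * kahler_gram \<phi> x $ I $ J" for I J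
    using DD[OF x sm sm, of c 0] \<phi>(1) s(2)
    by (simp add: kahler_gram_eq[OF op sm x] kahler_gram_eq[OF op sm \<delta>(2)[OF x]] algebra_simps)
  define B where "B = (\<chi> I J. s I * s J / c * matrix_inv (kahler_gram \<phi> x) $ I $ J)"
  have "(kahler_gram \<phi> (\<delta> x) ** B) $ I $ K = (mat 1 :: real^('m \<times> bool)^('m \<times> bool)) $ I $ K" for I K
  proof -
    have "(kahler_gram \<phi> (\<delta> x) ** B) $ I $ K = (\<Sum>J\<in>UNIV. s K / s I * (kahler_gram \<phi> x $ I $ J * matrix_inv (kahler_gram \<phi> x) $ J $ K))"
      unfolding matrix_matrix_mult_def B_def G vec_lambda_beta
      using s \<phi>(2) by (intro sum.cong refl) (simp add: field_simps)
    also have "\<dots> = s K / s I * (kahler_gram \<phi> x ** matrix_inv (kahler_gram \<phi> x)) $ I $ K"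
      by (simp add: matrix_matrix_mult_def sum_distrib_left)
    finally show ?thesis
      using matrix_mult_inv(1)[OF nd[OF x]] s by (auto simp: mat_def)
  qed
  then have "kahler_gram \<phi> (\<delta> x) ** B = mat 1" by (simp add: vec_eq_iff)
  from matrix_inv_unique[OF this] have "matrix_inv (kahler_gram \<phi> (\<delta> x)) $ I $ J = B $ I $ J" for I J by simp
  then have "laplacian (kahler_gram \<phi>) f (\<delta> x) = - (\<Sum>I\<in>UNIV. \<Sum>J\<in>UNIV. \<alpha> / c * (matrix_inv (kahler_gram \<phi> x) $ I $ J * cderiv I (cderiv J k) x))"
    using s \<phi>(2) by (simp add: laplacian_eq[OF \<delta>(2)[OF x]] DD[OF x f] B_def mult.left_commute)
  then show ?thesis
    by (simp add: laplacian_eq[OF x] sum_distrib_left)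
qed

lemma laplacian_iter_scale:
  assumes \<delta>: "bounded_linear \<delta>" "\<And>y. y \<in> \<Omega> \<Longrightarrow> \<delta> y \<in> \<Omega>" "\<And>I. \<delta> (cframe I) = s I *\<^sub>R cframe I"
    and s: "\<And>I. s I \<noteq> 0" "\<And>I. s (irot I) = s I"
    and \<phi>: "\<And>y. y \<in> \<Omega> \<Longrightarrow> \<phi> (\<delta> y) = c * \<phi> y" "c \<noteq> 0"
    and f: "smooth_on \<Omega> f" "\<And>y. y \<in> \<Omega> \<Longrightarrow> f (\<delta> y) = f y + \<beta>"
    and x: "x \<in> \<Omega>" and n: "n \<noteq> 0"
  shows "(laplacian (kahler_gram \<phi>) ^^ n) f (\<delta> x) = (laplacian (kahler_gram \<phi>) ^^ n) f x / c ^ n"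
proof -
  let ?f = "\<lambda>n. (laplacian (kahler_gram \<phi>) ^^ n) f"
  \<comment> \<open>The constant \<beta> is present only before the first Laplacian, so the
    induction carries it for n = 0.\<close>
  have "?f n (\<delta> x) = (1 / c ^ n) * ?f n x + (if n = 0 then \<beta> else 0)"
    using x
  proof (induction n arbitrary: x)
    case (Suc n)
    have "?f (Suc n) (\<delta> x) = (1 / c ^ n) / c * ?f (Suc n) x"
      using laplacian_scale[OF \<delta> s \<phi> smooth_on_laplacian_iter[OF f(1)] smooth_on_laplacian_iter[OF f(1)] Suc.IH Suc.prems]
      by simp
    then show ?case by (simp add: mult.commute)
  qed (simp add: f)
  then show ?thesis using n by simp
qed

end

section \<open>Formal holomorphic extension of CR functions\<close>

text \<open>Holomorphy as complex linearity of the real derivative. The functions to which it is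
  applied are built from polynomials, so it is demanded on the whole space and no domain has to be
  carried along.\<close>

definition holo :: "(complex^'n::finite \<Rightarrow> complex) \<Rightarrow> bool" where
  "holo P \<longleftrightarrow> smooth_on UNIV P \<and> (\<forall>w x. dir_deriv (\<i> *s w) P x = \<i> * dir_deriv w P x)"

lemma holo_smooth: "holo P \<Longrightarrow> smooth_on UNIV P"
  by (simp add: holo_def)

lemma holo_has_derivative: "holo P \<Longrightarrow> (P has_derivative (\<lambda>v. dir_deriv v P x)) (at x)"
  by (rule smooth_on_has_derivative[OF holo_smooth]) auto

lemma holoI:
  assumes "smooth_on UNIV P" "\<And>x. (P has_derivative P' x) (at x)" "\<And>x w. P' x (\<i> *s w) = \<i> * P' x w"
  shows "holo P"
  using assms dir_deriv_eqI[OF assms(2)] by (simp add: holo_def)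

lemma holo_const: "holo (\<lambda>x. c)"
  by (rule holoI[where P' = "\<lambda>x v. 0"]) (auto intro: smooth_on_const)

lemma holo_add:
  assumes "holo P" "holo Q"
  shows "holo (\<lambda>x. P x + Q x)"
proof (rule holoI)
  note sm = assms[THEN holo_smooth] and der = assms[THEN holo_has_derivative]
  show "smooth_on UNIV (\<lambda>x. P x + Q x)" by (intro smooth_on_add sm open_UNIV)
  show "((\<lambda>x. P x + Q x) has_derivative (\<lambda>v. dir_deriv v P x + dir_deriv v Q x)) (at x)" for x
    by (intro has_derivative_add der)
qed (use assms in \<open>simp add: holo_def algebra_simps\<close>)

lemma holo_mult:
  assumes "holo P" "holo Q"
  shows "holo (\<lambda>x. P x * Q x)"
proof (rule holoI)
  note sm = assms[THEN holo_smooth] and der = assms[THEN holo_has_derivative]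
  show "smooth_on UNIV (\<lambda>x. P x * Q x)" by (intro smooth_on_mult sm open_UNIV)
  show "((\<lambda>x. P x * Q x) has_derivative (\<lambda>v. P x * dir_deriv v Q x + dir_deriv v P x * Q x)) (at x)" for x
    by (intro has_derivative_mult der)
qed (use assms in \<open>simp add: holo_def algebra_simps\<close>)

lemma holo_sum: "(\<And>i. i \<in> I \<Longrightarrow> holo (P i)) \<Longrightarrow> holo (\<lambda>x. \<Sum>i\<in>I. P i x)"
  by (induction I rule: infinite_finite_induct) (auto intro: holo_const holo_add)

lemma holo_prod: "(\<And>i. i \<in> I \<Longrightarrow> holo (P i)) \<Longrightarrow> holo (\<lambda>x. \<Prod>i\<in>I. P i x)"
  by (induction I rule: infinite_finite_induct) (auto intro: holo_const holo_mult)

lemma holo_power: "holo P \<Longrightarrow> holo (\<lambda>x. P x ^ k)"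
  by (induction k) (auto intro: holo_const holo_mult)

lemma holo_nth: "holo (\<lambda>x. x $ j)"
  by (rule holoI[where P' = "\<lambda>x v. v $ j"])
    (auto intro: smooth_on_linear bounded_linear_vec_nth bounded_linear_imp_has_derivative)

lemma holo_translate:
  assumes "holo P"
  shows "holo (\<lambda>x. P (x - b))"
proof (rule holoI)
  show "smooth_on UNIV (\<lambda>x. P (x - b))"
    by (rule smooth_on_compose[OF open_UNIV open_UNIV _ _ holo_smooth[OF assms]], simp)
      (intro smooth_on_diff smooth_on_ident smooth_on_const open_UNIV)
  have "((\<lambda>x. x - b) has_derivative (\<lambda>v. v)) (at x)" for x :: "complex^'a"
    by (auto intro!: derivative_eq_intros)
  from diff_chain_at[OF this holo_has_derivative[OF assms]]
  show "((\<lambda>x. P (x - b)) has_derivative (\<lambda>v. dir_deriv v P (x - b))) (at x)" for x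
    by (simp add: o_def)
  show "dir_deriv (\<i> *s w) P (x - b) = \<i> * dir_deriv w P (x - b)" for x w
    using assms by (simp add: holo_def)
qed

lemma complex_vec_expansion:
  fixes w :: "complex^'n::finite"
  shows "w = (\<Sum>j\<in>UNIV. Re (w $ j) *\<^sub>R axis j 1 + Im (w $ j) *\<^sub>R (\<i> *s axis j 1))"
proof -
  have "(\<Sum>j\<in>UNIV. (Re (w $ j) *\<^sub>R axis j 1 + Im (w $ j) *\<^sub>R (\<i> *s axis j 1)) $ i) = w $ i" for i
  proof -
    have "(\<Sum>j\<in>UNIV. (Re (w $ j) *\<^sub>R axis j 1 + Im (w $ j) *\<^sub>R (\<i> *s axis j 1)) $ i)
      = (\<Sum>j\<in>UNIV. if j = i then w $ i else 0)"
      by (intro sum.cong refl) (auto simp: axis_def complex_eq_iff)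
    then show ?thesis by simp
  qed
  then show ?thesis by (simp add: vec_eq_iff)
qed

lemma holo_dir_deriv_expansion:
  assumes "holo P"
  shows "dir_deriv w P x = (\<Sum>j\<in>UNIV. w $ j * dir_deriv (axis j 1) P x)"
proof -
  interpret linear "\<lambda>w. dir_deriv w P x"
    using has_derivative_linear[OF holo_has_derivative[OF assms]] .
  have "dir_deriv w P x = (\<Sum>j\<in>UNIV. Re (w $ j) *\<^sub>R dir_deriv (axis j 1) P x + Im (w $ j) *\<^sub>R (\<i> * dir_deriv (axis j 1) P x))"
    using assms by (subst complex_vec_expansion[of w]) (simp add: sum add scale holo_def)
  also have "\<dots> = (\<Sum>j\<in>UNIV. w $ j * dir_deriv (axis j 1) P x)"
    by (intro sum.cong refl) (simp add: complex_eq_iff algebra_simps)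
  finally show ?thesis .
qed

section \<open>Derivatives along complex tangent vectors\<close>

lemma cvec_deriv_add: "cvec_deriv (v + w) f x = cvec_deriv v f x + cvec_deriv w f x"
  by (simp add: cvec_deriv_def algebra_simps sum.distrib)

lemma cvec_deriv_scale: "cvec_deriv (c *s v) f x = c * cvec_deriv v f x"
  by (simp add: cvec_deriv_def sum_distrib_left mult.assoc)

lemma cvec_deriv_0: "cvec_deriv 0 f x = 0"
  by (simp add: cvec_deriv_def)

lemma smooth_on_cvec_deriv:
  assumes "open S" "smooth_on S f" "smooth_on S Y"
  shows "smooth_on S (\<lambda>x. cvec_deriv (Y x) f x)"
  unfolding cvec_deriv_def
  by (intro smooth_on_sum smooth_on_mult smooth_on_dir_deriv smooth_on_nth assms)

lemma smooth_on_cvec_deriv_const: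
  assumes "open S" "smooth_on S f"
  shows "smooth_on S (cvec_deriv v f)"
  using smooth_on_cvec_deriv[OF assms smooth_on_const[OF assms(1)]] by simp

lemma cvec_deriv_cong:
  assumes "open S" "x \<in> S" "\<And>y. y \<in> S \<Longrightarrow> f y = g y"
  shows "cvec_deriv v f x = cvec_deriv v g x"
proof -
  have "dir_deriv e f x = dir_deriv e g x" for e by (rule dir_deriv_cong[OF assms])
  then show ?thesis by (simp add: cvec_deriv_def)
qed

lemma cvec_deriv_linear_combination:
  assumes "open S" "smooth_on S f" "smooth_on S g" "x \<in> S"
  shows "cvec_deriv v (\<lambda>y. f y - c * g y) x = cvec_deriv v f x - c * cvec_deriv v g x"
proof -
  have *: "dir_deriv w (\<lambda>y. f y - c * g y) x = dir_deriv w f x - c * dir_deriv w g x" for w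
    using assms by (intro dir_deriv_eqI has_derivative_diff has_derivative_mult_right smooth_on_has_derivative)
  show ?thesis
    unfolding cvec_deriv_def * by (simp add: algebra_simps sum_subtractf sum_distrib_left)
qed

lemma dir_deriv_cvec:
  fixes f :: "real^'d::finite \<Rightarrow> complex"
  assumes "f differentiable (at x)"
  shows "dir_deriv v f x = cvec_deriv (\<chi> k. complex_of_real (v $ k)) f x"
proof -
  interpret linear "\<lambda>w. dir_deriv w f x" using linear_dir_deriv[OF assms] .
  have "dir_deriv v f x = dir_deriv (\<Sum>k\<in>UNIV. (v $ k) *\<^sub>R axis k 1) f x"
    using basis_expansion[of v] by (simp add: scalar_mult_eq_scaleR)
  then show ?thesis
    by (simp only: sum scale cvec_deriv_def vec_lambda_beta) (simp add: scaleR_conv_of_real)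
qed

lemma cvec_deriv_commute:
  assumes "open S" "smooth_on S f" "x \<in> S"
  shows "cvec_deriv v (cvec_deriv w f) x = cvec_deriv w (cvec_deriv v f) x"
proof -
  have *: "dir_deriv e (cvec_deriv w f) x = cvec_deriv w (dir_deriv e f) x" for e w
  proof -
    have "dir_deriv e (cvec_deriv w f) x = (\<Sum>k\<in>UNIV. w $ k * dir_deriv e (dir_deriv (axis k 1) f) x)"
      unfolding cvec_deriv_def[abs_def] using assms
      by (intro dir_deriv_eqI has_derivative_sum has_derivative_mult_right smooth_on_has_derivative smooth_on_dir_deriv)
    then show ?thesis
      using dir_deriv_commute[OF assms] by (simp add: cvec_deriv_def)
  qed
  have "cvec_deriv v (cvec_deriv w f) x = (\<Sum>k\<in>UNIV. \<Sum>l\<in>UNIV. v $ k * (w $ l * dir_deriv (axis l 1) (dir_deriv (axis k 1) f) x))"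
    unfolding cvec_deriv_def[of v] * by (simp add: cvec_deriv_def sum_distrib_left)
  moreover have "cvec_deriv w (cvec_deriv v f) x = (\<Sum>k\<in>UNIV. \<Sum>l\<in>UNIV. w $ k * (v $ l * dir_deriv (axis l 1) (dir_deriv (axis k 1) f) x))"
    unfolding cvec_deriv_def[of w] * by (simp add: cvec_deriv_def sum_distrib_left)
  moreover have "(\<Sum>k\<in>UNIV. \<Sum>l\<in>UNIV. v $ k * (w $ l * dir_deriv (axis l 1) (dir_deriv (axis k 1) f) x))
      = (\<Sum>k\<in>UNIV. \<Sum>l\<in>UNIV. w $ k * (v $ l * dir_deriv (axis l 1) (dir_deriv (axis k 1) f) x))"
    by (subst sum.swap, intro sum.cong refl, subst dir_deriv_commute[OF assms]) simp
  ultimately show ?thesis by simp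
qed

text \<open>Since \<open>P\<close> is holomorphic, the components of \<open>F\<close> enter but
  their conjugates do not. Hence a vector field that annihilates the components of \<open>F\<close>
  to some order does the same to \<open>P o F\<close>.\<close>

lemma cvec_deriv_holo_compose:
  fixes F :: "real^'d::finite \<Rightarrow> complex^'n::finite"
  assumes "F differentiable (at x)" "holo P"
  shows "cvec_deriv v (\<lambda>y. P (F y)) x
    = (\<Sum>j\<in>UNIV. cvec_deriv v (\<lambda>y. F y $ j) x * dir_deriv (axis j 1) P (F x))"
proof -
  have P: "P differentiable (at (F x))"
    using holo_has_derivative[OF assms(2)] by (auto simp: differentiable_def)
  have "dir_deriv e (\<lambda>y. P (F y)) x
      = (\<Sum>j\<in>UNIV. dir_deriv e (\<lambda>y. F y $ j) x * dir_deriv (axis j 1) P (F x))" for e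
    unfolding dir_deriv_compose[OF assms(1) P] holo_dir_deriv_expansion[OF assms(2), of "dir_deriv e F x"]
    by (simp add: dir_deriv_linear_compose[OF bounded_linear_vec_nth assms(1)])
  then have "cvec_deriv v (\<lambda>y. P (F y)) x = (\<Sum>k\<in>UNIV. \<Sum>j\<in>UNIV. v $ k *
      (dir_deriv (axis k 1) (\<lambda>y. F y $ j) x * dir_deriv (axis j 1) P (F x)))"
    by (simp add: cvec_deriv_def sum_distrib_left)
  also have "\<dots> = (\<Sum>j\<in>UNIV. cvec_deriv v (\<lambda>y. F y $ j) x * dir_deriv (axis j 1) P (F x))"
    unfolding cvec_deriv_def sum_distrib_right mult.assoc by (rule sum.swap)
  finally show ?thesis .
qed

lemma vanish_cvec_deriv:
  assumes "open S" "a \<in> S" "smooth_on S f" "vanish m f a"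
  shows "vanish (m - 1) (cvec_deriv v f) a"
proof -
  have "vanish (0 + (m - 1)) (\<lambda>x. v $ k * dir_deriv (axis k 1) f x) a" for k
    by (intro vanish_mult[OF assms(1,2)] smooth_on_const smooth_on_dir_deriv vanish_dir_deriv assms) simp
  then show ?thesis
    unfolding cvec_deriv_def[abs_def]
    by (intro vanish_sum[OF assms(1,2)] smooth_on_mult smooth_on_const smooth_on_dir_deriv assms) simp
qed

text \<open>Replacing the field \<open>Y\<close> by its value at \<open>a\<close> changes the
  derivative by products of \<open>Y - Y a\<close>, of order one, with first derivatives of
  \<open>g\<close>, of order \<open>m - 1\<close>. Constant vectors have the advantage that their
  derivatives commute.\<close>

lemma vanish_cvec_deriv_freeze:
  assumes "open S" "a \<in> S" "smooth_on S g" "smooth_on S Y" "vanish m g a"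
    and "vanish m (\<lambda>x. cvec_deriv (Y x) g x) a"
  shows "vanish m (cvec_deriv (Y a) g) a"
proof (cases m)
  case (Suc n)
  have sm: "smooth_on S (\<lambda>x. Y x $ k - Y a $ k)" for k
    by (intro smooth_on_diff smooth_on_nth smooth_on_const assms)
  have "vanish (1 + n) (\<lambda>x. (Y x $ k - Y a $ k) * dir_deriv (axis k 1) g x) a" for k
    using assms(5) unfolding Suc
    by (intro vanish_mult[OF assms(1,2)] sm smooth_on_dir_deriv assms) auto
  then have "vanish m (\<lambda>x. \<Sum>k\<in>UNIV. (Y x $ k - Y a $ k) * dir_deriv (axis k 1) g x) a"
    unfolding Suc
    by (intro vanish_sum[OF assms(1,2)] smooth_on_mult smooth_on_dir_deriv sm assms) (simp del: vanish.simps)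
  then have "vanish m (\<lambda>x. cvec_deriv (Y x) g x - (\<Sum>k\<in>UNIV. (Y x $ k - Y a $ k) * dir_deriv (axis k 1) g x)) a"
    by (intro vanish_diff[OF assms(1,2)] smooth_on_cvec_deriv smooth_on_sum smooth_on_mult smooth_on_dir_deriv sm assms)
  moreover have "cvec_deriv (Y x) g x - (\<Sum>k\<in>UNIV. (Y x $ k - Y a $ k) * dir_deriv (axis k 1) g x) = cvec_deriv (Y a) g x" for x
    by (simp add: cvec_deriv_def algebra_simps sum_subtractf)
  ultimately show ?thesis by (simp only:)
qed simp

subsection \<open>Divided monomials\<close>

text \<open>The monomial w^\<alpha> / \<alpha>!, with the multi-index as a multiset of coordinates.
  With this normalization a derivative removes one element without a numerical factor.\<close>

definition mmono :: "'n::finite multiset \<Rightarrow> complex^'n \<Rightarrow> complex" where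
  "mmono \<alpha> w = (\<Prod>j\<in>UNIV. (w $ j) ^ count \<alpha> j / fact (count \<alpha> j))"

lemma holo_mmono: "holo (mmono \<alpha>)"
proof -
  have "holo (\<lambda>w::complex^'n. \<Prod>j\<in>UNIV. (w $ j) ^ count \<alpha> j * (1 / fact (count \<alpha> j)))" for \<alpha>
    by (intro holo_prod holo_mult holo_power holo_nth holo_const)
  then show ?thesis by (simp add: mmono_def[abs_def])
qed

lemma dir_deriv_mmono:
  "dir_deriv (axis k 1) (mmono \<alpha>) w = (if k \<in># \<alpha> then mmono (\<alpha> - {#k#}) w else 0)"
proof -
  define c where "c = count \<alpha> k"
  define R where "R w = (\<Prod>j\<in>UNIV - {k}. (w $ j) ^ count \<alpha> j / fact (count \<alpha> j))" for w :: "complex^'a"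
  have fact: "mmono \<alpha> = (\<lambda>w. (w $ k) ^ c / fact c * R w)"
    unfolding mmono_def R_def c_def by (rule ext) (simp add: prod.remove[of UNIV k])
  have Rh: "holo R"
  proof -
    have "holo (\<lambda>w::complex^'a. \<Prod>j\<in>UNIV - {k}. (w $ j) ^ count \<alpha> j * (1 / fact (count \<alpha> j)))"
      by (intro holo_prod holo_mult holo_power holo_nth holo_const)
    then show ?thesis by (simp add: R_def[abs_def])
  qed
  \<comment> \<open>\<open>R\<close> lacks the factor with index \<open>k\<close> and is therefore
    constant along the line through \<open>w\<close> in that coordinate direction.\<close>
  have R0: "dir_deriv (axis k 1) R w = 0"
  proof -
    have "((\<lambda>s::real. w + s *\<^sub>R axis k 1) has_derivative (\<lambda>h. h *\<^sub>R axis k 1)) (at 0)"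
      by (auto intro!: derivative_eq_intros)
    moreover have "(R has_derivative (\<lambda>v. dir_deriv v R w)) (at (w + 0 *\<^sub>R axis k 1))"
      using holo_has_derivative[OF Rh] by simp
    ultimately have "((\<lambda>s. R (w + s *\<^sub>R axis k 1)) has_derivative (\<lambda>h. dir_deriv (h *\<^sub>R axis k 1) R w)) (at 0)"
      using diff_chain_at by (fastforce simp: o_def)
    moreover have "R (w + s *\<^sub>R axis k 1) = R w" for s
      unfolding R_def by (intro prod.cong refl) (simp add: axis_def)
    ultimately have "((\<lambda>s::real. R w) has_derivative (\<lambda>h. dir_deriv (h *\<^sub>R axis k 1) R w)) (at 0)"
      by simp
    then have "(\<lambda>h. dir_deriv (h *\<^sub>R axis k 1) R w) = (\<lambda>h::real. 0)"
      using has_derivative_unique has_derivative_const by blast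
    then have "dir_deriv (1 *\<^sub>R axis k 1) R w = 0" by (rule fun_cong)
    then show ?thesis by simp
  qed
  have "((\<lambda>w. (w $ k) ^ c / fact c) has_derivative (\<lambda>v. of_nat c * (w $ k) ^ (c - 1) * (v $ k) / fact c)) (at w)"
    by (auto intro!: derivative_eq_intros bounded_linear_imp_has_derivative bounded_linear_vec_nth simp: algebra_simps)
  from dir_deriv_eqI[OF has_derivative_mult[OF this holo_has_derivative[OF Rh]]]
  have "dir_deriv (axis k 1) (mmono \<alpha>) w = of_nat c * (w $ k) ^ (c - 1) / fact c * R w"
    unfolding fact by (simp add: R0)
  also have "\<dots> = (if k \<in># \<alpha> then mmono (\<alpha> - {#k#}) w else 0)"
  proof (cases "k \<in># \<alpha>")
    case True
    then obtain c' where c': "c = Suc c'" by (metis c_def count_greater_zero_iff gr0_implies_Suc)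
    have "mmono (\<alpha> - {#k#}) w = (w $ k) ^ c' / fact c' * R w"
      unfolding mmono_def R_def using c' by (subst prod.remove[of UNIV k]) (auto simp: c_def intro!: prod.cong)
    then show ?thesis using True by (simp add: c' divide_simps del: of_nat_Suc)
  next
    case False
    then have "c = 0" by (simp add: c_def not_in_iff)
    then show ?thesis using False by simp
  qed
  finally show ?thesis .
qed

lemma vanish_mmono: "size \<alpha> = m \<Longrightarrow> vanish m (mmono \<alpha>) 0"
proof (induction m arbitrary: \<alpha>)
  case (Suc m)
  then obtain k where "k \<in># \<alpha>" by (metis multiset_nonemptyE size_empty nat.distinct(1))
  then have "mmono \<alpha> 0 = 0"
    unfolding mmono_def by (intro prod_zero) (auto intro!: bexI[of _ k] simp: zero_power)
  moreover have "vanish m (dir_deriv v (mmono \<alpha>)) 0" for v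
  proof -
    have "vanish (0 + m) (\<lambda>x. v $ j * dir_deriv (axis j 1) (mmono \<alpha>) x) 0" for j
    proof (intro vanish_mult[of UNIV] smooth_on_const smooth_on_dir_deriv holo_smooth[OF holo_mmono])
      show "vanish m (dir_deriv (axis j 1) (mmono \<alpha>)) 0"
      proof (cases "j \<in># \<alpha>")
        case True
        then have "dir_deriv (axis j 1) (mmono \<alpha>) = mmono (\<alpha> - {#j#})"
          by (simp add: fun_eq_iff dir_deriv_mmono)
        then show ?thesis using True Suc by (auto simp: size_Diff_singleton intro!: Suc.IH)
      next
        case False
        then have "dir_deriv (axis j 1) (mmono \<alpha>) = (\<lambda>x. 0)"
          by (simp add: fun_eq_iff dir_deriv_mmono)
        then show ?thesis by (simp add: vanish_const0)
      qed
    qed auto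
    then have "vanish m (\<lambda>x. \<Sum>j\<in>UNIV. v $ j * dir_deriv (axis j 1) (mmono \<alpha>) x) 0"
      by (intro vanish_sum[of UNIV] smooth_on_mult smooth_on_const smooth_on_dir_deriv holo_smooth[OF holo_mmono]) auto
    then show ?thesis by (simp add: holo_dir_deriv_expansion[OF holo_mmono, symmetric, abs_def])
  qed
  ultimately show ?case by simp
qed simp

subsection \<open>Iterated derivatives along complex vectors\<close>

text \<open>Lists allow recursion on the derivatives; for constant vectors only the underlying
  multiset matters, see \<open>cderivs_mset_cong\<close>.\<close>

definition cderivs :: "('k \<Rightarrow> complex^'d) \<Rightarrow> 'k list \<Rightarrow> (real^'d::finite \<Rightarrow> complex) \<Rightarrow> real^'d \<Rightarrow> complex" where
  "cderivs X ks g = foldr (\<lambda>k. cvec_deriv (X k)) ks g"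

lemma cderivs_simps [simp]:
  "cderivs X [] g = g" "cderivs X (k # ks) g = cvec_deriv (X k) (cderivs X ks g)"
  "cderivs X (ks @ [k]) g = cderivs X ks (cvec_deriv (X k) g)"
  by (simp_all add: cderivs_def)

context
  fixes V :: "(real^'d::finite) set" and a :: "real^'d" and X :: "'k \<Rightarrow> complex^'d"
  assumes V: "open V" "a \<in> V"
begin

lemma smooth_on_cderivs: "smooth_on V g \<Longrightarrow> smooth_on V (cderivs X ks g)"
  by (induction ks) (auto intro: smooth_on_cvec_deriv_const[OF V(1)])

lemma cderivs_cong: "(\<And>y. y \<in> V \<Longrightarrow> g y = g' y) \<Longrightarrow> x \<in> V \<Longrightarrow> cderivs X ks g x = cderivs X ks g' x"
  by (induction ks arbitrary: x) (auto intro!: cvec_deriv_cong[OF V(1)])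

lemma cderivs_diff_scaled:
  assumes "smooth_on V g" "smooth_on V g'" "x \<in> V"
  shows "cderivs X ks (\<lambda>y. g y - c * g' y) x = cderivs X ks g x - c * cderivs X ks g' x"
  using assms(3)
proof (induction ks arbitrary: x)
  case (Cons k ks)
  have "cderivs X (k # ks) (\<lambda>y. g y - c * g' y) x
    = cvec_deriv (X k) (\<lambda>y. cderivs X ks g y - c * cderivs X ks g' y) x"
    using Cons by (auto intro!: cvec_deriv_cong[OF V(1)])
  also have "\<dots> = cderivs X (k # ks) g x - c * cderivs X (k # ks) g' x"
    using assms Cons.prems by (simp add: cvec_deriv_linear_combination[OF V(1)] smooth_on_cderivs)
  finally show ?case .
qed simp

lemma cderivs_remove1:
  assumes "smooth_on V g" "k \<in> set ks" "x \<in> V"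
  shows "cderivs X ks g x = cvec_deriv (X k) (cderivs X (remove1 k ks) g) x"
  using assms(2,3)
proof (induction ks arbitrary: x)
  case (Cons l ks)
  show ?case
  proof (cases "k = l")
    case False
    have "cderivs X (l # ks) g x = cvec_deriv (X l) (cvec_deriv (X k) (cderivs X (remove1 k ks) g)) x"
      using Cons False by (auto intro!: cvec_deriv_cong[OF V(1)])
    also have "\<dots> = cvec_deriv (X k) (cvec_deriv (X l) (cderivs X (remove1 k ks) g)) x"
      by (intro cvec_deriv_commute[OF V(1)] smooth_on_cderivs assms Cons.prems)
    finally show ?thesis using False by simp
  qed simp
qed simp

lemma cderivs_mset_cong:
  assumes "smooth_on V g" "mset ks = mset ls" "x \<in> V"
  shows "cderivs X ks g x = cderivs X ls g x"
  using assms(2,3)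
proof (induction ks arbitrary: ls x)
  case (Cons k ks)
  then have k: "k \<in> set ls" "mset ks = mset (remove1 k ls)"
    by (metis list.set_intros(1) set_mset_mset, metis mset_remove1 mset.simps(2) add_mset_remove_trivial)
  have "cderivs X (k # ks) g x = cvec_deriv (X k) (cderivs X (remove1 k ls) g) x"
    using Cons.IH[OF k(2)] Cons.prems(2) by (auto intro!: cvec_deriv_cong[OF V(1)])
  then show ?case
    using cderivs_remove1[OF assms(1) k(1) Cons.prems(2)] by simp
qed simp

lemma cderivs_vanish:
  assumes "smooth_on V g" "vanish m g a" "length ks < m"
  shows "cderivs X ks g a = 0"
proof -
  have "vanish (m - length ks) (cderivs X ks g) a"
  proof (induction ks)
    case (Cons k ks)
    then show ?case
      using vanish_cvec_deriv[OF V smooth_on_cderivs[OF assms(1)] Cons, of "X k"] by simp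
  qed (use assms in simp)
  moreover obtain n where "m - length ks = Suc n" using assms(3) by (metis Suc_diff_Suc)
  ultimately show ?thesis by simp
qed

text \<open>The degree \<open>m\<close> part of the Taylor expansion of \<open>g\<close> is a
  symmetric form that is zero as soon as one argument lies in \<open>K\<close>, so it only remains
  to test it on the vectors \<open>X k\<close>. The induction differentiates once and commutes the
  derivatives to keep the hypothesis on \<open>K\<close>.\<close>

lemma vanish_Suc_spanning:
  assumes span: "vec.span (range X \<union> K) = UNIV"
    and "smooth_on V g" "vanish m g a" "\<And>\<zeta>. \<zeta> \<in> K \<Longrightarrow> vanish m (cvec_deriv \<zeta> g) a"
    and "\<And>ks. length ks = m \<Longrightarrow> cderivs X ks g a = 0"
  shows "vanish (Suc m) g a"
  using assms(2-)
proof (induction m arbitrary: g)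
  case 0
  from 0(4)[of "[]"] show ?case by simp
next
  case (Suc m)
  note sm = Suc.prems(1)
  have smc: "smooth_on V (cvec_deriv \<zeta> g)" for \<zeta>
    by (rule smooth_on_cvec_deriv_const[OF V(1) sm])
  have X: "vanish (Suc m) (cvec_deriv (X k) g) a" for k
  proof (rule Suc.IH[OF smc])
    show "vanish m (cvec_deriv (X k) g) a"
      using vanish_cvec_deriv[OF V sm Suc.prems(2)] by simp
    show "vanish m (cvec_deriv \<zeta> (cvec_deriv (X k) g)) a" if "\<zeta> \<in> K" for \<zeta>
    proof (rule vanish_cong[OF V])
      show "vanish m (cvec_deriv (X k) (cvec_deriv \<zeta> g)) a"
        using vanish_cvec_deriv[OF V smc Suc.prems(3)[OF that]] by simp
    qed (rule cvec_deriv_commute[OF V(1) sm])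
    show "cderivs X ks (cvec_deriv (X k) g) a = 0" if "length ks = m" for ks
      using Suc.prems(4)[of "ks @ [k]"] that by simp
  qed
  \<comment> \<open>The directions along which the derivative vanishes to the required order form a
    complex subspace; it contains a spanning set.\<close>
  have "vec.subspace {\<zeta>. vanish (Suc m) (cvec_deriv \<zeta> g) a}"
    unfolding vec.subspace_def
  proof (intro conjI ballI allI; simp only: mem_Collect_eq)
    show "vanish (Suc m) (cvec_deriv 0 g) a"
      using vanish_const0 by (simp only: cvec_deriv_0[abs_def])
    show "vanish (Suc m) (cvec_deriv (\<zeta> + \<xi>) g) a"
      if "vanish (Suc m) (cvec_deriv \<zeta> g) a" "vanish (Suc m) (cvec_deriv \<xi> g) a" for \<zeta> \<xi>
      using vanish_add[OF V smc smc that] by (simp only: cvec_deriv_add[abs_def])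
    show "vanish (Suc m) (cvec_deriv (c *s \<zeta>) g) a" if "vanish (Suc m) (cvec_deriv \<zeta> g) a" for c \<zeta>
      using vanish_linear_compose[OF V bounded_linear_mult_right smc that, of c]
      by (simp only: cvec_deriv_scale[abs_def])
  qed
  then have "vec.span (range X \<union> K) \<subseteq> {\<zeta>. vanish (Suc m) (cvec_deriv \<zeta> g) a}"
    using X Suc.prems(3) by (intro vec.span_minimal) auto
  then have all: "vanish (Suc m) (cvec_deriv \<zeta> g) a" for \<zeta>
    using span by auto
  have "vanish (Suc m) (dir_deriv v g) a" for v
    by (rule vanish_cong[OF V _ all[of "\<chi> k. complex_of_real (v $ k)"]])
      (rule dir_deriv_cvec[symmetric, OF smooth_on_differentiable[OF sm V(1)]])
  moreover have "g a = 0" using Suc.prems(2) by simp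
  ultimately show ?case by simp
qed

end

text \<open>In degree \<open>size \<alpha>\<close> only the differential of \<open>F\<close> at
  \<open>a\<close> is visible, and the \<open>X k\<close> are dual to it. The derivatives of divided
  monomials therefore form an identity matrix, from which coefficients can be read off.\<close>

lemma cderivs_mmono:
  fixes F :: "real^'d::finite \<Rightarrow> complex^'n::finite" and X :: "'n \<Rightarrow> complex^'d"
  assumes V: "open V" "a \<in> V" and F: "smooth_on V F"
    and dual: "\<And>k j. cvec_deriv (X k) (\<lambda>y. F y $ j) a = (if j = k then 1 else 0)"
    and "length ks = size \<alpha>"
  shows "cderivs X ks (\<lambda>x. mmono \<alpha> (F x - F a)) a = (if mset ks = \<alpha> then 1 else 0)"
  using assms(5)
proof (induction ks arbitrary: \<alpha> rule: rev_induct)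
  case Nil
  then show ?case by (simp add: mmono_def)
next
  case (snoc k ks)
  have smF: "smooth_on V (\<lambda>x. F x - F a)"
    by (intro smooth_on_diff smooth_on_const V F)
  have smP: "smooth_on V (\<lambda>x. P (F x - F a))" if "smooth_on UNIV P" for P :: "complex^'n \<Rightarrow> complex"
    by (rule smooth_on_compose[OF V(1) open_UNIV _ smF that]) simp
  have smj: "smooth_on V (\<lambda>y. F y $ j)" for j by (rule smooth_on_nth[OF V(1) F])
  define c where "c j x = cvec_deriv (X k) (\<lambda>y. F y $ j) x - (if j = k then 1 else 0)" for j x
  have smc: "smooth_on V (c j)" for j
    unfolding c_def by (intro smooth_on_diff smooth_on_cvec_deriv_const smj smooth_on_const V)
  define Q where "Q j x = dir_deriv (axis j 1) (mmono \<alpha>) (F x - F a)" for j x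
  have smQ: "smooth_on V (Q j)" for j
    unfolding Q_def by (intro smP smooth_on_dir_deriv holo_smooth holo_mmono)
  define E where "E x = (\<Sum>j\<in>UNIV. c j x * Q j x)" for x
  have smE: "smooth_on V E"
    unfolding E_def by (intro smooth_on_sum smooth_on_mult smc smQ V)
  have size: "size \<alpha> = Suc (length ks)" using snoc.prems by simp
  \<comment> \<open>The deviation \<open>c j\<close> from duality is zero at \<open>a\<close>. Its
    products thus have order one more than the number of derivatives still to be taken, and these do
    not see them.\<close>
  have "vanish (1 + length ks) (\<lambda>x. c j x * Q j x) a" for j
  proof (rule vanish_mult[OF V smc smQ])
    show "vanish 1 (c j) a" by (simp add: c_def dual)
    have "vanish (Suc (length ks) - 1) (dir_deriv (axis j 1) (mmono \<alpha>)) (F a - F a)"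
      using vanish_dir_deriv[OF vanish_mmono[OF size]] by simp
    then show "vanish (length ks) (Q j) a"
      unfolding Q_def using holo_smooth[OF holo_mmono]
      by (intro vanish_compose[OF V open_UNIV _ smF] smooth_on_dir_deriv) auto
  qed
  then have vE: "vanish (Suc (length ks)) E a"
    unfolding E_def by (intro vanish_sum[OF V] smooth_on_mult smc smQ V) (simp del: vanish.simps)
  have "cvec_deriv (X k) (\<lambda>x. mmono \<alpha> (F x - F a)) x = Q k x - (- 1) * E x" if x: "x \<in> V" for x
  proof -
    have "dir_deriv v (\<lambda>y. (F y - F a) $ j) x = dir_deriv v (\<lambda>y. F y $ j) x" for v j
      using smooth_on_has_derivative[OF smj V(1) x]
      by (intro dir_deriv_eqI) (auto intro!: derivative_eq_intros)
    then have "cvec_deriv (X k) (\<lambda>y. (F y - F a) $ j) x = cvec_deriv (X k) (\<lambda>y. F y $ j) x" for j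
      by (simp only: cvec_deriv_def)
    then have "cvec_deriv (X k) (\<lambda>x. mmono \<alpha> (F x - F a)) x
      = (\<Sum>j\<in>UNIV. (c j x + (if j = k then 1 else 0)) * Q j x)"
      using cvec_deriv_holo_compose[OF smooth_on_differentiable[OF smF V(1) x] holo_mmono, of "X k" \<alpha>]
      by (simp add: c_def Q_def)
    also have "\<dots> = E x + (\<Sum>j\<in>UNIV. if j = k then Q j x else 0)"
      unfolding E_def sum.distrib[symmetric] by (intro sum.cong refl) (simp add: algebra_simps)
    finally show ?thesis by simp
  qed
  then have "cderivs X (ks @ [k]) (\<lambda>x. mmono \<alpha> (F x - F a)) a = cderivs X ks (\<lambda>x. Q k x - (- 1) * E x) a"
    unfolding cderivs_simps(3) by (rule cderivs_cong[OF V _ V(2)])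
  also have "\<dots> = cderivs X ks (Q k) a"
    using cderivs_diff_scaled[OF V smQ smE V(2), of X ks k "- 1"] cderivs_vanish[OF V smE vE, of ks X] by simp
  also have "\<dots> = (if mset (ks @ [k]) = \<alpha> then 1 else 0)"
  proof (cases "k \<in># \<alpha>")
    case True
    then have "Q k = (\<lambda>x. mmono (\<alpha> - {#k#}) (F x - F a))"
      by (simp add: Q_def fun_eq_iff dir_deriv_mmono)
    moreover have "length ks = size (\<alpha> - {#k#})" using True size by (simp add: size_Diff_singleton)
    moreover have "mset ks = \<alpha> - {#k#} \<longleftrightarrow> mset (ks @ [k]) = \<alpha>" using True by auto
    ultimately show ?thesis using snoc.IH by simp
  next
    case False
    then have "Q k = (\<lambda>x. 0)" by (simp add: Q_def fun_eq_iff dir_deriv_mmono)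
    moreover have "cderivs X ks (\<lambda>x. 0) x = 0" for x
    proof (induction ks arbitrary: x)
      case (Cons l ks)
      then have "cderivs X ks (\<lambda>x. 0) = (\<lambda>x. 0)" by blast
      then show ?case by (simp add: cvec_deriv_def)
    qed simp
    moreover have "mset (ks @ [k]) \<noteq> \<alpha>" using False by auto
    ultimately show ?thesis by simp
  qed
  finally show ?case .
qed

text \<open>The order \<open>m\<close> part of the remainder is annihilated by \<open>K = span {Y i a}\<close>,
  so it is a polynomial in the differentials of the components of \<open>F\<close>.\<close>

theorem formal_holomorphic_extension:
  fixes F :: "real^'d::finite \<Rightarrow> complex^'n::finite" and X :: "'n \<Rightarrow> complex^'d"
  assumes V: "open V" "a \<in> V" and F: "smooth_on V F" and f: "smooth_on V f"
    and Y: "\<And>i. i \<in> I \<Longrightarrow> smooth_on V (Y i)"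
    and crF: "\<And>i j m. i \<in> I \<Longrightarrow> vanish m (\<lambda>x. cvec_deriv (Y i x) (\<lambda>y. F y $ j) x) a"
    and crf: "\<And>i m. i \<in> I \<Longrightarrow> vanish m (\<lambda>x. cvec_deriv (Y i x) f x) a"
    and dual: "\<And>k j. cvec_deriv (X k) (\<lambda>y. F y $ j) a = (if j = k then 1 else 0)"
    and span: "vec.span (range X \<union> (\<lambda>i. Y i a) ` I) = UNIV"
  shows "\<exists>P. holo P \<and> vanish m (\<lambda>x. f x - P (F x)) a"
proof (induction m)
  case 0
  then show ?case using holo_const by auto
next
  case (Suc m)
  then obtain P where P: "holo P" "vanish m (\<lambda>x. f x - P (F x)) a" by blast
  have smP: "smooth_on V (\<lambda>x. P (F x))" if "smooth_on UNIV P" for P :: "complex^'n \<Rightarrow> complex"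
    by (rule smooth_on_compose[OF V(1) open_UNIV _ F that]) simp
  have smj: "smooth_on V (\<lambda>y. F y $ j)" for j by (rule smooth_on_nth[OF V(1) F])
  define g where "g x = f x - P (F x)" for x
  have smg: "smooth_on V g"
    unfolding g_def by (intro smooth_on_diff V f smP holo_smooth P)
  define L where "L = {ks :: 'n list. length ks = m}"
  have finL: "finite (mset ` L)"
    using finite_lists_length_eq[of "UNIV :: 'n set" m] by (simp add: L_def)
  \<comment> \<open>The Taylor coefficient of the remainder belonging to the multiset \<alpha>;
    \<open>SOME\<close> picks one ordering of it, and all orderings give the same value.\<close>
  define \<tau> where "\<tau> \<alpha> = cderivs X (SOME ks. mset ks = \<alpha>) g a" for \<alpha>
  define M where "M \<alpha> w = mmono \<alpha> (w - F a)" for \<alpha> and w :: "complex^'n"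
  define H where "H w = (\<Sum>\<alpha>\<in>mset ` L. \<tau> \<alpha> * M \<alpha> w)" for w
  have holoM: "holo (M \<alpha>)" for \<alpha>
    unfolding M_def by (rule holo_translate[OF holo_mmono])
  have holoH: "holo H"
    unfolding H_def by (intro holo_sum holo_mult holo_const holoM)
  have holoPH: "holo (\<lambda>w. P w + H w)" using holo_add[OF P(1) holoH] .
  have smH: "smooth_on V (\<lambda>x. H (F x))" and smM: "smooth_on V (\<lambda>x. M \<alpha> (F x))" for \<alpha>
    using smP holo_smooth holoH holoM by blast+
  \<comment> \<open>The factor 1 brings the difference into the shape of the rules for
    \<open>f y - c * g y\<close>.\<close>
  define g' where "g' x = g x - 1 * H (F x)" for x
  have g': "g' x = f x - 1 * (P (F x) + H (F x))" for x by (simp add: g'_def g_def)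
  have smg': "smooth_on V g'"
    unfolding g'_def by (intro smooth_on_diff smooth_on_mult smooth_on_const V smg smH)
  have vM: "vanish m (\<lambda>x. M \<alpha> (F x)) a" if "\<alpha> \<in> mset ` L" for \<alpha>
  proof -
    have "size \<alpha> = m" using that by (auto simp: L_def)
    have sm: "smooth_on V (\<lambda>x. F x - F a)" by (intro smooth_on_diff smooth_on_const V F)
    show ?thesis
      unfolding M_def using vanish_mmono[OF \<open>size \<alpha> = m\<close>]
      by (intro vanish_compose[OF V open_UNIV _ sm holo_smooth[OF holo_mmono]]) auto
  qed
  have "vanish (0 + m) (\<lambda>x. \<tau> \<alpha> * M \<alpha> (F x)) a" if "\<alpha> \<in> mset ` L" for \<alpha>
    by (rule vanish_mult[OF V smooth_on_const[OF V(1)] smM _ vM[OF that]]) simp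
  then have vH: "vanish m (\<lambda>x. H (F x)) a"
    unfolding H_def by (intro vanish_sum[OF V] smooth_on_mult smooth_on_const smM V) simp
  then have vg': "vanish m g' a"
    using vanish_diff[OF V smg smH P(2)[folded g_def] vH] by (simp add: g'_def[abs_def])
  \<comment> \<open>Along the field \<open>Y i\<close> both \<open>f\<close> and the holomorphic
    function of \<open>F\<close> are annihilated to every order; freezing the field at
    \<open>a\<close> keeps order \<open>m\<close>.\<close>
  have "vanish m (cvec_deriv (Y i a) g') a" if i: "i \<in> I" for i
  proof (rule vanish_cvec_deriv_freeze[OF V smg' Y[OF i] vg'])
    let ?D = "\<lambda>j x. dir_deriv (axis j 1) (\<lambda>w. P w + H w) (F x)"
    have smD: "smooth_on V (?D j)" for j
      by (intro smP smooth_on_dir_deriv holo_smooth holoPH)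
    have smYf: "smooth_on V (\<lambda>x. cvec_deriv (Y i x) f x)" and smYF: "smooth_on V (\<lambda>x. cvec_deriv (Y i x) (\<lambda>y. F y $ j) x)" for j
      by (intro smooth_on_cvec_deriv V f smj Y[OF i])+
    have "vanish (m + 0) (\<lambda>x. cvec_deriv (Y i x) (\<lambda>y. F y $ j) x * ?D j x) a" for j
      by (rule vanish_mult[OF V smYF smD crF[OF i]]) simp
    then have v: "vanish m (\<lambda>x. cvec_deriv (Y i x) f x - (\<Sum>j\<in>UNIV. cvec_deriv (Y i x) (\<lambda>y. F y $ j) x * ?D j x)) a"
      by (intro vanish_diff[OF V] vanish_sum[OF V] smooth_on_sum smooth_on_mult smYf smYF smD crf[OF i] V) simp
    show "vanish m (\<lambda>x. cvec_deriv (Y i x) g' x) a"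
    proof (rule vanish_cong[OF V _ v])
      fix x assume x: "x \<in> V"
      have "cvec_deriv (Y i x) g' x = cvec_deriv (Y i x) f x - 1 * cvec_deriv (Y i x) (\<lambda>y. P (F y) + H (F y)) x"
        unfolding g' using smP[OF holo_smooth[OF holoPH]]
        by (intro cvec_deriv_linear_combination[OF V(1) f _ x])
      then show "cvec_deriv (Y i x) f x - (\<Sum>j\<in>UNIV. cvec_deriv (Y i x) (\<lambda>y. F y $ j) x * ?D j x) = cvec_deriv (Y i x) g' x"
        using cvec_deriv_holo_compose[OF smooth_on_differentiable[OF F V(1) x] holoPH] by simp
    qed
  qed
  moreover have "cderivs X ks g' a = 0" if ks: "length ks = m" for ks
  proof -
    \<comment> \<open>The sum is peeled off term by term, so that \<open>cderivs_diff_scaled\<close>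
      handles each subtraction separately.\<close>
    have "cderivs X ks (\<lambda>x. g x - 1 * (\<Sum>\<alpha>\<in>B. \<tau> \<alpha> * M \<alpha> (F x))) a
        = cderivs X ks g a - (\<Sum>\<alpha>\<in>B. \<tau> \<alpha> * (if mset ks = \<alpha> then 1 else 0))" if "finite B" "B \<subseteq> mset ` L" for B
      using that
    proof (induction B rule: finite_induct)
      case (insert \<alpha> B)
      have "length ks = size \<alpha>" using ks insert.prems by (auto simp: L_def)
      note m = cderivs_mmono[OF V F dual this]
      have sm: "smooth_on V (\<lambda>x. g x - 1 * (\<Sum>\<alpha>\<in>B. \<tau> \<alpha> * M \<alpha> (F x)))"
        by (intro smooth_on_diff smooth_on_mult smooth_on_sum smooth_on_const smg smM V)
      have "cderivs X ks (\<lambda>x. g x - 1 * (\<Sum>\<alpha>\<in>insert \<alpha> B. \<tau> \<alpha> * M \<alpha> (F x))) a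
        = cderivs X ks (\<lambda>x. (g x - 1 * (\<Sum>\<alpha>\<in>B. \<tau> \<alpha> * M \<alpha> (F x))) - \<tau> \<alpha> * M \<alpha> (F x)) a"
        using insert.hyps by (simp add: algebra_simps)
      also have "\<dots> = cderivs X ks (\<lambda>x. g x - 1 * (\<Sum>\<alpha>\<in>B. \<tau> \<alpha> * M \<alpha> (F x))) a
          - \<tau> \<alpha> * cderivs X ks (\<lambda>x. M \<alpha> (F x)) a"
        by (rule cderivs_diff_scaled[OF V sm smM V(2)])
      finally show ?case
        using insert m by (simp add: M_def)
    qed simp
    from this[OF finL subset_refl] have "cderivs X ks g' a
        = cderivs X ks g a - (\<Sum>\<alpha>\<in>mset ` L. \<tau> \<alpha> * (if mset ks = \<alpha> then 1 else 0))"
      by (simp add: g'_def[abs_def] H_def)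
    also have "(\<Sum>\<alpha>\<in>mset ` L. \<tau> \<alpha> * (if mset ks = \<alpha> then 1 else 0)) = (\<Sum>\<alpha>\<in>mset ` L. if mset ks = \<alpha> then \<tau> \<alpha> else 0)"
      by (intro sum.cong refl) simp
    also have "\<dots> = \<tau> (mset ks)"
      using finL ks by (simp add: sum.delta' L_def)
    also have "\<dots> = cderivs X ks g a"
      unfolding \<tau>_def by (rule cderivs_mset_cong[OF V smg _ V(2)]) (rule someI[of _ ks], rule refl)
    finally show ?thesis by simp
  qed
  ultimately have "vanish (Suc m) g' a"
    by (intro vanish_Suc_spanning[OF V span smg' vg']) auto
  then have "vanish (Suc m) (\<lambda>x. f x - (P (F x) + H (F x))) a"
    by (simp add: g'[abs_def] del: vanish.simps)
  then show ?case using holoPH by blast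
qed

section \<open>Frames of the complexified tangent space\<close>

lemma cnj_vec_cnj_vec [simp]: "cnj_vec (cnj_vec v) = v"
  by (simp add: cnj_vec_def vec_eq_iff)

lemma cnj_vec_span: "v \<in> vec.span S \<Longrightarrow> cnj_vec v \<in> vec.span (cnj_vec ` S)"
proof (induction rule: vec.span_induct_alt)
  case base
  have "cnj_vec 0 = (0 :: complex^'a)" by (simp add: cnj_vec_def vec_eq_iff)
  then show ?case by (simp add: vec.span_zero)
next
  case (step c x y)
  have "cnj_vec (c *s x + y) = cnj c *s cnj_vec x + cnj_vec y"
    by (simp add: cnj_vec_def vec_eq_iff)
  then show ?case
    using step by (simp only:) (intro vec.span_add vec.span_scale; auto intro: vec.span_base)
qed

text \<open>Conjugation is antilinear, so the dimensions are compared through a basis: a dependence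
  among conjugated vectors conjugates back to one among the original vectors.\<close>

lemma dim_cnj_vec_le: "vec.dim S \<le> vec.dim (cnj_vec ` S)"
proof -
  obtain B where B: "B \<subseteq> S" "vec.independent B" "card B = vec.dim S"
    using vec.basis_exists by metis
  have inj: "inj cnj_vec" by (metis cnj_vec_cnj_vec injI)
  have "vec.independent (cnj_vec ` B)"
    unfolding vec.dependent_def
  proof clarsimp
    fix x assume x: "x \<in> B" and "cnj_vec x \<in> vec.span (cnj_vec ` B - {cnj_vec x})"
    from cnj_vec_span[OF this(2)] have "x \<in> vec.span (cnj_vec ` (cnj_vec ` B - {cnj_vec x}))"
      by simp
    also have "cnj_vec ` (cnj_vec ` B - {cnj_vec x}) = B - {x}"
      by (simp add: image_set_diff[OF inj] image_image)
    finally show False using B(2) x by (auto simp: vec.dependent_def)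
  qed
  then have "card (cnj_vec ` B) \<le> vec.dim (cnj_vec ` S)"
    using B(1) by (intro vec.independent_card_le_dim) auto
  then show ?thesis
    using B(3) card_image[OF inj_on_subset[OF inj], of B] by simp
qed

text \<open>A real hyperplane of \<open>complex^'n\<close> spans over the complex numbers, so the differentials
  of the coordinates are independent on the complexified tangent space.\<close>

lemma complex_dual_frame:
  fixes D :: "real^'d::finite \<Rightarrow> complex^'n::finite" and K :: "(complex^'d) set"
  assumes D: "linear D" "inj D" and card: "CARD('d) = 2 * CARD('n) - 1"
    and K: "\<And>\<zeta> j. \<zeta> \<in> K \<Longrightarrow> (\<Sum>l\<in>UNIV. \<zeta> $ l * D (axis l 1) $ j) = 0"
    and dim: "CARD('n) - 1 \<le> vec.dim K"
  shows "\<exists>X :: 'n \<Rightarrow> complex^'d. (\<forall>k j. (\<Sum>l\<in>UNIV. X k $ l * D (axis l 1) $ j) = (if j = k then 1 else 0))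
    \<and> vec.span (range X \<union> K) = UNIV"
proof -
  interpret D: linear D by fact
  define M :: "complex^'d^'n" where "M = (\<chi> j l. D (axis l 1) $ j)"
  have Mv: "(M *v \<zeta>) $ j = (\<Sum>l\<in>UNIV. \<zeta> $ l * D (axis l 1) $ j)" for \<zeta> j
    by (simp add: M_def matrix_vector_mult_def mult.commute)
  have "\<forall>c. (\<Sum>i\<in>UNIV. c i *s row i M) = 0 \<longrightarrow> (\<forall>i. c i = 0)"
  proof (intro allI impI, rule ccontr)
    fix c i0 assume c: "(\<Sum>i\<in>UNIV. c i *s row i M) = 0" and i0: "c i0 \<noteq> 0"
    \<comment> \<open>A dependence among the rows is a complex linear form that is zero on the range
      of \<open>D\<close>. Adding a complex line on which it is not zero would embed real dimension
      2 n + 1 into 2 n, where n is the complex dimension of the target.\<close>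
    define ell where "ell w = (\<Sum>i\<in>UNIV. c i * w $ i)" for w :: "complex^'n"
    have ellin: "ell (v + w) = ell v + ell w" "ell (z *s v) = z * ell v" for v w z
      by (simp_all add: ell_def algebra_simps sum.distrib sum_distrib_left)
    have "(\<Sum>i\<in>UNIV. c i *s row i M) $ l = 0" for l using c by simp
    then have ax: "ell (D (axis l 1)) = 0" for l
      by (simp add: ell_def row_def M_def)
    have ellD: "ell (D v) = 0" for v
    proof -
      have "D v = (\<Sum>l\<in>UNIV. complex_of_real (v $ l) *s D (axis l 1))"
        using arg_cong[OF basis_expansion[of v, symmetric], of D]
        by (simp only: scalar_mult_eq_scaleR D.sum D.scale) (simp add: vec_eq_iff complex_eq_iff)
      moreover have "ell (\<Sum>l\<in>I. complex_of_real (v $ l) *s D (axis l 1)) = 0" if "finite I" for I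
        using that by (induction I rule: finite_induct) (simp_all add: ellin ax, simp add: ell_def)
      ultimately show ?thesis by simp
    qed
    define w0 :: "complex^'n" where "w0 = axis i0 (1 / c i0)"
    have w0: "ell w0 = 1"
      using i0 by (simp add: ell_def w0_def axis_def if_distrib cong: if_cong)
    define \<Theta> where "\<Theta> p = D (fst p) + snd p *s w0" for p :: "(real^'d) \<times> complex"
    have lin: "linear \<Theta>"
      by (rule linearI) (simp_all add: \<Theta>_def D.add D.scale vec_eq_iff algebra_simps)
    have "inj \<Theta>"
      unfolding linear_injective_0[OF lin]
    proof (intro allI impI)
      fix p assume p: "\<Theta> p = 0"
      have "ell (\<Theta> p) = snd p" by (simp add: \<Theta>_def ellin ellD w0)
      then have "snd p = 0" using p by (simp add: ell_def)
      moreover from this have "fst p = 0"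
        using p D by (simp add: \<Theta>_def linear_injective_0)
      ultimately show "p = 0" by (simp add: prod_eq_iff)
    qed
    then have "dim (\<Theta> ` UNIV) = dim (UNIV :: ((real^'d) \<times> complex) set)"
      by (intro dim_image_eq lin) simp
    then have "DIM((real^'d) \<times> complex) \<le> DIM(complex^'n)"
      using dim_subset_UNIV[of "\<Theta> ` UNIV"] by (simp add: dim_UNIV)
    moreover have "0 < CARD('n)" by simp
    ultimately show False using card by simp
  qed
  then obtain B where B: "M ** B = mat 1"
    using matrix_right_invertible_independent_rows by blast
  define X where "X k = column k B" for k
  have MB: "M *v (B *v c) = c" for c by (simp add: matrix_vector_mul_assoc B)
  have XB: "X k = B *v axis k 1" for k
    by (simp add: X_def vec_eq_iff column_def matrix_vector_mult_def axis_def if_distrib cong: if_cong)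
  have X: "(M *v X k) $ j = (if j = k then 1 else 0)" for k j
    unfolding XB MB by (simp add: axis_def)
  have injB: "inj ((*v) B)" by (metis MB injI)
  let ?R = "range ((*v) B)"
  have subR: "vec.subspace ?R"
    by (rule vec.subspace_image) (rule vec.subspace_UNIV)
  have dimR: "vec.dim ?R = CARD('n)"
    using vec.dim_image_eq[of "(*v) B" UNIV] injB by (simp add: card_cart_basis inj_on_subset)
  have RX: "?R \<subseteq> vec.span (range X)"
  proof clarsimp
    fix c :: "complex^'n"
    have "B *v c = (\<Sum>k\<in>UNIV. c $ k *s X k)" by (simp add: X_def matrix_mult_sum)
    also have "\<dots> \<in> vec.span (range X)"
      by (intro vec.span_sum vec.span_scale vec.span_base rangeI)
    finally show "B *v c \<in> vec.span (range X)" .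
  qed
  have kerK: "M *v \<zeta> = 0" if "\<zeta> \<in> vec.span K" for \<zeta>
    using that
  proof (induction rule: vec.span_induct_alt)
    case (step c x y)
    have "M *v x = 0" using K[OF step(1)] by (simp add: vec_eq_iff Mv)
    then show ?case using step by (simp add: vec.add vec.scale)
  qed simp
  \<comment> \<open>\<open>K\<close> lies in the kernel of \<open>M\<close>, while \<open>M\<close>
    is injective on the range of its right inverse \<open>B\<close>. The dimensions n - 1 and n then
    add up to that of the whole space.\<close>
  have "vec.span K \<inter> ?R = {0}"
  proof (intro equalityI subsetI)
    fix \<zeta> assume "\<zeta> \<in> vec.span K \<inter> ?R"
    then obtain c where c: "\<zeta> = B *v c" "M *v \<zeta> = 0" using kerK by blast
    then have "c = 0" using MB[of c] by simp
    then show "\<zeta> \<in> {0}" using c by simp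
  qed (use vec.span_zero subR vec.subspace_0 in auto)
  then have "vec.dim {x + y |x y. x \<in> vec.span K \<and> y \<in> ?R} = vec.dim K + CARD('n)"
    using vec.dim_sums_Int[OF vec.subspace_span[of K] subR] dimR by simp
  moreover
  have "{x + y |x y. x \<in> vec.span K \<and> y \<in> ?R} \<subseteq> vec.span (range X \<union> K)"
  proof
    fix z assume "z \<in> {x + y |x y. x \<in> vec.span K \<and> y \<in> ?R}"
    then obtain x y where z: "z = x + y" and "x \<in> vec.span K" "y \<in> ?R" by blast
    then have "x \<in> vec.span (range X \<union> K)" "y \<in> vec.span (range X \<union> K)"
      using RX vec.span_mono[of "range X" "range X \<union> K"] vec.span_mono[of K "range X \<union> K"] by blast+
    then show "z \<in> vec.span (range X \<union> K)" unfolding z by (rule vec.span_add)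
  qed
  from vec.dim_subset[OF this] calculation have "vec.dim K + CARD('n) \<le> vec.dim (vec.span (range X \<union> K))"
    by (simp only:)
  moreover have "vec.dim (vec.span (range X \<union> K)) \<le> CARD('d)"
    using vec.dim_subset_UNIV[of "vec.span (range X \<union> K)"] by (simp add: card_cart_basis vec.dimension_def)
  ultimately have "vec.dim (range X \<union> K) = CARD('d)"
    using dim card by simp
  then have "vec.span (range X \<union> K) = UNIV"
    using vec.dim_eq_full[of "range X \<union> K"] by (simp add: card_cart_basis vec.dimension_def)
  then show ?thesis
    using X unfolding Mv by blast
qed

section \<open>The ambient metric\<close>

lemma bounded_linear_amb_base: "bounded_linear (amb_base :: complex^('n::finite option) \<Rightarrow> complex^'n)"
  unfolding linear_conv_bounded_linear[symmetric]
  by (rule linearI) (simp_all add: amb_base_def vec_eq_iff)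

lemma amb_nth [simp]: "amb z0 z $ None = z0" "amb z0 z $ Some j = z $ j"
  by (simp_all add: amb_def)

lemma amb_base_amb [simp]: "amb_base (amb z0 z) = z"
  by (simp add: amb_base_def vec_eq_iff)

lemma amb_collapse [simp]: "amb (y $ None) (amb_base y) = y"
  by (auto simp: amb_def amb_base_def vec_eq_iff split: option.split)

lemma amb_over_eq: "amb_over W = {y. y $ None \<noteq> 0 \<and> amb_base y \<in> W}"
  unfolding amb_over_def by (auto) (metis amb_collapse)

lemma open_amb_over:
  assumes "open W"
  shows "open (amb_over W)"
proof -
  have "open ((\<lambda>y. y $ None) -` (- {0}) \<inter> amb_base -` W :: (complex^('a option)) set)"
    using assms linear_continuous_on[OF bounded_linear_amb_base]
    by (intro open_Int open_vimage continuous_on_component continuous_on_id) auto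
  moreover have "(\<lambda>y. y $ None) -` (- {0}) \<inter> amb_base -` W = amb_over W"
    by (auto simp: amb_over_eq)
  ultimately show ?thesis by simp
qed

text \<open>The parameter \<epsilon> = - i gives \<open>dz\<close> and \<epsilon> = i gives
  \<open>dzbar\<close>, so product and chain rules are proved once for both.\<close>

definition wirt :: "complex \<Rightarrow> 'm::finite \<Rightarrow> (complex^'m \<Rightarrow> complex) \<Rightarrow> complex^'m \<Rightarrow> complex" where
  "wirt \<epsilon> j f x = (dir_deriv (axis j 1) f x + \<epsilon> * dir_deriv (axis j \<i>) f x) / 2"

lemma dz_wirt: "dz = wirt (- \<i>)" and dzbar_wirt: "dzbar = wirt \<i>"
  by (simp_all add: fun_eq_iff dz_def dzbar_def wirt_def)

lemma smooth_on_wirt: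
  assumes "open S" "smooth_on S f"
  shows "smooth_on S (wirt \<epsilon> j f)"
proof -
  have "smooth_on S (\<lambda>x. (dir_deriv (axis j 1) f x + \<epsilon> * dir_deriv (axis j \<i>) f x) * (1 / 2))"
    by (intro smooth_on_mult smooth_on_add smooth_on_const smooth_on_dir_deriv assms)
  then show ?thesis by (simp add: wirt_def[abs_def])
qed

lemma wirt_cong:
  "open S \<Longrightarrow> x \<in> S \<Longrightarrow> (\<And>y. y \<in> S \<Longrightarrow> f y = g y) \<Longrightarrow> wirt \<epsilon> j f x = wirt \<epsilon> j g x"
  by (simp add: wirt_def dir_deriv_cong[of S x f g])

lemma wirt_mult:
  assumes "f differentiable (at x)" "g differentiable (at x)"
  shows "wirt \<epsilon> j (\<lambda>y. f y * g y) x = wirt \<epsilon> j f x * g x + f x * wirt \<epsilon> j g x"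
proof -
  have "dir_deriv v (\<lambda>y. f y * g y) x = f x * dir_deriv v g x + dir_deriv v f x * g x" for v
    by (rule dir_deriv_eqI) (intro has_derivative_mult has_derivative_dir_deriv assms)
  then show ?thesis by (simp add: wirt_def field_simps)
qed

lemma wirt_amb_base:
  fixes f :: "complex^'n::finite \<Rightarrow> complex"
  assumes "f differentiable (at (amb_base x))"
  shows "wirt \<epsilon> None (\<lambda>y. f (amb_base y)) x = 0"
    "wirt \<epsilon> (Some j) (\<lambda>y. f (amb_base y)) x = wirt \<epsilon> j f (amb_base x)"
proof -
  have "dir_deriv v (\<lambda>y. f (amb_base y)) x = dir_deriv (amb_base v) f (amb_base x)" for v
    using diff_chain_at[OF bounded_linear_imp_has_derivative[OF bounded_linear_amb_base]
        has_derivative_dir_deriv[OF assms]]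
    by (intro dir_deriv_eqI) (simp add: o_def)
  moreover have "amb_base (axis None e) = (0 :: complex^'n)" "amb_base (axis (Some j) e) = axis j e" for e
    by (auto simp: amb_base_def axis_def vec_eq_iff)
  ultimately show "wirt \<epsilon> None (\<lambda>y. f (amb_base y)) x = 0"
    "wirt \<epsilon> (Some j) (\<lambda>y. f (amb_base y)) x = wirt \<epsilon> j f (amb_base x)"
    using linear_0[OF linear_dir_deriv[OF assms]] by (simp_all add: wirt_def)
qed

lemma wirt_nth:
  "wirt \<epsilon> j (\<lambda>y. y $ i) x = (if i = j then (1 + \<epsilon> * \<i>) / 2 else 0)"
  "wirt \<epsilon> j (\<lambda>y. cnj (y $ i)) x = (if i = j then (1 - \<epsilon> * \<i>) / 2 else 0)"
proof -
  have "dir_deriv v (\<lambda>y. y $ i) x = v $ i" "dir_deriv v (\<lambda>y. cnj (y $ i)) x = cnj (v $ i)" for v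
    by (rule dir_deriv_eqI, rule bounded_linear_imp_has_derivative,
        intro bounded_linear_vec_nth bounded_linear_compose[OF bounded_linear_cnj])+
  then show "wirt \<epsilon> j (\<lambda>y. y $ i) x = (if i = j then (1 + \<epsilon> * \<i>) / 2 else 0)"
    "wirt \<epsilon> j (\<lambda>y. cnj (y $ i)) x = (if i = j then (1 - \<epsilon> * \<i>) / 2 else 0)"
    by (simp_all add: wirt_def axis_def)
qed

definition fefferman_matrix :: "(complex^'n::finite \<Rightarrow> real) \<Rightarrow> complex^'n \<Rightarrow> complex^('n option)^('n option)" where
  "fefferman_matrix \<rho> z = (\<chi> a b.
       (let r = (\<lambda>w. complex_of_real (\<rho> w)) in
        case (a, b) of
          (None, None) \<Rightarrow> r z
        | (None, Some j) \<Rightarrow> dz j r z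
        | (Some k, None) \<Rightarrow> dzbar k r z
        | (Some k, Some j) \<Rightarrow> dzbar k (dz j r) z))"

lemma fefferman_J_eq: "fefferman_J \<rho> z = (-1) ^ CARD('n) * det (fefferman_matrix \<rho> z)"
  for \<rho> :: "complex^'n::finite \<Rightarrow> real"
  by (simp only: fefferman_J_def fefferman_matrix_def)

text \<open>Serves to make the condition that J[u] is nonzero an open one.\<close>

lemma smooth_on_fefferman_J:
  assumes "open W" "smooth_on W u"
  shows "smooth_on W (fefferman_J u)"
proof -
  have sm: "smooth_on W (\<lambda>w. complex_of_real (u w))"
    by (rule smooth_on_linear_compose[OF assms(1) bounded_linear_of_real assms(2)])
  have "smooth_on W (\<lambda>z. fefferman_matrix u z $ a $ b)" for a b
    using sm smooth_on_wirt[OF assms(1) sm] smooth_on_wirt[OF assms(1) smooth_on_wirt[OF assms(1) sm]]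
    by (cases a; cases b) (simp_all add: fefferman_matrix_def dz_wirt dzbar_wirt)
  then show ?thesis
    unfolding fefferman_J_eq[abs_def]
    by (intro smooth_on_mult smooth_on_const smooth_on_det assms(1))
qed

abbreviation ambient_potential :: "(complex^'n::finite \<Rightarrow> real) \<Rightarrow> complex^('n option) \<Rightarrow> real" where
  "ambient_potential u y \<equiv> (cmod (y $ None))\<^sup>2 * u (amb_base y)"

lemma smooth_on_amb_base:
  assumes "open W" "smooth_on W f"
  shows "smooth_on (amb_over W) (\<lambda>y. f (amb_base y))"
  by (rule smooth_on_compose[OF open_amb_over[OF assms(1)] assms(1) _
      smooth_on_linear[OF open_amb_over[OF assms(1)] bounded_linear_amb_base] assms(2)])
    (auto simp: amb_over_eq)

lemma smooth_on_ambient_potential: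
  assumes "open W" "smooth_on W u"
  shows "smooth_on (amb_over W) (ambient_potential u)"
proof -
  have op: "open (amb_over W)" by (rule open_amb_over[OF assms(1)])
  have lin: "bounded_linear (\<lambda>y::complex^('a option). Re (y $ None))" "bounded_linear (\<lambda>y::complex^('a option). Im (y $ None))"
    by (rule bounded_linear_compose[OF bounded_linear_Re bounded_linear_vec_nth],
        rule bounded_linear_compose[OF bounded_linear_Im bounded_linear_vec_nth])
  have "smooth_on (amb_over W) (\<lambda>y. (Re (y $ None) * Re (y $ None) + Im (y $ None) * Im (y $ None)) * u (amb_base y))"
    by (intro smooth_on_mult smooth_on_add op smooth_on_amb_base assms smooth_on_linear[OF op lin(1)] smooth_on_linear[OF op lin(2)])
  then show ?thesis unfolding cmod_power2 by (simp only: power2_eq_square)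
qed

text \<open>The complex Hessian of \<open>|z\<^sub>0|\<^sup>2 u\<close> is \<open>S\<^sup>* B S\<close>, where \<open>B\<close> is the bordered matrix in
  \<open>J[u]\<close> and \<open>S = diag(1, z\<^sub>0, \<dots>, z\<^sub>0)\<close>.\<close>

lemma complex_hessian_ambient_potential:
  assumes W: "open W" "smooth_on W u" and y: "y \<in> amb_over W"
  defines "s \<equiv> (\<lambda>i. case i of None \<Rightarrow> 1 | Some _ \<Rightarrow> y $ None)"
  shows "dzbar k (dz j (\<lambda>y. complex_of_real (ambient_potential u y))) y
    = cnj (s k) * fefferman_matrix u (amb_base y) $ k $ j * s j"
proof -
  let ?U = "\<lambda>w. complex_of_real (u w)" and ?r = "\<lambda>y. complex_of_real (ambient_potential u y)"
  have op: "open (amb_over W)" by (rule open_amb_over[OF W(1)])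
  have sm: "smooth_on W ?U"
    by (rule smooth_on_linear_compose[OF W(1) bounded_linear_of_real W(2)])
  note smz = smooth_on_wirt[OF W(1) sm, of "- \<i>"]
  have dU: "?U differentiable (at (amb_base y))" "wirt (- \<i>) j ?U differentiable (at (amb_base y))"
    if "y \<in> amb_over W" for y j
    using smooth_on_differentiable[OF sm W(1)] smooth_on_differentiable[OF smz W(1)] that
    by (auto simp: amb_over_eq)
  have db: "(\<lambda>y. f (amb_base y)) differentiable (at y)" if "f differentiable (at (amb_base y))" for f :: "_ \<Rightarrow> complex" and y
    using differentiable_chain_at[OF bounded_linear_imp_differentiable[OF bounded_linear_amb_base] that]
    by (simp add: o_def)
  have dn: "(\<lambda>y::complex^('a option). y $ None) differentiable (at y)" "(\<lambda>y::complex^('a option). cnj (y $ None)) differentiable (at y)" for y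
    by (intro bounded_linear_imp_differentiable bounded_linear_vec_nth bounded_linear_compose[OF bounded_linear_cnj])+
  note wm = wirt_mult wirt_nth wirt_amb_base[OF dU(1)] wirt_amb_base[OF dU(2)] db[OF dU(1)] db[OF dU(2)] dn
    differentiable_mult
  \<comment> \<open>With |z_0|^2 as the product of z_0 and its conjugate, each Wirtinger derivative
    sees only one of the two factors.\<close>
  have r: "?r = (\<lambda>y. y $ None * (cnj (y $ None) * ?U (amb_base y)))"
    by (rule ext) (simp only: complex_norm_square of_real_mult mult.assoc)
  have z: "wirt (- \<i>) i ?r y = (case i of None \<Rightarrow> cnj (y $ None) * ?U (amb_base y)
      | Some j \<Rightarrow> y $ None * (cnj (y $ None) * wirt (- \<i>) j ?U (amb_base y)))"
    if "y \<in> amb_over W" for y i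
    unfolding r using that by (cases i) (simp_all add: wm)
  have "wirt \<i> k (wirt (- \<i>) j ?r) y = wirt \<i> k (\<lambda>y. case j of None \<Rightarrow> cnj (y $ None) * ?U (amb_base y)
      | Some j \<Rightarrow> y $ None * (cnj (y $ None) * wirt (- \<i>) j ?U (amb_base y))) y"
    by (rule wirt_cong[OF op y z])
  also have "\<dots> = cnj (s k) * fefferman_matrix u (amb_base y) $ k $ j * s j"
    using y by (cases j; cases k) (simp_all add: wm s_def fefferman_matrix_def dz_wirt dzbar_wirt)
  finally show ?thesis by (simp only: dz_wirt dzbar_wirt)
qed

text \<open>For a real kernel vector, the two rows belonging to a coordinate are the real and
  imaginary parts of one complex equation for the complex Hessian, so a trivial complex kernel
  forces a trivial real one.\<close>

lemma det_kahler_gram_nonzero: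
  fixes \<phi> :: "complex^'m::finite \<Rightarrow> real"
  assumes "\<And>w. (\<And>j. (\<Sum>k\<in>UNIV. dzbar k (dz j (\<lambda>y. complex_of_real (\<phi> y))) x * w $ k) = 0) \<Longrightarrow> w = 0"
  shows "det (kahler_gram \<phi> x) \<noteq> 0"
proof -
  let ?H = "\<lambda>j k. dzbar k (dz j (\<lambda>y. complex_of_real (\<phi> y))) x"
  have "V = 0" if V: "kahler_gram \<phi> x *v V = 0" for V
  proof -
    \<comment> \<open>The conjugate of the complex vector with real coordinates \<open>V\<close>:
      the second argument of the Hermitian form enters conjugated.\<close>
    define w :: "complex^'m" where "w = (\<chi> k. complex_of_real (V $ (k, False)) - \<i> * complex_of_real (V $ (k, True)))"
    have eq: "(kahler_gram \<phi> x *v V) $ I = - Re (cpart I * (\<Sum>k\<in>UNIV. ?H (fst I) k * w $ k))" for I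
    proof -
      have UNIV_pair: "(\<Sum>J\<in>UNIV. f J) = (\<Sum>k\<in>UNIV. \<Sum>b\<in>UNIV. f (k, b))" for f :: "'m \<times> bool \<Rightarrow> real"
        by (simp add: sum.cartesian_product)
      have "(kahler_gram \<phi> x *v V) $ I = (\<Sum>J\<in>UNIV. - Re (?H (fst I) (fst J) * cpart I * cnj (cpart J)) * V $ J)"
        by (simp only: matrix_vector_mult_def vec_lambda_beta kahler_gram_entry)
      also have "\<dots> = (\<Sum>k\<in>UNIV. \<Sum>b\<in>UNIV. - Re (?H (fst I) k * cpart I * cnj (cpart (k, b))) * V $ (k, b))"
        by (simp only: UNIV_pair fst_conv)
      also have "\<dots> = (\<Sum>k\<in>UNIV. - Re (cpart I * (?H (fst I) k * w $ k)))"
        by (intro sum.cong refl) (simp add: UNIV_bool w_def algebra_simps)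
      finally show ?thesis by (simp only: sum_distrib_left Re_sum sum_negf)
    qed
    have "w = 0"
    proof (rule assms)
      fix j
      have "(kahler_gram \<phi> x *v V) $ (j, False) = 0" "(kahler_gram \<phi> x *v V) $ (j, True) = 0"
        using V by simp_all
      then show "(\<Sum>k\<in>UNIV. ?H j k * w $ k) = 0"
        unfolding eq by (simp add: complex_eq_iff)
    qed
    then have "w $ k = 0" for k by simp
    then have "V $ (k, b) = 0" for k b
      by (cases b) (simp_all add: w_def complex_eq_iff)
    then show "V = 0" by (simp add: vec_eq_iff)
  qed
  then have "\<exists>B. B ** kahler_gram \<phi> x = mat 1"
    unfolding matrix_left_invertible_ker by blast
  then show ?thesis
    by (metis det_I det_mul mult_zero_right zero_neq_one)
qed

text \<open>In the factorization of the complex Hessian the diagonal factors are invertible because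
  z_0 is not 0, and the bordered matrix because J[u] is not 0.\<close>

lemma det_ambient_gram_nonzero:
  fixes u :: "complex^'n::finite \<Rightarrow> real"
  assumes W: "open W" "smooth_on W u" and y: "y \<in> amb_over W" and J: "fefferman_J u (amb_base y) \<noteq> 0"
  shows "det (kahler_gram (ambient_potential u) y) \<noteq> 0"
proof (rule det_kahler_gram_nonzero)
  fix w :: "complex^('n option)"
  let ?B = "fefferman_matrix u (amb_base y)"
  define s where "s = (\<lambda>i :: 'n option. case i of None \<Rightarrow> 1 | Some _ \<Rightarrow> y $ None)"
  have s: "s i \<noteq> 0" for i using y by (auto simp: s_def amb_over_eq split: option.split)
  assume "\<And>j. (\<Sum>k\<in>UNIV. dzbar k (dz j (\<lambda>y. complex_of_real (ambient_potential u y))) y * w $ k) = 0"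
  then have 0: "(\<Sum>k\<in>UNIV. cnj (s k) * ?B $ k $ j * s j * w $ k) = 0" for j
    unfolding complex_hessian_ambient_potential[OF W y] s_def .
  have "(transpose ?B *v (\<chi> k. cnj (s k) * w $ k)) $ j = 0" for j
  proof -
    have "(transpose ?B *v (\<chi> k. cnj (s k) * w $ k)) $ j * s j = (\<Sum>k\<in>UNIV. cnj (s k) * ?B $ k $ j * s j * w $ k)"
      by (simp add: matrix_vector_mult_def transpose_def sum_distrib_left ac_simps)
    then show ?thesis using 0 s by simp
  qed
  then have "transpose ?B *v (\<chi> k. cnj (s k) * w $ k) = 0" by (simp add: vec_eq_iff)
  moreover have "det (transpose ?B) \<noteq> 0" using J by (simp add: fefferman_J_eq)
  ultimately have "(\<chi> k. cnj (s k) * w $ k) = 0"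
    by (metis invertible_det_nz invertible_def matrix_left_invertible_ker)
  then show "w = 0" using s by (simp add: vec_eq_iff)
qed

section \<open>Real parts of holomorphic functions are pluriharmonic\<close>

lemma holo_linear_compose:
  fixes L :: "complex^'m::finite \<Rightarrow> complex^'n::finite"
  assumes "bounded_linear L" "\<And>w. L (\<i> *s w) = \<i> *s L w" "holo P"
  shows "holo (\<lambda>x. P (L x))"
proof (rule holoI)
  show "smooth_on UNIV (\<lambda>x. P (L x))"
    by (rule smooth_on_compose[OF open_UNIV open_UNIV _ smooth_on_linear[OF open_UNIV assms(1)] holo_smooth[OF assms(3)]]) simp
  show "((\<lambda>x. P (L x)) has_derivative (\<lambda>v. dir_deriv (L v) P (L x))) (at x)" for x
    using diff_chain_at[OF bounded_linear_imp_has_derivative[OF assms(1)] holo_has_derivative[OF assms(3)]]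
    by (simp add: o_def)
  show "dir_deriv (L (\<i> *s w)) P (L x) = \<i> * dir_deriv (L w) P (L x)" for x w
    using assms by (simp add: holo_def)
qed

lemma holo_dir_deriv:
  assumes "holo P"
  shows "holo (dir_deriv v P)"
  unfolding holo_def
proof (intro conjI allI)
  note sm = holo_smooth[OF assms]
  show "smooth_on UNIV (dir_deriv v P)" by (rule smooth_on_dir_deriv[OF sm])
  fix w x
  have "dir_deriv (\<i> *s w) (dir_deriv v P) x = dir_deriv v (dir_deriv (\<i> *s w) P) x"
    by (rule dir_deriv_commute[OF open_UNIV sm UNIV_I])
  also have "dir_deriv (\<i> *s w) P = (\<lambda>x. \<i> * dir_deriv w P x)"
    using assms by (simp add: holo_def fun_eq_iff)
  also have "dir_deriv v (\<lambda>x. \<i> * dir_deriv w P x) x = \<i> * dir_deriv v (dir_deriv w P) x"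
    by (intro dir_deriv_eqI has_derivative_mult_right smooth_on_has_derivative[OF _ open_UNIV] smooth_on_dir_deriv sm) simp
  also have "dir_deriv v (dir_deriv w P) x = dir_deriv w (dir_deriv v P) x"
    by (rule dir_deriv_commute[OF open_UNIV sm UNIV_I])
  finally show "dir_deriv (\<i> *s w) (dir_deriv v P) x = \<i> * dir_deriv w (dir_deriv v P) x" .
qed

lemma holo_cderiv_irot:
  assumes "holo P"
  shows "complex_of_real (isgn I) * cderiv (irot I) P x = \<i> * cderiv I P x"
proof -
  have "\<i> * cderiv I P x = dir_deriv (isgn I *\<^sub>R cframe (irot I)) P x"
    using assms by (simp add: holo_def scale_i_cframe[symmetric])
  also have "\<dots> = isgn I *\<^sub>R cderiv (irot I) P x"
    by (rule linear_scale[OF has_derivative_linear[OF holo_has_derivative[OF assms]]])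
  finally show ?thesis by (simp add: scaleR_conv_of_real)
qed

text \<open>Rotating both directions by i takes a factor i * i = - 1 out of the complex bilinear
  second derivative of \<open>P\<close>.\<close>

lemma Re_holo_pluriharmonic:
  assumes P: "holo P"
  shows "cderiv I (cderiv J (\<lambda>y. Re (P y))) x
    = - (isgn I * isgn J * cderiv (irot I) (cderiv (irot J) (\<lambda>y. Re (P y))) x)"
proof -
  have Re: "dir_deriv v (\<lambda>y. Re (Q y)) = (\<lambda>y. Re (dir_deriv v Q y))" if "holo Q" for v and Q :: "complex^'a \<Rightarrow> complex"
    using holo_has_derivative[OF that]
    by (intro ext dir_deriv_linear_compose[OF bounded_linear_Re]) (auto simp: differentiable_def)
  have R2: "cderiv I (cderiv J (\<lambda>y. Re (P y))) x = Re (cderiv I (cderiv J P) x)" for I J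
    by (simp add: Re P holo_dir_deriv)
  have "(\<lambda>x. complex_of_real (isgn J) * cderiv (irot J) P x) = (\<lambda>x. \<i> * cderiv J P x)"
    by (rule ext) (rule holo_cderiv_irot[OF P])
  moreover have "dir_deriv v (\<lambda>x. c * Q x) x = c * dir_deriv v Q x" if "holo Q" for v c and Q :: "complex^'a \<Rightarrow> complex"
    by (intro dir_deriv_eqI has_derivative_mult_right holo_has_derivative that)
  ultimately have "complex_of_real (isgn J) * cderiv (irot I) (cderiv (irot J) P) x = \<i> * cderiv (irot I) (cderiv J P) x"
    by (metis P holo_dir_deriv)
  then have "complex_of_real (isgn I) * (complex_of_real (isgn J) * cderiv (irot I) (cderiv (irot J) P) x)
      = \<i> * (complex_of_real (isgn I) * cderiv (irot I) (cderiv J P) x)" by simp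
  also have "\<dots> = - cderiv I (cderiv J P) x"
    by (simp add: holo_cderiv_irot[OF holo_dir_deriv[OF P]] mult.assoc[symmetric])
  finally have "Re (complex_of_real (isgn I * isgn J) * cderiv (irot I) (cderiv (irot J) P) x) = - Re (cderiv I (cderiv J P) x)"
    by (simp add: mult.assoc)
  then show ?thesis unfolding R2 by simp
qed

section \<open>Transformation of the Q-curvature\<close>

text \<open>Multiplying z_0 by \<open>l\<close> multiplies the potential |z_0|^2 u by l^2 and adds
  the constant \<open>ln l\<close> to log t, so every Laplacian contributes a factor l^(-2).\<close>

lemma laplacian_iter_ln_scale:
  fixes u :: "complex^'n::finite \<Rightarrow> real" and l :: real
  assumes W: "open W" "smooth_on W u" "\<And>z. z \<in> W \<Longrightarrow> fefferman_J u z \<noteq> 0"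
    and t: "smooth_on (amb_over W) t" "\<And>y. y \<in> amb_over W \<Longrightarrow> 0 < t y"
      "\<And>l z0 z. l \<noteq> 0 \<Longrightarrow> z0 \<noteq> 0 \<Longrightarrow> z \<in> W \<Longrightarrow> t (amb (l * z0) z) = cmod l * t (amb z0 z)"
    and l: "0 < l" and z: "z0 \<noteq> 0" "z \<in> W" and n: "n \<noteq> 0"
  shows "(laplacian (ambient_metric u) ^^ n) (\<lambda>y. ln (t y)) (amb (complex_of_real l * z0) z)
    = (laplacian (ambient_metric u) ^^ n) (\<lambda>y. ln (t y)) (amb z0 z) / l ^ (2 * n)"
proof -
  let ?\<Omega> = "amb_over W"
  define \<delta> where "\<delta> y = amb (complex_of_real l * y $ None) (amb_base y)" for y :: "complex^('n option)"
  have op: "open ?\<Omega>" by (rule open_amb_over[OF W(1)])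
  have sm: "smooth_on ?\<Omega> (ambient_potential u)" by (rule smooth_on_ambient_potential[OF W(1,2)])
  have nd: "det (kahler_gram (ambient_potential u) y) \<noteq> 0" if "y \<in> ?\<Omega>" for y
    using that W(3) by (intro det_ambient_gram_nonzero[OF W(1,2)]) (auto simp: amb_over_eq)
  \<comment> \<open>Since \<open>l\<close> is real, the dilation maps each real frame vector to a
    multiple of itself.\<close>
  define s where "s I = (if fst I = None then l else 1)" for I :: "'n option \<times> bool"
  have \<delta>nth: "\<delta> y $ i = (if i = None then complex_of_real l * y $ None else y $ i)" for y i
    by (cases i) (simp_all add: \<delta>_def amb_base_def)
  have "linear \<delta>"
    by (rule linearI) (simp_all add: vec_eq_iff \<delta>nth algebra_simps)
  then have lin: "bounded_linear \<delta>" by (simp add: linear_conv_bounded_linear)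
  have ln: "ln (t (\<delta> y)) = ln (t y) + ln l" if "y \<in> ?\<Omega>" for y
  proof -
    have "t (\<delta> y) = l * t (amb (y $ None) (amb_base y))"
      using t(3)[of "complex_of_real l" "y $ None" "amb_base y"] that l by (simp add: \<delta>_def amb_over_eq)
    then show ?thesis using t(2)[OF that] l by (simp add: ln_mult)
  qed
  have "(laplacian (kahler_gram (ambient_potential u)) ^^ n) (\<lambda>y. ln (t y)) (\<delta> (amb z0 z))
      = (laplacian (kahler_gram (ambient_potential u)) ^^ n) (\<lambda>y. ln (t y)) (amb z0 z) / (l\<^sup>2) ^ n"
  proof (rule laplacian_iter_scale[OF op sm nd lin, where s = s and \<beta> = "ln l"])
    show "\<delta> y \<in> ?\<Omega>" if "y \<in> ?\<Omega>" for y using that l by (simp add: \<delta>_def amb_over_eq)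
    show "\<delta> (cframe I) = s I *\<^sub>R cframe I" for I
      by (auto simp: vec_eq_iff \<delta>nth s_def cframe_def axis_def scaleR_conv_of_real[where 'a = complex])
    show "smooth_on ?\<Omega> (\<lambda>y. ln (t y))"
      using Ck_on_ln[OF op t(2)] t(1) by (simp add: smooth_on_def)
    show "amb z0 z \<in> ?\<Omega>" using z by (simp add: amb_over_eq)
  qed (use l n ln in \<open>auto simp: s_def irot_def \<delta>_def norm_mult power_mult_distrib\<close>)
  then show ?thesis by (simp add: \<delta>_def ambient_metric_eq power_mult)
qed

text \<open>Transfers the infinite-order agreement of a contact form with its pullback to the
  rescaled form; the factor is bounded near the point.\<close>

lemma flat_at_scaleR:
  assumes "flat_at f a" "open S" "a \<in> S" "continuous_on S h" "\<And>x. x \<in> S \<Longrightarrow> g x = h x *\<^sub>R f x"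
  shows "flat_at g a"
  unfolding flat_at_def
proof
  fix k
  obtain C where C: "\<forall>\<^sub>F x in nhds a. norm (f x) \<le> C * norm (x - a) ^ k"
    using assms(1) unfolding flat_at_def by blast
  have "isCont h a" using assms by (simp add: continuous_on_eq_continuous_at)
  then obtain d where "0 < d" "\<And>x. dist x a < d \<Longrightarrow> dist (h x) (h a) < 1"
    unfolding continuous_at_eps_delta using zero_less_one by blast
  moreover have "norm (h x) < norm (h a) + 1" if "dist (h x) (h a) < 1" for x
    using that by (simp add: dist_real_def)
  ultimately have "\<forall>\<^sub>F x in nhds a. norm (h x) < norm (h a) + 1"
    unfolding eventually_nhds_metric by blast
  moreover have "\<forall>\<^sub>F x in nhds a. x \<in> S"
    using assms by (intro eventually_nhds_in_open)
  ultimately have "\<forall>\<^sub>F x in nhds a. norm (g x) \<le> ((norm (h a) + 1) * C) * norm (x - a) ^ k"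
    using C
  proof eventually_elim
    case (elim x)
    have "norm (g x) = norm (h x) * norm (f x)" using assms(5)[OF elim(2)] by simp
    also have "\<dots> \<le> (norm (h a) + 1) * (C * norm (x - a) ^ k)"
      using elim by (intro mult_mono) auto
    finally show ?case by (simp add: mult.assoc)
  qed
  then show "\<exists>C. \<forall>\<^sub>F x in nhds a. norm (g x) \<le> C * norm (x - a) ^ k" by blast
qed

lemma local_section_subset:
  "local_section V E Z \<Longrightarrow> open U \<Longrightarrow> U \<subseteq> V \<Longrightarrow> local_section U E Z"
  by (auto simp: local_section_def intro: smooth_on_subset)

text \<open>\<open>F\<close> has to parametrize the whole zero set of \<open>u\<close> in the
  ambient open set, so \<open>V\<close> must shrink together with \<open>W\<close>.\<close>

lemma formal_embedding_restrict:
  assumes "formal_embedding E a V W F u" "open W'" "W' \<subseteq> W" "F a \<in> W'"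
  shows "formal_embedding E a {x \<in> V. F x \<in> W'} W' F u"
proof -
  let ?V = "{x \<in> V. F x \<in> W'}"
  have V: "open V" "a \<in> V" "smooth_on V F" and W: "fefferman_defining W u" "F ` V = {z\<in>W. u z = 0}"
    using assms(1) by (auto simp: formal_embedding_def)
  have "open (V \<inter> F -` W')"
    by (rule continuous_open_preimage[OF smooth_on_continuous[OF V(3)] V(1) assms(2)])
  moreover have "V \<inter> F -` W' = ?V" by auto
  ultimately have op: "open ?V" by simp
  have "fefferman_defining W' u"
    using W(1) assms(2,3) smooth_on_subset[of W u W']
    unfolding fefferman_defining_def pseudoconvex_defining_def Let_def by blast
  moreover have "F ` ?V = {z\<in>W'. u z = 0}"
  proof (intro equalityI subsetI)
    fix z assume "z \<in> F ` ?V"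
    then have "z \<in> F ` V" "z \<in> W'" by auto
    then show "z \<in> {z\<in>W'. u z = 0}" unfolding W(2) by simp
  next
    fix z assume z: "z \<in> {z\<in>W'. u z = 0}"
    then have "z \<in> F ` V" unfolding W(2) using assms(3) by auto
    then show "z \<in> F ` ?V" using z by auto
  qed
  moreover have "flat_at (\<lambda>x. cvec_deriv (cnj_vec (Z x)) (\<lambda>y. F y $ j) x) a"
    if "a \<in> V'" "V' \<subseteq> ?V" "local_section V' E Z" for V' Z j
  proof -
    have "V' \<subseteq> V" using that(2) by blast
    then show ?thesis using assms(1) that(1,3) unfolding formal_embedding_def by blast
  qed
  moreover have "a \<in> ?V" "smooth_on ?V F"
    using V(2) assms(4) by simp (rule smooth_on_subset[OF V(3)], blast)
  moreover have "inj_on F ?V" "\<forall>x\<in>?V. inj (frechet_derivative F (at x))"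
    using assms(1) inj_on_subset[of F V ?V] unfolding formal_embedding_def by blast+
  ultimately show ?thesis
    unfolding formal_embedding_def using op by (intro conjI allI impI) (assumption | blast)+
qed

text \<open>\<open>R\<close> equals \<open>Re f\<close> exactly on a neighbourhood in the
  hypersurface and is close to \<open>Re P\<close> at the point: the first is for the contact form,
  which is compared to infinite order, the second for the Laplacian.\<close>

lemma pluriharmonic_extension:
  fixes F :: "real^'d::finite \<Rightarrow> complex^'n::finite" and u :: "complex^'n \<Rightarrow> real"
  assumes emb: "formal_embedding E a V W F u"
    and card: "CARD('d) = 2 * CARD('n) - 1"
    and V0: "open V0" "a \<in> V0" and f: "smooth_on V0 f"
    and cr: "\<And>x v. x \<in> V0 \<Longrightarrow> v \<in> E x \<Longrightarrow> cvec_deriv (cnj_vec v) f x = 0"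
    and Z: "\<And>i. i < CARD('n) - 1 \<Longrightarrow> local_section V0 E (Z i)"
    and dim: "vec.dim ((\<lambda>i. Z i a) ` {..<CARD('n) - 1}) = CARD('n) - 1"
  obtains W' R P S where "open W'" "W' \<subseteq> W" "F a \<in> W'" "smooth_on W' R"
    "open S" "a \<in> S" "S \<subseteq> V \<inter> V0" "F ` S \<subseteq> W'" "\<And>x. x \<in> S \<Longrightarrow> R (F x) = Re (f x)"
    "holo P" "vanish m (\<lambda>z. R z - Re (P z)) (F a)"
proof -
  have V: "open V" "a \<in> V" "smooth_on V F" and W: "open W" "F ` V \<subseteq> W"
    and injD: "inj (frechet_derivative F (at a))"
    and flat: "\<And>V' Z j. a \<in> V' \<Longrightarrow> V' \<subseteq> V \<Longrightarrow> local_section V' E Z \<Longrightarrow>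
        flat_at (\<lambda>x. cvec_deriv (cnj_vec (Z x)) (\<lambda>y. F y $ j) x) a"
    using emb by (auto simp: formal_embedding_def fefferman_defining_def pseudoconvex_defining_def)
  define U where "U = V \<inter> V0"
  have U: "open U" "a \<in> U" "U \<subseteq> V" "U \<subseteq> V0" using V V0 by (auto simp: U_def)
  have smF: "smooth_on U F" and smf: "smooth_on U f"
    using V f U smooth_on_subset by blast+
  have smj: "smooth_on U (\<lambda>y. F y $ j)" for j by (rule smooth_on_nth[OF U(1) smF])
  define I where "I = {..<CARD('n) - 1}"
  define Y where "Y i x = cnj_vec (Z i x)" for i x
  have secU: "local_section U E (Z i)" if "i \<in> I" for i
    using local_section_subset[OF Z U(1,4)] that by (simp add: I_def)
  have smZ: "smooth_on U (Z i)" if "i \<in> I" for i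
    using secU[OF that] by (simp add: local_section_def)
  have bl: "bounded_linear cnj_vec"
    unfolding linear_conv_bounded_linear[symmetric]
    by (rule linearI) (simp_all add: cnj_vec_def vec_eq_iff)
  have smY: "smooth_on U (Y i)" if "i \<in> I" for i
    unfolding Y_def by (rule smooth_on_linear_compose[OF U(1) bl smZ[OF that]])
  have crF: "vanish k (\<lambda>x. cvec_deriv (Y i x) (\<lambda>y. F y $ j) x) a" if "i \<in> I" for i j k
    using flat[OF U(2,3) secU[OF that], of j] unfolding Y_def[symmetric]
    by (intro vanish_flat_at[OF U(1,2)] smooth_on_cvec_deriv U(1) smj smY that)
  have crf: "vanish k (\<lambda>x. cvec_deriv (Y i x) f x) a" if "i \<in> I" for i k
  proof (rule vanish_cong[OF U(1,2) _ vanish_const0])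
    show "0 = cvec_deriv (Y i x) f x" if "x \<in> U" for x
      using cr[of x "Z i x"] secU[OF \<open>i \<in> I\<close>] that U by (auto simp: Y_def local_section_def)
  qed
  define D where "D v = dir_deriv v F a" for v
  have diff: "F differentiable (at a)" by (rule smooth_on_differentiable[OF smF U(1,2)])
  have D: "linear D" "inj D"
    using linear_dir_deriv[OF diff] injD by (simp_all add: D_def[abs_def] dir_deriv_def)
  have Dj: "cvec_deriv \<zeta> (\<lambda>y. F y $ j) a = (\<Sum>l\<in>UNIV. \<zeta> $ l * D (axis l 1) $ j)" for \<zeta> j
    by (simp add: cvec_deriv_def D_def dir_deriv_linear_compose[OF bounded_linear_vec_nth diff])
  have "\<exists>X :: 'n \<Rightarrow> complex^'d. (\<forall>k j. (\<Sum>l\<in>UNIV. X k $ l * D (axis l 1) $ j) = (if j = k then 1 else 0))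
    \<and> vec.span (range X \<union> (\<lambda>i. Y i a) ` I) = UNIV"
  proof (rule complex_dual_frame[OF D card])
    show "(\<Sum>l\<in>UNIV. \<zeta> $ l * D (axis l 1) $ j) = 0" if "\<zeta> \<in> (\<lambda>i. Y i a) ` I" for \<zeta> j
      using that crF[of _ "Suc 0"] unfolding Dj[symmetric] by auto
    have "(\<lambda>i. Y i a) ` I = cnj_vec ` (\<lambda>i. Z i a) ` I" by (auto simp: Y_def)
    then show "CARD('n) - 1 \<le> vec.dim ((\<lambda>i. Y i a) ` I)"
      using dim_cnj_vec_le[of "(\<lambda>i. Z i a) ` I"] dim by (simp add: I_def)
  qed
  then obtain X :: "'n \<Rightarrow> complex^'d" where
    X: "\<And>k j. cvec_deriv (X k) (\<lambda>y. F y $ j) a = (if j = k then 1 else 0)"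
      "vec.span (range X \<union> (\<lambda>i. Y i a) ` I) = UNIV" unfolding Dj by blast
  obtain P where P: "holo P" "vanish m (\<lambda>x. f x - P (F x)) a"
    using formal_holomorphic_extension[OF U(1,2) smF smf smY crF crf X] by blast
  define \<rho> where "\<rho> x = Re (f x - P (F x))" for x
  have smfP: "smooth_on U (\<lambda>x. f x - P (F x))"
    by (intro smooth_on_diff U(1) smf, rule smooth_on_compose[OF U(1) open_UNIV _ smF holo_smooth[OF P(1)]]) simp
  have sm\<rho>: "smooth_on U \<rho>"
    unfolding \<rho>_def by (rule smooth_on_linear_compose[OF U(1) bounded_linear_Re smfP])
  have v\<rho>: "vanish m \<rho> a"
    unfolding \<rho>_def[abs_def] by (rule vanish_linear_compose[OF U(1,2) bounded_linear_Re smfP P(2)])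
  \<comment> \<open>A linear left inverse of the differential at \<open>a\<close>. It gives \<kappa>
    the identity derivative there, as \<open>smooth_local_inverse\<close> demands.\<close>
  obtain L where L: "linear L" "\<And>v. L (D v) = v"
    using linear_injective_left_inverse[OF D] by (auto simp: fun_eq_iff)
  have blL: "bounded_linear L" using L(1) by (simp add: linear_conv_bounded_linear)
  define \<kappa> where "\<kappa> x = L (F x - F a)" for x
  have smFa: "smooth_on U (\<lambda>x. F x - F a)"
    by (intro smooth_on_diff U(1) smF smooth_on_const)
  have sm\<kappa>: "smooth_on U \<kappa>"
    unfolding \<kappa>_def by (rule smooth_on_linear_compose[OF U(1) blL smFa])
  have "dir_deriv v \<kappa> a = v" for v
  proof -
    have "((\<lambda>x. F x - F a) has_derivative (\<lambda>v. D v)) (at a)"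
      using has_derivative_diff[OF has_derivative_dir_deriv[OF diff] has_derivative_const] by (simp add: D_def)
    then have "dir_deriv v \<kappa> a = L (D v)"
      unfolding \<kappa>_def by (intro dir_deriv_eqI bounded_linear.has_derivative[OF blL])
    then show ?thesis by (simp add: L)
  qed
  then obtain S g where S: "open S" "a \<in> S" "S \<subseteq> U" "open (\<kappa> ` S)" "smooth_on (\<kappa> ` S) g"
    "\<And>x. x \<in> S \<Longrightarrow> g (\<kappa> x) = x"
    using smooth_local_inverse[OF U(1,2) sm\<kappa>] by blast
  define W' where "W' = {z \<in> W. L (z - F a) \<in> \<kappa> ` S}"
  have smL: "smooth_on T (\<lambda>z. L (z - F a))" if "open T" for T
    by (rule smooth_on_linear_compose[OF that blL]) (intro smooth_on_diff smooth_on_ident smooth_on_const that)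
  have "open (W \<inter> (\<lambda>z. L (z - F a)) -` (\<kappa> ` S))"
    by (rule continuous_open_preimage[OF smooth_on_continuous[OF smL[OF W(1)]] W(1) S(4)])
  moreover have "W \<inter> (\<lambda>z. L (z - F a)) -` (\<kappa> ` S) = W'" by (auto simp: W'_def)
  ultimately have W': "open W'" "W' \<subseteq> W" by (auto simp: W'_def)
  have FS: "F ` S \<subseteq> W'" using S(3) U(3) W(2) by (auto simp: W'_def \<kappa>_def)
  then have FaW': "F a \<in> W'" using S(2) by blast
  \<comment> \<open>The map sending \<open>z\<close> to \<open>g (L (z - F a))\<close> retracts
    \<open>W'\<close> onto the parameters \<open>S\<close>. Along its fibres the correction \<rho>
    is constant, so on the hypersurface it restores \<open>Re f\<close>, and composition preserves
    its order of vanishing.\<close>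
  define R where "R z = Re (P z) + \<rho> (g (L (z - F a)))" for z
  have smg\<rho>: "smooth_on (\<kappa> ` S) (\<lambda>w. \<rho> (g w))"
    using S by (intro smooth_on_compose[OF S(4,1) _ S(5) smooth_on_subset[OF sm\<rho> S(3)]]) auto
  have sm2: "smooth_on W' (\<lambda>z. \<rho> (g (L (z - F a))))"
    by (rule smooth_on_compose[OF W'(1) S(4) _ smL[OF W'(1)] smg\<rho>]) (auto simp: W'_def)
  have smR: "smooth_on W' R"
    unfolding R_def
    by (intro smooth_on_add W'(1) sm2 smooth_on_linear_compose[OF W'(1) bounded_linear_Re]
        smooth_on_subset[OF holo_smooth[OF P(1)]]) simp
  have \<kappa>a: "\<kappa> a = 0" by (simp add: \<kappa>_def linear_0[OF L(1)])
  have "vanish m (\<lambda>w. \<rho> (g w)) (\<kappa> a)"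
    using S v\<rho> by (intro vanish_compose[OF S(4) _ S(1) _ S(5) smooth_on_subset[OF sm\<rho> S(3)]]) auto
  then have "vanish m (\<lambda>z. \<rho> (g (L (z - F a)))) (F a)"
    using \<kappa>a linear_0[OF L(1)]
    by (intro vanish_compose[OF W'(1) FaW' S(4) _ smL[OF W'(1)] smg\<rho>]) (auto simp: W'_def)
  then have vR: "vanish m (\<lambda>z. R z - Re (P z)) (F a)" by (simp add: R_def)
  have "R (F x) = Re (f x)" if "x \<in> S" for x
    using S(6)[OF that] by (simp add: R_def \<rho>_def \<kappa>_def)
  then show thesis
    using that[OF W' FaW' smR S(1,2) _ FS _ P(1) vR] S(3) by (simp add: U_def)
qed

lemma laplacian_iter_rescaled:
  fixes u :: "complex^'n::finite \<Rightarrow> real" and R :: "complex^'n \<Rightarrow> real"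
  assumes W: "open W" "smooth_on W u" and J: "b \<in> W" "fefferman_J u b \<noteq> 0"
    and t: "smooth_on (amb_over W) t" "\<And>y. y \<in> amb_over W \<Longrightarrow> 0 < t y"
      "\<And>l z0 z. l \<noteq> 0 \<Longrightarrow> z0 \<noteq> 0 \<Longrightarrow> z \<in> W \<Longrightarrow> t (amb (l * z0) z) = cmod l * t (amb z0 z)"
    and R: "smooth_on W R" "holo P" "vanish (2 * n + 1) (\<lambda>z. R z - Re (P z)) b"
    and l: "0 < l" and z0: "z0 \<noteq> 0" and n: "n \<noteq> 0"
  shows "(laplacian (ambient_metric u) ^^ n) (\<lambda>y. ln (t y * exp (- R (amb_base y)))) (amb (complex_of_real l * z0) b)
    = (laplacian (ambient_metric u) ^^ n) (\<lambda>y. ln (t y)) (amb z0 b) / l ^ (2 * n)"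
proof -
  \<comment> \<open>Nondegeneracy is given at \<open>b\<close> only and spreads to an open set by
    continuity. The iterated Laplacian is local, so its value over \<open>b\<close> can be computed
    over \<open>W0\<close>.\<close>
  define W0 where "W0 = {z \<in> W. fefferman_J u z \<noteq> 0}"
  have "open (W \<inter> fefferman_J u -` (- {0}))"
    by (rule continuous_open_preimage[OF smooth_on_continuous[OF smooth_on_fefferman_J[OF W]] W(1) open_Compl[OF closed_singleton]])
  moreover have "W \<inter> fefferman_J u -` (- {0}) = W0" by (auto simp: W0_def)
  ultimately have W0: "open W0" "W0 \<subseteq> W" "b \<in> W0" using J by (auto simp: W0_def)
  let ?\<Omega> = "amb_over W0" and ?L = "laplacian (kahler_gram (ambient_potential u)) ^^ n"
  have sub: "?\<Omega> \<subseteq> amb_over W" using W0 by (auto simp: amb_over_eq)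
  have op: "open ?\<Omega>" by (rule open_amb_over[OF W0(1)])
  have smu: "smooth_on W0 u" using W(2) W0(2) by (rule smooth_on_subset)
  have sm: "smooth_on ?\<Omega> (ambient_potential u)" by (rule smooth_on_ambient_potential[OF W0(1) smu])
  have nd: "det (kahler_gram (ambient_potential u) y) \<noteq> 0" if "y \<in> ?\<Omega>" for y
    using that by (intro det_ambient_gram_nonzero[OF W0(1) smu]) (auto simp: amb_over_eq W0_def)
  define y' where "y' = amb (complex_of_real l * z0) b"
  have y': "y' \<in> ?\<Omega>" using z0 l W0 by (simp add: y'_def amb_over_eq)
  have t0: "smooth_on ?\<Omega> t" "\<And>y. y \<in> ?\<Omega> \<Longrightarrow> 0 < t y"
    using smooth_on_subset[OF t(1) sub] t(2) sub by auto
  have smln: "smooth_on ?\<Omega> (\<lambda>y. ln (t y))"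
    using Ck_on_ln[OF op t0(2)] t0(1) by (simp add: smooth_on_def)
  define R1 where "R1 y = Re (P (amb_base y))" for y :: "complex^('n option)"
  define R2 where "R2 y = R (amb_base y) - R1 y" for y
  have holoP: "holo (\<lambda>y::complex^('n option). P (amb_base y))"
    by (rule holo_linear_compose[OF bounded_linear_amb_base _ R(2)]) (simp add: amb_base_def vec_eq_iff)
  have smP: "smooth_on W0 (\<lambda>z. Re (P z))"
    by (rule smooth_on_linear_compose[OF W0(1) bounded_linear_Re smooth_on_subset[OF holo_smooth[OF R(2)]]]) simp
  have smR: "smooth_on W0 R" using R(1) W0(2) by (rule smooth_on_subset)
  have smd: "smooth_on W0 (\<lambda>z. R z - Re (P z))" by (intro smooth_on_diff W0(1) smR smP)
  have smR1: "smooth_on ?\<Omega> R1" and smR2: "smooth_on ?\<Omega> R2"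
    unfolding R1_def R2_def by (rule smooth_on_amb_base[OF W0(1) smP], rule smooth_on_amb_base[OF W0(1) smd])
  have "?L (\<lambda>y. ln (t y * exp (- R (amb_base y)))) y' = ?L (\<lambda>y. (ln (t y) - R1 y) - R2 y) y'"
  proof (rule laplacian_iter_cong[OF op sm nd _ y'])
    show "ln (t y * exp (- R (amb_base y))) = (ln (t y) - R1 y) - R2 y" if "y \<in> ?\<Omega>" for y
      using t0(2)[OF that] by (simp add: ln_mult R2_def)
  qed
  also have "\<dots> = ?L (\<lambda>y. ln (t y) - R1 y) y' - ?L R2 y'"
    by (rule laplacian_iter_diff[OF op sm nd smooth_on_diff[OF op smln smR1] smR2 y'])
  also have "?L (\<lambda>y. ln (t y) - R1 y) y' = ?L (\<lambda>y. ln (t y)) y' - ?L R1 y'"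
    by (rule laplacian_iter_diff[OF op sm nd smln smR1 y'])
  also have "?L R1 y' = 0"
    unfolding R1_def[abs_def]
    by (rule laplacian_iter_pluriharmonic[OF op sm nd Re_holo_pluriharmonic[OF holoP] y' n])
  also have "?L R2 y' = 0"
  proof -
    \<comment> \<open>The \<open>n\<close> Laplacians use up order 2 n; the remaining order one is
      the value 0.\<close>
    have "vanish (2 * n + 1) R2 y'"
      unfolding R2_def R1_def
      using R(3)
      by (intro vanish_compose[OF op y' W0(1) _ smooth_on_linear[OF op bounded_linear_amb_base] smd])
        (auto simp: amb_over_eq y'_def simp del: vanish.simps)
    from laplacian_iter_vanish[OF op sm nd smR2 y' this] show ?thesis by simp
  qed
  also have "?L (\<lambda>y. ln (t y)) y' = ?L (\<lambda>y. ln (t y)) (amb z0 b) / l ^ (2 * n)"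
  proof -
    have "t (amb (k * z0) z) = cmod k * t (amb z0 z)" if "k \<noteq> 0" "z0 \<noteq> 0" "z \<in> W0" for k z0 z
      using that t(3) W0(2) by blast
    then show ?thesis
      using laplacian_iter_ln_scale[OF W0(1) smu _ t0 _ l z0 W0(3) n]
      unfolding y'_def by (simp add: ambient_metric_eq W0_def)
  qed
  finally show ?thesis by (simp add: y'_def ambient_metric_eq)
qed

section \<open>From charts to the abstract manifold\<close>

lemma chart_image_Int:
  assumes "smooth_atlas A" "c \<in> A" "open U"
  shows "snd c ` (fst c \<inter> U) = chart_img c \<inter> chart_inv c -` U" "open (snd c ` (fst c \<inter> U))"
proof -
  have homeo: "homeomorphism (fst c) (chart_img c) (snd c) (chart_inv c)" and op: "open (chart_img c)"
    using assms(1,2) by (auto simp: smooth_atlas_def)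
  have inv: "chart_inv c (snd c q) = q" if "q \<in> fst c" for q
    using homeo that by (simp add: homeomorphism_def)
  show eq: "snd c ` (fst c \<inter> U) = chart_img c \<inter> chart_inv c -` U"
  proof (intro equalityI subsetI)
    fix x assume "x \<in> chart_img c \<inter> chart_inv c -` U"
    then obtain q where "q \<in> fst c" "x = snd c q" "chart_inv c x \<in> U" by (auto simp: chart_img_def)
    then show "x \<in> snd c ` (fst c \<inter> U)" using inv by auto
  next
    fix x assume "x \<in> snd c ` (fst c \<inter> U)"
    then obtain q where "q \<in> fst c" "q \<in> U" "x = snd c q" by blast
    then show "x \<in> chart_img c \<inter> chart_inv c -` U" using inv by (auto simp: chart_img_def)
  qed
  have "continuous_on (chart_img c) (chart_inv c)" using homeo by (simp add: homeomorphism_def)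
  then show "open (snd c ` (fst c \<inter> U))"
    unfolding eq by (rule continuous_open_preimage[OF _ op assms(3)])
qed

text \<open>Over smaller \<open>V\<close> and \<open>W\<close> only the scale changes: \<open>log t\<close> is replaced by \<open>log t - R\<close>.\<close>

lemma cr_Q_values_rescale:
  fixes A :: "('m::{t2_space,second_countable_topology}, 'd::finite) chart set"
    and \<Upsilon> :: "'m \<Rightarrow> real"
  assumes cr: "cr_manifold CARD('n::finite) A T"
    and ph: "cr_pluriharmonic A T \<Upsilon>"
    and \<theta>': "\<And>c x. c \<in> A \<Longrightarrow> x \<in> chart_img c \<Longrightarrow> \<theta>' c x = exp (2 * \<Upsilon> (chart_inv c x)) *\<^sub>R \<theta> c x"
    and q: "q \<in> cr_Q_values TYPE('n) A T \<theta> p"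
  shows "exp (- (2 * real CARD('n) * \<Upsilon> p)) * q \<in> cr_Q_values TYPE('n) A T \<theta>' p"
proof -
  obtain c V W F and u :: "complex^'n \<Rightarrow> real" and ups t z0 where
    c: "c \<in> A" "p \<in> fst c" "V \<subseteq> chart_img c" and
    emb: "formal_embedding (T c) (snd c p) V W F u" and
    ups: "smooth_on V ups" "flat_at (\<lambda>x. \<theta> c x - pulled_back_form F u ups x) (snd c p)" and
    t: "scale_extension V W F ups t" "z0 \<noteq> 0" "t (amb z0 (F (snd c p))) = 1" and
    qeq: "q = - (laplacian (ambient_metric u) ^^ CARD('n)) (\<lambda>y. ln (t y)) (amb z0 (F (snd c p)))"
    using q unfolding cr_Q_values_def mem_Collect_eq by (elim bexE exE conjE) (rule that)
  define a where "a = snd c p"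
  note emb = emb[folded a_def] and ups = ups[folded a_def] and t = t[folded a_def] and qeq = qeq[folded a_def]
  have V: "open V" "a \<in> V" "smooth_on V F" and W: "open W" "smooth_on W u"
    and FV: "F ` V = {z\<in>W. u z = 0}"
    and J: "\<exists>C. \<forall>z\<in>W. cmod (fefferman_J u z - 1) \<le> C * \<bar>u z\<bar> ^ (CARD('n) + 1)"
    using emb by (auto simp: formal_embedding_def fefferman_defining_def pseudoconvex_defining_def)
  have ac: "a \<in> chart_img c" using V c by blast
  have card: "CARD('d) = 2 * CARD('n) - 1" and at: "smooth_atlas A"
    using cr by (simp_all add: cr_manifold_def)
  have homeo: "homeomorphism (fst c) (chart_img c) (snd c) (chart_inv c)"
    using at c(1) by (auto simp: smooth_atlas_def)
  have inv: "chart_inv c a = p"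
    using homeo c(2) by (simp add: a_def homeomorphism_def)
  obtain O' f where O': "open O'" "p \<in> O'" and f: "cr_function_on A T O' f" "\<And>q. q \<in> O' \<Longrightarrow> \<Upsilon> q = Re (f q)"
  proof -
    have "p \<in> carrier_of A" using c(1,2) by (auto simp: carrier_of_def)
    from ph[unfolded cr_pluriharmonic_def, rule_format, OF this] show thesis
      using that by blast
  qed
  define fh where "fh = f \<circ> chart_inv c"
  define V1 where "V1 = snd c ` (fst c \<inter> O')"
  have V1eq: "V1 = chart_img c \<inter> chart_inv c -` O'" and V1: "open V1"
    unfolding V1_def using chart_image_Int[OF at c(1) O'(1)] by blast+
  have aV1: "a \<in> V1" using c(2) O'(2) by (auto simp: V1_def a_def)
  have fh: "smooth_on V1 fh" "\<And>x v. x \<in> V1 \<Longrightarrow> v \<in> T c x \<Longrightarrow> cvec_deriv (cnj_vec v) fh x = 0"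
    using f(1) c(1) unfolding cr_function_on_def V1_def fh_def by blast+
  have \<Upsilon>: "\<Upsilon> (chart_inv c x) = Re (fh x)" if "x \<in> V1" for x
    using f(2) that by (simp add: fh_def V1eq)
  have "vec.dim (T c a) = CARD('n) - 1 \<and> (\<exists>V Z. a \<in> V \<and> V \<subseteq> chart_img c \<and>
           (\<forall>i<CARD('n) - 1. local_section V (T c) (Z i)) \<and> open V \<and>
           (\<forall>y\<in>V. T c y = vec.span ((\<lambda>i. Z i y) ` {..<CARD('n) - 1})))"
    using bspec[OF bspec[OF cr[unfolded cr_manifold_def, THEN conjunct2, THEN conjunct2, THEN conjunct1] c(1)] ac]
    by blast
  then obtain V2 Z where V2: "a \<in> V2" "open V2" and
    Z: "\<And>i. i < CARD('n) - 1 \<Longrightarrow> local_section V2 (T c) (Z i)"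
      "T c a = vec.span ((\<lambda>i. Z i a) ` {..<CARD('n) - 1})" "vec.dim (T c a) = CARD('n) - 1"
    by blast
  define V0 where "V0 = V1 \<inter> V2"
  have V0: "open V0" "a \<in> V0" "V0 \<subseteq> V1" "V0 \<subseteq> V2" using V1 aV1 V2 by (auto simp: V0_def)
  have dim: "vec.dim ((\<lambda>i. Z i a) ` {..<CARD('n) - 1}) = CARD('n) - 1"
    using Z(2,3) by (metis vec.dim_span)
  obtain W' R P S where
    W': "open W'" "W' \<subseteq> W" "F a \<in> W'" "smooth_on W' R" and
    S: "open S" "a \<in> S" "S \<subseteq> V \<inter> V0" "F ` S \<subseteq> W'" "\<And>x. x \<in> S \<Longrightarrow> R (F x) = Re (fh x)" and
    P: "holo P" "vanish (2 * CARD('n) + 1) (\<lambda>z. R z - Re (P z)) (F a)"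
  proof (rule pluriharmonic_extension[where Z = Z, OF emb card V0(1,2) smooth_on_subset[OF fh(1) V0(3)] _ _ dim])
    show "cvec_deriv (cnj_vec v) fh x = 0" if "x \<in> V0" "v \<in> T c x" for x v
      using fh(2) V0(3) that by blast
    show "local_section V0 (T c) (Z i)" if "i < CARD('n) - 1" for i
      by (rule local_section_subset[OF Z(1)[OF that] V0(1,4)])
  qed blast
  define V' where "V' = {x \<in> V. F x \<in> W'}"
  have emb': "formal_embedding (T c) a V' W' F u"
    unfolding V'_def by (rule formal_embedding_restrict[OF emb W'(1-3)])
  have V': "open V'" "V' \<subseteq> V" using emb' by (auto simp: formal_embedding_def V'_def)
  have Rb: "R (F a) = \<Upsilon> p"
    using S(5)[OF S(2)] \<Upsilon>[OF aV1] inv by simp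
  \<comment> \<open>The condition on the new scale is imposed on all of \<open>V'\<close>, so the
    exponent is defined there through \<open>R\<close>. It agrees with \<open>ups\<close> plus
    \<Upsilon> on \<open>S\<close>, which suffices for flatness at \<open>a\<close>.\<close>
  define ups' where "ups' x = ups x + R (F x)" for x
  define t' where "t' y = t y * exp (- R (amb_base y))" for y
  \<comment> \<open>Multiplying z_0 by this \<open>l\<close> compensates the factor e^(- R) in
    \<open>t'\<close> at the base point and returns to the level set where the scale is 1.\<close>
  define l where "l = exp (\<Upsilon> p)"
  have smF': "smooth_on V' F" using V(3) V'(2) by (rule smooth_on_subset)
  have ups': "smooth_on V' ups'"
    unfolding ups'_def using W'(4) W'(1)
    by (intro smooth_on_add V'(1) smooth_on_subset[OF ups(1) V'(2)] smooth_on_compose[OF V'(1) W'(1) _ smF' W'(4)])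
      (auto simp: V'_def)
  have flat': "flat_at (\<lambda>x. \<theta>' c x - pulled_back_form F u ups' x) a"
  proof (rule flat_at_scaleR[OF ups(2) S(1,2)])
    have "smooth_on S fh" using smooth_on_subset[OF fh(1)] S(3) V0(3) by blast
    then show "continuous_on S (\<lambda>x. exp (2 * Re (fh x)))"
      by (intro continuous_intros smooth_on_continuous)
    fix x assume x: "x \<in> S"
    then have "x \<in> V1" "x \<in> chart_img c" using S(3) V0(3) V1eq by auto
    then show "\<theta>' c x - pulled_back_form F u ups' x = exp (2 * Re (fh x)) *\<^sub>R (\<theta> c x - pulled_back_form F u ups x)"
      using S(5)[OF x] \<Upsilon> \<theta>'[OF c(1)]
      by (simp add: vec_eq_iff pulled_back_form_def ups'_def exp_add algebra_simps)
  qed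
  have sub: "amb_over W' \<subseteq> amb_over W" using W'(2) by (auto simp: amb_over_eq)
  have tt: "smooth_on (amb_over W) t" "\<And>y. y \<in> amb_over W \<Longrightarrow> 0 < t y"
      "\<And>l z0 z. l \<noteq> 0 \<Longrightarrow> z0 \<noteq> 0 \<Longrightarrow> z \<in> W \<Longrightarrow> t (amb (l * z0) z) = cmod l * t (amb z0 z)"
      "\<And>x z0. x \<in> V \<Longrightarrow> z0 \<noteq> 0 \<Longrightarrow> t (amb z0 (F x)) = exp (- ups x) * cmod z0"
    using t(1) unfolding scale_extension_def by blast+
  have t': "scale_extension V' W' F ups' t'"
    unfolding scale_extension_def
  proof (intro conjI ballI allI impI)
    have op: "open (amb_over W')" by (rule open_amb_over[OF W'(1)])
    have "smooth_on (amb_over W') (\<lambda>y. exp (- R (amb_base y)))"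
      using Ck_on_exp[OF op] smooth_on_minus[OF op smooth_on_amb_base[OF W'(1,4)]]
      by (simp add: smooth_on_def)
    then show "smooth_on (amb_over W') t'"
      unfolding t'_def by (intro smooth_on_mult op smooth_on_subset[OF tt(1) sub])
    show "0 < t' x" if "x \<in> amb_over W'" for x
      using tt(2) sub that by (auto simp: t'_def)
    show "t' (amb (l * z0) z) = cmod l * t' (amb z0 z)" if "l \<noteq> 0 \<and> z0 \<noteq> 0 \<and> z \<in> W'" for l z0 z
      using tt(3)[of l z0 z] that W'(2) by (auto simp: t'_def)
    show "t' (amb z0 (F x)) = exp (- ups' x) * cmod z0" if "x \<in> V'" "z0 \<noteq> 0" for x z0
      using tt(4)[of x z0] that V'(2) by (auto simp: t'_def ups'_def exp_add[symmetric])
  qed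
  have FaW: "F a \<in> W" "u (F a) = 0" using FV V(2) by blast+
  have l: "0 < l" by (simp add: l_def)
  have t1: "t' (amb (complex_of_real l * z0) (F a)) = 1"
    using tt(3)[of "complex_of_real l" z0 "F a"] t(2,3) FaW l
    by (simp add: t'_def Rb l_def exp_minus)
  \<comment> \<open>The error bound carries a positive power of \<open>u\<close>, which is zero at
    \<open>F a\<close>.\<close>
  have "fefferman_J u (F a) = 1" using J FaW by force
  then have "(laplacian (ambient_metric u) ^^ CARD('n)) (\<lambda>y. ln (t' y)) (amb (complex_of_real l * z0) (F a))
      = (laplacian (ambient_metric u) ^^ CARD('n)) (\<lambda>y. ln (t y)) (amb z0 (F a)) / l ^ (2 * CARD('n))"
    unfolding t'_def using W'(2) sub tt
    by (intro laplacian_iter_rescaled[OF W'(1) smooth_on_subset[OF W(2) W'(2)] W'(3) _ _ _ _ W'(4) P l t(2)]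
        smooth_on_subset[OF tt(1) sub]) auto
  moreover have "l ^ (2 * CARD('n)) = exp (2 * real CARD('n) * \<Upsilon> p)"
    unfolding l_def exp_of_nat_mult[symmetric] by simp
  ultimately have q': "exp (- (2 * real CARD('n) * \<Upsilon> p)) * q
      = - (laplacian (ambient_metric u) ^^ CARD('n)) (\<lambda>y. ln (t' y)) (amb (complex_of_real l * z0) (F a))"
    unfolding qeq by (simp add: exp_minus divide_inverse)
  have "complex_of_real l * z0 \<noteq> 0" using l t(2) by simp
  then show ?thesis
    unfolding cr_Q_values_def mem_Collect_eq
    using c(1,2) subset_trans[OF V'(2) c(3)] emb'[unfolded a_def] ups' flat'[unfolded a_def] t'
      t1[unfolded a_def] q'[unfolded a_def]
    by (intro bexI[OF _ c(1)] exI[of _ V'] exI[of _ W'] exI[of _ F] exI[of _ u] exI[of _ ups'] exI[of _ t']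
        exI[of _ "complex_of_real l * z0"] conjI)
qed

text \<open>The original contact form arises from the rescaled one with the opposite exponent, so
  the rescaling lemma can be applied in both directions.\<close>

lemma cr_pluriharmonic_minus:
  assumes "cr_pluriharmonic A T \<Upsilon>" "smooth_atlas A"
  shows "cr_pluriharmonic A T (\<lambda>q. - \<Upsilon> q)"
  unfolding cr_pluriharmonic_def
proof
  fix p assume "p \<in> carrier_of A"
  then obtain O' f where O': "open O'" "p \<in> O'" "O' \<subseteq> carrier_of A" and
    f: "cr_function_on A T O' f" "\<forall>q\<in>O'. \<Upsilon> q = Re (f q)"
    using assms(1) unfolding cr_pluriharmonic_def by blast
  have "cr_function_on A T O' (\<lambda>q. - f q)"
    unfolding cr_function_on_def
  proof (intro ballI conjI)
    fix c assume c: "c \<in> A"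
    let ?V = "snd c ` (fst c \<inter> O')" and ?f = "f \<circ> chart_inv c"
    have op: "open ?V" by (rule chart_image_Int(2)[OF assms(2) c O'(1)])
    have sm: "smooth_on ?V ?f" and cr: "\<forall>x\<in>?V. \<forall>v\<in>T c x. cvec_deriv (cnj_vec v) ?f x = 0"
      using f(1) c unfolding cr_function_on_def by blast+
    have eq: "(\<lambda>q. - f q) \<circ> chart_inv c = (\<lambda>x. - ?f x)" by (simp add: fun_eq_iff)
    show "smooth_on ?V ((\<lambda>q. - f q) \<circ> chart_inv c)"
      unfolding eq by (rule smooth_on_minus[OF op sm])
    fix x v assume x: "x \<in> ?V" and v: "v \<in> T c x"
    have "dir_deriv w (\<lambda>x. - ?f x) x = - dir_deriv w ?f x" for w
      by (rule dir_deriv_eqI) (rule has_derivative_minus[OF smooth_on_has_derivative[OF sm op x]])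
    then have "cvec_deriv (cnj_vec v) (\<lambda>x. - ?f x) x = - cvec_deriv (cnj_vec v) ?f x"
      by (simp only: cvec_deriv_def mult_minus_right sum_negf)
    then show "cvec_deriv (cnj_vec v) ((\<lambda>q. - f q) \<circ> chart_inv c) x = 0"
      unfolding eq using cr x v by (simp only: neg_equal_0_iff_equal)
  qed
  then show "\<exists>O' f. open O' \<and> p \<in> O' \<and> O' \<subseteq> carrier_of A \<and>
        cr_function_on A T O' f \<and> (\<forall>q\<in>O'. - \<Upsilon> q = Re (f q))"
    using O' f(2) by (intro exI[of _ O'] exI[of _ "\<lambda>q. - f q"]) auto
qed

theorem mainTheorem5:
  fixes A :: "('m::{t2_space,second_countable_topology}, 'd::finite) chart set"
    and T :: "('m, 'd) chart \<Rightarrow> real^'d \<Rightarrow> (complex^'d) set"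
    and \<theta> \<theta>' :: "('m, 'd) chart \<Rightarrow> real^'d \<Rightarrow> real^'d"
    and \<Upsilon> :: "'m \<Rightarrow> real"
  assumes "CARD('n::finite) \<ge> 2"
    and "strictly_pseudoconvex_cr_manifold CARD('n) A T"
    and "contact_form A T \<theta>"
    and "contact_form A T \<theta>'"
    and "cr_pluriharmonic A T \<Upsilon>"
    and "\<And>c x. c \<in> A \<Longrightarrow> x \<in> chart_img c \<Longrightarrow>
           \<theta>' c x = exp (2 * \<Upsilon> (chart_inv c x)) *\<^sub>R \<theta> c x"
  shows "\<forall>p\<in>carrier_of A.
           exp (2 * real CARD('n) * \<Upsilon> p) * cr_Q_curvature TYPE('n) A T \<theta>' p
           = cr_Q_curvature TYPE('n) A T \<theta> p"
proof
  fix p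
  let ?Q = "cr_Q_values TYPE('n) A T \<theta> p" and ?Q' = "cr_Q_values TYPE('n) A T \<theta>' p"
  define e where "e = exp (2 * real CARD('n) * \<Upsilon> p)"
  have e: "e \<noteq> 0" by (simp add: e_def)
  have cr: "cr_manifold CARD('n) A T"
    using assms(2) by (simp add: strictly_pseudoconvex_cr_manifold_def)
  then have minus: "cr_pluriharmonic A T (\<lambda>q. - \<Upsilon> q)"
    using cr_pluriharmonic_minus[OF assms(5)] by (simp add: cr_manifold_def)
  have \<theta>: "\<theta> c x = exp (2 * (- \<Upsilon> (chart_inv c x))) *\<^sub>R \<theta>' c x" if "c \<in> A" "x \<in> chart_img c" for c x
    using assms(6)[OF that] by (simp add: exp_minus)
  have "q / e \<in> ?Q'" if "q \<in> ?Q" for q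
    using cr_Q_values_rescale[OF cr assms(5) assms(6) that] by (simp add: e_def exp_minus divide_inverse mult.commute)
  moreover have "e * q \<in> ?Q" if "q \<in> ?Q'" for q
    using cr_Q_values_rescale[OF cr minus \<theta> that] by (simp add: e_def)
  ultimately have Q: "?Q = (*) e ` ?Q'"
    using e by (intro equalityI subsetI image_eqI[of _ "(*) e" "_ / e"]) auto
  have "e * cr_Q_curvature TYPE('n) A T \<theta>' p = cr_Q_curvature TYPE('n) A T \<theta> p"
  proof (cases "is_singleton ?Q'")
    case True
    then obtain q where "?Q' = {q}" by (auto simp: is_singleton_def)
    then show ?thesis by (simp add: cr_Q_curvature_def Q)
  next
    case False
    \<comment> \<open>Multiplication by the nonzero \<open>e\<close> preserves being a singleton.
      Otherwise both curvatures take the default value 0, which obeys the transformation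
      law.\<close>
    have "\<not> is_singleton ?Q"
    proof
      assume "is_singleton ?Q"
      then obtain q where "(*) e ` ?Q' = {q}" by (auto simp: is_singleton_def Q)
      then have "(\<lambda>x. x / e) ` (*) e ` ?Q' = {q / e}" by simp
      then have "?Q' = {q / e}" using e by (simp add: image_image)
      then show False using False by simp
    qed
    then show ?thesis using False by (simp add: cr_Q_curvature_def)
  qed
  then show "exp (2 * real CARD('n) * \<Upsilon> p) * cr_Q_curvature TYPE('n) A T \<theta>' p
      = cr_Q_curvature TYPE('n) A T \<theta> p" by (simp add: e_def)
qed

end
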